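(* Let $d\geqslant2$ and let $\alpha$ be a mixing Noetherian entropy rank one $\mathbb{Z}^d$-action by continuous automorphisms of a compact metrizable abelian zero-dimensional group $X$. Then there is a set $Q$ of rational primes having positive (relative natural) density in the set of all rational primes such that $\{\mathsf{F}_\alpha(\Lambda):\Lambda\in\mathcal{L}_d,\ [\Lambda]\in Q\}$ is a finite set. When $d\geqslant3$, such a set $Q$ may be found with density $1$ in the set of rational primes.
   Context: $\mathcal{L}_d$ is the set of finite-index subgroups of $\mathbb{Z}^d$; $[\Lambda]=|\mathbb{Z}^d/\Lambda|$; $\mathsf{F}_\alpha(\Lambda)$ is the number of $x\in X$ fixed by $\alpha^{\mathbf{n}}$ for all $\mathbf{n}\in\Lambda$. Let $R_d=\mathbb{Z}[u_1^{\pm1},\dots,u_d^{\pm1}]$. The Pontryagin dual $M=\widehat{X}$ is an $R_d$-module, where multiplication by $u^{\mathbf{n}}=u_1^{n_1}\cdots u_d^{n_d}$ is the dual automorphism $\widehat{\alpha^{\mathbf{n}}}$; the action is Noetherian if $M$ is a Noetherian $R_d$-module. Entropy rank one means every $\alpha^{\mathbf{n}}$ has finite topological entropy. Mixing is with respect to Haar measure. *)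

theory Defs
  imports "HOL-Analysis.Analysis" "HOL-Probability.Probability" "HOL-Computational_Algebra.Primes"
begin

text \<open>The group X is the whole type 'a: a compact metrizable (class metric_space)
 abelian topological group; Z^d is int^'d with d = CARD('d).\<close>

definition zero_dim_space :: "'a::topological_space set \<Rightarrow> bool" where
  "zero_dim_space S \<longleftrightarrow> (\<forall>x\<in>S. \<forall>U. open U \<and> x \<in> U \<longrightarrow>
      (\<exists>V. open V \<and> closed V \<and> x \<in> V \<and> V \<subseteq> U))"

definition cont_aut_action :: "(int^'d \<Rightarrow> 'a::topological_ab_group_add \<Rightarrow> 'a) \<Rightarrow> bool" where
  "cont_aut_action \<alpha> \<longleftrightarrow>
     \<alpha> 0 = id \<and> (\<forall>m n. \<alpha> (m + n) = \<alpha> m \<circ> \<alpha> n) \<and>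
     (\<forall>n. bij (\<alpha> n) \<and> continuous_on UNIV (\<alpha> n) \<and> (\<forall>x y. \<alpha> n (x + y) = \<alpha> n x + \<alpha> n y))"

definition haar_measure :: "'a::topological_ab_group_add measure \<Rightarrow> bool" where
  "haar_measure \<mu> \<longleftrightarrow> prob_space \<mu> \<and> sets \<mu> = sets borel \<and>
     (\<forall>A \<in> sets borel. \<forall>x. measure \<mu> ((\<lambda>y. x + y) ` A) = measure \<mu> A)"

definition mixing_action :: "(int^'d \<Rightarrow> 'a::topological_ab_group_add \<Rightarrow> 'a) \<Rightarrow> bool" where
  "mixing_action \<alpha> \<longleftrightarrow> (\<forall>\<mu>. haar_measure \<mu> \<longrightarrow>
     (\<forall>A \<in> sets borel. \<forall>B \<in> sets borel.
        ((\<lambda>n. measure \<mu> (A \<inter> \<alpha> n -` B)) \<longlongrightarrow> measure \<mu> A * measure \<mu> B) cofinite))"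

definition separated_set :: "('a::metric_space \<Rightarrow> 'a) \<Rightarrow> nat \<Rightarrow> real \<Rightarrow> 'a set \<Rightarrow> bool" where
  "separated_set T n \<epsilon> E \<longleftrightarrow> (\<forall>x\<in>E. \<forall>y\<in>E. x \<noteq> y \<longrightarrow>
      (\<exists>k<n. dist ((T ^^ k) x) ((T ^^ k) y) > \<epsilon>))"

definition max_separated :: "('a::metric_space \<Rightarrow> 'a) \<Rightarrow> nat \<Rightarrow> real \<Rightarrow> nat" where
  "max_separated T n \<epsilon> = Sup {card E | E. finite E \<and> separated_set T n \<epsilon> E}"

definition top_entropy :: "('a::metric_space \<Rightarrow> 'a) \<Rightarrow> ereal" where
  "top_entropy T = (SUP \<epsilon>\<in>{0<..}. limsup (\<lambda>n. ereal (ln (real (max_separated T n \<epsilon>)) / real n)))"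

definition entropy_rank_one :: "(int^'d \<Rightarrow> 'a::metric_space \<Rightarrow> 'a) \<Rightarrow> bool" where
  "entropy_rank_one \<alpha> \<longleftrightarrow> (\<forall>n. top_entropy (\<alpha> n) < \<infinity>)"

text \<open>Pontryagin dual: continuous characters into the unit circle, an R_d-module
 with u^n acting by composition with alpha n.\<close>
definition characters :: "('a::topological_ab_group_add \<Rightarrow> complex) set" where
  "characters = {c. continuous_on UNIV c \<and> (\<forall>x. norm (c x) = 1) \<and>
                    (\<forall>x y. c (x + y) = c x * c y)}"

definition dual_submodule :: "(int^'d \<Rightarrow> 'a::topological_ab_group_add \<Rightarrow> 'a) \<Rightarrow> ('a \<Rightarrow> complex) set \<Rightarrow> bool" where
  "dual_submodule \<alpha> N \<longleftrightarrow> N \<subseteq> characters \<and> (\<lambda>_. 1) \<in> N \<and>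
     (\<forall>c\<in>N. \<forall>d\<in>N. (\<lambda>x. c x * d x) \<in> N) \<and>
     (\<forall>c\<in>N. (\<lambda>x. inverse (c x)) \<in> N) \<and>
     (\<forall>c\<in>N. \<forall>n. c \<circ> \<alpha> n \<in> N)"

definition dual_span :: "(int^'d \<Rightarrow> 'a::topological_ab_group_add \<Rightarrow> 'a) \<Rightarrow> ('a \<Rightarrow> complex) set \<Rightarrow> ('a \<Rightarrow> complex) set" where
  "dual_span \<alpha> S = \<Inter>{N. dual_submodule \<alpha> N \<and> S \<subseteq> N}"

definition noetherian_action :: "(int^'d \<Rightarrow> 'a::topological_ab_group_add \<Rightarrow> 'a) \<Rightarrow> bool" where
  "noetherian_action \<alpha> \<longleftrightarrow> (\<forall>N. dual_submodule \<alpha> N \<longrightarrow>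
      (\<exists>S. finite S \<and> S \<subseteq> N \<and> dual_span \<alpha> S = N))"

definition subgroup_Zd :: "(int^'d) set \<Rightarrow> bool" where
  "subgroup_Zd L \<longleftrightarrow> 0 \<in> L \<and> (\<forall>x\<in>L. \<forall>y\<in>L. x + y \<in> L) \<and> (\<forall>x\<in>L. - x \<in> L)"

definition cosets_Zd :: "(int^'d) set \<Rightarrow> (int^'d) set set" where
  "cosets_Zd L = range (\<lambda>x. (\<lambda>y. x + y) ` L)"

definition finite_index_subgroups :: "(int^'d) set set" where
  "finite_index_subgroups = {L. subgroup_Zd L \<and> finite (cosets_Zd L)}"

definition index_Zd :: "(int^'d) set \<Rightarrow> nat" where
  "index_Zd L = card (cosets_Zd L)"

definition fix_count :: "(int^'d \<Rightarrow> 'a \<Rightarrow> 'a) \<Rightarrow> (int^'d) set \<Rightarrow> enat" where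
  "fix_count \<alpha> L = (let P = {x. \<forall>n\<in>L. \<alpha> n x = x} in
      if finite P then enat (card P) else \<infinity>)"

definition prime_density :: "nat set \<Rightarrow> real \<Rightarrow> bool" where
  "prime_density Q \<delta> \<longleftrightarrow>
     (\<lambda>N. real (card {p \<in> Q. prime p \<and> p \<le> N}) / real (card {p. prime p \<and> p \<le> N}))
       \<longlonglongrightarrow> \<delta>"

end

(* For a subgroup L of prime index q, the p-part of the points fixed by L but not by all of Z^d is permuted by
   Z^d / L in orbits of length q, so q divides p ^ k - 1, where p ^ k is at most the number of points fixed by L.
   Finite entropy of a single nonzero element of the action, expansiveness (from the Noetherian hypothesis) and
   surjectivity of alpha n - 1 (from mixing) bound the number of points fixed by alpha n exponentially in the size
   of n.  Since L contains a nonzero vector of size at most sqrt q, the order of p modulo q is O(sqrt q).  Such q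
   have density 0 among the primes by the method of Erdos' multiplication table problem: q - 1 would be a product
   of two factors of order sqrt q, and typically these have too many prime factors together.  Off this set of
   primes the number of fixed points is constant, for every d >= 2. *)
theory Submission
  imports Defs "HOL-Computational_Algebra.Squarefree" "HOL-Number_Theory.Number_Theory" "HOL-Real_Asymp.Real_Asymp"
begin

section \<open>Selberg sieve\<close>

text \<open>The exponent 1/2 is exactly critical. Counting the large prime divisors of the numbers
  p^k - 1 with k \<le> C sqrt N gives O(C^2 N / ln N) primes, the order of magnitude of all primes
  up to N, and the constant is not small. The gain has to come from the order being a divisor of q -
  1. To tell typical integers from atypical ones, a fixed finite set \<open>P\<close> of primes with
  a large sum of reciprocals is enough: N tends to infinity after \<open>P\<close> is chosen, so
  primes in progressions enter only through upper bounds of Brun-Titchmarsh type. On the dynamical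
  side, a single \<alpha> n need not be expansive, so windows along its own multiples may fail to
  separate its fixed points. Windows over cubes of Z^d do separate points, but a priori their index
  is only bounded exponentially in the volume R^d. A surjective endomorphism of the form \<alpha> (m
  e) - 1, which turns a window along one line into a window in all directions, brings this down to
  an exponential in R.\<close>

lemma card_residue_class_bounds:
  fixes D r Y :: nat
  assumes "D > 0"
  shows "\<bar>real (card {n. n < Y \<and> n mod D = r mod D}) - real Y / real D\<bar> \<le> 1"
proof -
  let ?S = "{n. n < Y \<and> n mod D = r mod D}"
  have inj: "inj_on (\<lambda>n. n div D) ?S"
    by (rule inj_onI) (metis (mono_tags, lifting) div_mult_mod_eq mem_Collect_eq)
  have "card ?S = card ((\<lambda>n. n div D) ` ?S)" using card_image[OF inj] by simp
  also have "\<dots> \<le> card {..Y div D}"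
    by (rule card_mono) (auto intro: div_le_mono)
  finally have up: "card ?S \<le> Y div D + 1" by simp
  have "{..<Y div D} \<subseteq> (\<lambda>n. n div D) ` ?S"
  proof
    fix t assume "t \<in> {..<Y div D}"
    hence "Suc t \<le> Y div D" by simp
    hence "Suc t * D \<le> Y" using assms by (metis less_eq_div_iff_mult_less_eq)
    moreover have "r mod D < D" using assms by simp
    ultimately have "t * D + r mod D < Y" by simp
    moreover have "(t * D + r mod D) div D = t" "(t * D + r mod D) mod D = r mod D"
      using assms by auto
    ultimately show "t \<in> (\<lambda>n. n div D) ` ?S" by (intro image_eqI[where x="t * D + r mod D"]) auto
  qed
  hence "card {..<Y div D} \<le> card ((\<lambda>n. n div D) ` ?S)" by (intro card_mono) auto
  hence lo: "Y div D \<le> card ?S" using card_image[OF inj] by simp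
  have "\<lfloor>real Y / real D\<rfloor> = int (Y div D)" by (rule floor_divide_of_nat_eq)
  hence "real (Y div D) \<le> real Y / real D" "real Y / real D \<le> real (Y div D) + 1" by linarith+
  thus ?thesis
    using up lo by linarith
qed

text \<open>Since \<open>m\<close> is invertible modulo \<open>D\<close>, the condition singles out
  one residue class.\<close>

lemma card_dvd_linear_bounds:
  fixes D m Y :: nat
  assumes "D > 0" "coprime D m"
  shows "\<bar>real (card {n. n < Y \<and> D dvd m * n + 1}) - real Y / real D\<bar> \<le> 1"
proof -
  obtain r where r: "D dvd m * r + 1"
  proof -
    obtain x where x: "[int m * x = - 1] (mod int D)"
      using assms(2) cong_solve_coprime_int[of "int m" "int D"]
      by (metis coprime_commute coprime_int_iff cong_scalar_right mult.assoc mult_minus1_right)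
    define r where "r = nat (x mod int D)"
    have r: "int r = x mod int D" using assms by (simp add: r_def)
    have "[int m * int r = - 1] (mod int D)"
      unfolding r using x by (metis cong_def mod_mult_right_eq)
    hence "int D dvd int (m * r + 1)"
      by (simp add: cong_iff_dvd_diff add.commute)
    thus ?thesis using that by (metis int_dvd_int_iff)
  qed
  have "D dvd m * n + 1 \<longleftrightarrow> n mod D = r mod D" for n
  proof -
    have "D dvd m * n + 1 \<longleftrightarrow> int D dvd (int m * int n + 1) - (int m * int r + 1)"
    proof -
      have "int D dvd int m * int r + 1" using r by (metis int_dvd_int_iff of_nat_1 of_nat_add of_nat_mult)
      moreover have "D dvd m * n + 1 \<longleftrightarrow> int D dvd int m * int n + 1"
        by (metis int_dvd_int_iff of_nat_1 of_nat_add of_nat_mult)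
      ultimately show ?thesis by (metis diff_add_cancel dvd_add dvd_diff)
    qed
    also have "\<dots> \<longleftrightarrow> int D dvd int m * (int n - int r)" by (simp add: algebra_simps)
    also have "\<dots> \<longleftrightarrow> int D dvd int n - int r"
      using assms(2) by (simp add: coprime_dvd_mult_right_iff)
    also have "\<dots> \<longleftrightarrow> n mod D = r mod D"
      by (metis mod_eq_dvd_iff of_nat_eq_iff zmod_int)
    finally show ?thesis .
  qed
  thus ?thesis using card_residue_class_bounds[OF assms(1), of Y r] by simp
qed

lemma prod_primes_dvd_iff:
  fixes x :: nat
  assumes "finite A" "\<forall>l\<in>A. prime l"
  shows "\<Prod>A dvd x \<longleftrightarrow> (\<forall>l\<in>A. l dvd x)"
  using assms
proof (induction A rule: finite_induct)
  case (insert l A)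
  have "coprime l (\<Prod>A)"
    using insert by (intro prod_coprime_right) (auto intro: primes_coprime)
  thus ?case using insert by (auto simp: divides_mult dest: dvd_mult_left dvd_mult_right)
qed auto

lemma prod_of_bool: "finite A \<Longrightarrow> (\<Prod>x\<in>A. of_bool (P x) :: real) = of_bool (\<forall>x\<in>A. P x)"
  by (induction A rule: finite_induct) auto

lemma sum_of_bool_card:
  fixes Y :: nat
  shows "(\<Sum>n<Y. of_bool (P n) :: real) = real (card {n. n < Y \<and> P n})"
proof -
  have "(\<Sum>n<Y. of_bool (P n) :: real) = (\<Sum>n\<in>{..<Y} \<inter> {n. P n}. 1)"
    unfolding of_bool_def by (subst sum.inter_restrict) simp_all
  also have "\<dots> = real (card {n. n < Y \<and> P n})" by (simp add: Int_def)
  finally show ?thesis .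
qed

text \<open>Expanding the product over the subsets \<open>A\<close> of \<open>E\<close> reduces the
  sum to counting the n for which \<Prod>A divides \<open>m * n + 1\<close>. Each count is
  \<open>Y\<close> over \<Prod>A up to 1, so the main terms reassemble into a product, and the
  errors add up to a product that does not depend on \<open>Y\<close>.\<close>

lemma sum_prod_local_factors:
  fixes a b :: "nat \<Rightarrow> real" and m Y :: nat
  assumes "finite E" "\<forall>l\<in>E. prime l \<and> \<not> l dvd m"
  shows "\<bar>(\<Sum>n<Y. \<Prod>l\<in>E. (a l + b l * of_bool (l dvd m * n + 1))) - real Y * (\<Prod>l\<in>E. (a l + b l / real l))\<bar>
          \<le> (\<Prod>l\<in>E. (\<bar>a l\<bar> + \<bar>b l\<bar>))"
proof -
  let ?c = "\<lambda>A. prod b A * prod a (E - A)"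
  let ?N = "\<lambda>A. real (card {n. n < Y \<and> \<Prod>A dvd m * n + 1})"
  have fA: "finite A" "\<forall>l\<in>A. prime l" if "A \<in> Pow E" for A using that assms by (auto intro: finite_subset)
  have "(\<Sum>n<Y. \<Prod>l\<in>E. (a l + b l * of_bool (l dvd m * n + 1)))
      = (\<Sum>n<Y. \<Sum>A\<in>Pow E. ?c A * of_bool (\<Prod>A dvd m * n + 1))"
  proof (intro sum.cong refl)
    fix n
    have "(\<Prod>l\<in>E. (a l + b l * of_bool (l dvd m * n + 1))) = (\<Prod>l\<in>E. (b l * of_bool (l dvd m * n + 1) + a l))"
      by (simp add: add.commute)
    also have "\<dots> = (\<Sum>A\<in>Pow E. (\<Prod>l\<in>A. b l * of_bool (l dvd m * n + 1)) * prod a (E - A))"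
      by (rule prod_add[OF assms(1)])
    also have "\<dots> = (\<Sum>A\<in>Pow E. ?c A * of_bool (\<Prod>A dvd m * n + 1))"
    proof (intro sum.cong refl)
      fix A assume "A \<in> Pow E"
      note f = fA[OF this]
      show "(\<Prod>l\<in>A. b l * of_bool (l dvd m * n + 1)) * prod a (E - A) = ?c A * of_bool (\<Prod>A dvd m * n + 1)"
        unfolding prod.distrib prod_of_bool[OF f(1)] prod_primes_dvd_iff[OF f] by simp
    qed
    finally show "(\<Prod>l\<in>E. (a l + b l * of_bool (l dvd m * n + 1))) = (\<Sum>A\<in>Pow E. ?c A * of_bool (\<Prod>A dvd m * n + 1))" .
  qed
  also have "\<dots> = (\<Sum>A\<in>Pow E. ?c A * (\<Sum>n<Y. of_bool (\<Prod>A dvd m * n + 1)))"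
    by (subst sum.swap) (simp only: sum_distrib_left)
  also have "\<dots> = (\<Sum>A\<in>Pow E. ?c A * ?N A)"
    by (simp only: sum_of_bool_card)
  finally have 1: "(\<Sum>n<Y. \<Prod>l\<in>E. (a l + b l * of_bool (l dvd m * n + 1))) = (\<Sum>A\<in>Pow E. ?c A * ?N A)" .
  have "(\<Prod>l\<in>E. (a l + b l / real l)) = (\<Prod>l\<in>E. (b l / real l + a l))" by (simp add: add.commute)
  also have "\<dots> = (\<Sum>A\<in>Pow E. (\<Prod>l\<in>A. b l / real l) * prod a (E - A))"
    by (rule prod_add[OF assms(1)])
  also have "\<dots> = (\<Sum>A\<in>Pow E. ?c A / real (\<Prod>A))"
    by (intro sum.cong refl) (simp add: prod_dividef)
  finally have 2: "real Y * (\<Prod>l\<in>E. (a l + b l / real l)) = (\<Sum>A\<in>Pow E. ?c A * (real Y / real (\<Prod>A)))"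
    by (simp add: sum_distrib_left mult_ac)
  have "\<bar>(\<Sum>A\<in>Pow E. ?c A * ?N A) - (\<Sum>A\<in>Pow E. ?c A * (real Y / real (\<Prod>A)))\<bar>
       = \<bar>\<Sum>A\<in>Pow E. ?c A * (?N A - real Y / real (\<Prod>A))\<bar>"
    by (simp add: sum_subtractf right_diff_distrib)
  also have "\<dots> \<le> (\<Sum>A\<in>Pow E. \<bar>?c A\<bar> * 1)"
  proof (rule order_trans[OF sum_abs], rule sum_mono)
    fix A assume A: "A \<in> Pow E"
    note f = fA[OF A]
    have "\<Prod>A > 0" using f by (auto intro!: prod_pos prime_gt_0_nat)
    moreover have "coprime (\<Prod>A) m"
      using A assms by (intro prod_coprime_left) (auto intro: prime_imp_coprime)
    ultimately have "\<bar>?N A - real Y / real (\<Prod>A)\<bar> \<le> 1" by (rule card_dvd_linear_bounds)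
    thus "\<bar>?c A * (?N A - real Y / real (\<Prod>A))\<bar> \<le> \<bar>?c A\<bar> * 1"
      unfolding abs_mult by (intro mult_left_mono) auto
  qed
  also have "\<dots> = (\<Sum>A\<in>Pow E. (\<Prod>l\<in>A. \<bar>b l\<bar>) * (\<Prod>l\<in>E-A. \<bar>a l\<bar>))"
    by (simp add: abs_mult abs_prod)
  also have "\<dots> = (\<Prod>l\<in>E. (\<bar>b l\<bar> + \<bar>a l\<bar>))"
    by (rule prod_add[OF assms(1), symmetric])
  finally show ?thesis unfolding 1 2 by (simp add: add.commute)
qed

text \<open>Squarefree integers are represented by their sets of prime factors.\<close>
definition sieve_sets :: "nat \<Rightarrow> nat \<Rightarrow> nat set set" where
  "sieve_sets m z = {E. finite E \<and> (\<forall>l\<in>E. prime l \<and> \<not> l dvd m) \<and> \<Prod>E \<le> z}"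

text \<open>Selberg's sum over the squarefree k \<le> z prime to \<open>m\<close>, with 1/k in place
  of the optimal 1/phi(k); the smaller sum suffices and is easier to bound from below.\<close>

definition sieve_sum :: "nat \<Rightarrow> nat \<Rightarrow> real" where
  "sieve_sum m z = (\<Sum>E\<in>sieve_sets m z. 1 / real (\<Prod>E))"

lemma inj_on_prod_primes: "inj_on \<Prod> {E :: nat set. finite E \<and> (\<forall>l\<in>E. prime l)}"
proof (rule inj_onI)
  fix E F :: "nat set"
  assume E: "E \<in> {E. finite E \<and> (\<forall>l\<in>E. prime l)}" and F: "F \<in> {E. finite E \<and> (\<forall>l\<in>E. prime l)}"
    and eq: "\<Prod>E = \<Prod>F"
  have *: "G = {l. prime l \<and> l dvd \<Prod>G}" if "G \<in> {E. finite E \<and> (\<forall>l\<in>E. prime l)}" for G :: "nat set"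
  proof -
    have "prime l \<Longrightarrow> l dvd \<Prod>G \<longleftrightarrow> (\<exists>x\<in>G. l dvd x)" for l
      using that by (subst prime_dvd_prod_iff) simp_all
    thus ?thesis using that primes_dvd_imp_eq by blast
  qed
  show "E = F" using *[OF E] *[OF F] eq by simp
qed

lemma prod_primes_pos: "finite E \<Longrightarrow> (\<forall>l\<in>E. prime l) \<Longrightarrow> 0 < \<Prod>(E :: nat set)"
  by (auto intro!: prod_pos prime_gt_0_nat)

lemma sieve_sets_finite_card: "finite (sieve_sets m z)" "card (sieve_sets m z) \<le> z"
proof -
  have sub: "\<Prod> ` sieve_sets m z \<subseteq> {1..z}"
  proof
    fix x assume "x \<in> \<Prod> ` sieve_sets m z"
    then obtain E where "x = \<Prod>E" "finite E" "\<forall>l\<in>E. prime l" "\<Prod>E \<le> z"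
      unfolding sieve_sets_def by blast
    thus "x \<in> {1..z}" using prod_primes_pos[of E] by (simp del: prod_pos_nat_iff add: Suc_le_eq)
  qed
  have inj: "inj_on \<Prod> (sieve_sets m z)"
    by (rule inj_on_subset[OF inj_on_prod_primes]) (auto simp: sieve_sets_def)
  show "finite (sieve_sets m z)"
    using finite_subset[OF sub] inj finite_imageD by blast
  show "card (sieve_sets m z) \<le> z"
    using card_mono[OF _ sub] card_image[OF inj] by simp
qed

lemma sieve_sum_ge_1:
  assumes "z \<ge> 1" shows "sieve_sum m z \<ge> 1"
proof -
  have "{{}} \<subseteq> sieve_sets m z" using assms by (auto simp: sieve_sets_def)
  hence "(\<Sum>E\<in>{{}}. 1 / real (\<Prod>E)) \<le> sieve_sum m z"
    unfolding sieve_sum_def by (intro sum_mono2 sieve_sets_finite_card) (auto intro: prod_nonneg)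
  thus ?thesis by simp
qed

text \<open>Bounds the weight of a set \<open>E\<close> in the error term of the sieve, through l +
  1 \<le> l^2 for every prime l.\<close>

lemma prod_one_plus_le:
  assumes "finite E" "\<forall>l\<in>E. prime (l::nat)"
  shows "(\<Prod>l\<in>E. real l + 1) / real (\<Prod>E) \<le> real (\<Prod>E)"
proof -
  have "(\<Prod>l\<in>E. real l + 1) \<le> (\<Prod>l\<in>E. real l * real l)"
  proof (rule prod_mono, intro conjI)
    fix l assume "l \<in> E"
    hence "l \<ge> 2" using assms prime_ge_2_nat by auto
    hence "real l \<ge> 2" by simp
    thus "real l + 1 \<le> real l * real l" using mult_right_mono[of 2 "real l" "real l"] by linarith
  qed auto
  also have "\<dots> = real (\<Prod>E) * real (\<Prod>E)" by (simp add: prod.distrib)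
  finally have "(\<Prod>l\<in>E. real l + 1) \<le> real (\<Prod>E) * real (\<Prod>E)" .
  moreover have "real (\<Prod>E) > 0" using prod_primes_pos[OF assms] by (simp only: of_nat_0_less_iff)
  ultimately show ?thesis by (simp only: divide_le_eq if_True)
qed

text \<open>The functions \<open>\<psi> E\<close> below are orthogonal on average. Their combination \<open>F\<close> takes the
  constant value \<open>sieve_sum m z\<close> on the sifted set, and its mean square is the same sum, so
  Chebyshev's inequality bounds the sifted set.\<close>
lemma selberg_sieve:
  fixes m z Y :: nat
  assumes z: "z \<ge> 1"
  shows "real (card {n. n < Y \<and> (\<forall>l. prime l \<and> l \<le> z \<longrightarrow> \<not> l dvd m * n + 1)})
           \<le> real Y / sieve_sum m z + real z ^ 4"
proof -
  define \<psi> where "\<psi> = (\<lambda>E n. \<Prod>l\<in>E. (- 1 + real l * of_bool (l dvd m * n + 1)))"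
  define w where "w = (\<lambda>E::nat set. (- 1) ^ card E / real (\<Prod>E))"
  define F where "F = (\<lambda>n. \<Sum>E\<in>sieve_sets m z. w E * \<psi> E n)"
  define S where "S = sieve_sum m z"
  let ?T = "{n. n < Y \<and> (\<forall>l. prime l \<and> l \<le> z \<longrightarrow> \<not> l dvd m * n + 1)}"
  let ?Q = "sieve_sets m z"
  note fin = sieve_sets_finite_card(1)[of m z]
  have EQ: "finite E" "\<forall>l\<in>E. prime l" "\<forall>l\<in>E. prime l \<and> \<not> l dvd m" "\<Prod>E \<le> z" "\<Prod>E > 0" if "E \<in> ?Q" for E
    using that prod_primes_pos[of E] by (auto simp: sieve_sets_def)
  have le_z: "l \<le> z" if "E \<in> ?Q" "l \<in> E" for E l
  proof -
    have "l dvd \<Prod>E" using that EQ by (intro dvd_prodI[where f="\<lambda>x. x", simplified]) auto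
    hence "l \<le> \<Prod>E" using EQ(5)[OF that(1)] by (rule dvd_imp_le)
    thus ?thesis using EQ(4)[OF that(1)] by simp
  qed
  have S1: "S \<ge> 1" unfolding S_def by (rule sieve_sum_ge_1[OF z])
  have FT: "F n = S" if "n \<in> ?T" for n
  proof -
    have "w E * \<psi> E n = 1 / real (\<Prod>E)" if E: "E \<in> ?Q" for E
    proof -
      have "\<not> l dvd m * n + 1" if "l \<in> E" for l
        using \<open>n \<in> ?T\<close> EQ(2)[OF E] le_z[OF E that] that by blast
      hence "\<psi> E n = (\<Prod>l\<in>E. - 1)" unfolding \<psi>_def
        by (intro prod.cong refl) simp
      hence "\<psi> E n = (- 1) ^ card E" by simp
      thus ?thesis by (simp add: w_def flip: power_mult_distrib)
    qed
    thus ?thesis by (simp add: F_def S_def sieve_sum_def)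
  qed
  have corr: "\<bar>(\<Sum>n<Y. \<psi> E n * \<psi> E' n) - real Y * (if E = E' then \<Prod>l\<in>E. (real l - 1) else 0)\<bar>
         \<le> (\<Prod>l\<in>E. real l + 1) * (\<Prod>l\<in>E'. real l + 1)" if E: "E \<in> ?Q" and E': "E' \<in> ?Q" for E E'
  proof -
    let ?U = "E \<union> E'"
    \<comment> \<open>At a common prime the local factor is a square, (-1 + l t)^2 = 1 + (l^2 - 2 l)
      t for t in {0, 1}; at the others it is -1 + l t, whose mean -1 + l / l vanishes. This is the
      orthogonality.\<close>
    define a b where "a = (\<lambda>l. if l \<in> E \<inter> E' then 1 else - 1 :: real)"
      and "b = (\<lambda>l. if l \<in> E \<inter> E' then real l ^ 2 - 2 * real l else real l)"
    have fU: "finite ?U" using EQ E E' by auto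
    have ext: "(\<Prod>l\<in>E. f l) = (\<Prod>l\<in>?U. if l \<in> E then f l else 1)"
              "(\<Prod>l\<in>E'. f l) = (\<Prod>l\<in>?U. if l \<in> E' then f l else 1)" for f :: "nat \<Rightarrow> real"
      using prod.inter_restrict[OF fU, of f E] prod.inter_restrict[OF fU, of f E'] by (simp_all add: Int_absorb1 Int_absorb2)
    have p1: "\<psi> E n * \<psi> E' n = (\<Prod>l\<in>?U. (a l + b l * of_bool (l dvd m * n + 1)))" for n
      unfolding \<psi>_def ext prod.distrib[symmetric]
      by (intro prod.cong refl) (auto simp: a_def b_def power2_eq_square algebra_simps)
    have p2: "(\<Prod>l\<in>?U. (a l + b l / real l)) = (if E = E' then \<Prod>l\<in>E. (real l - 1) else 0)"
    proof (cases "E = E'")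
      case True
      have "a l + b l / real l = real l - 1" if "l \<in> E" for l
      proof -
        have "real l > 0" using that EQ(2)[OF E] prime_gt_0_nat by auto
        thus ?thesis using that True by (simp add: a_def b_def power2_eq_square diff_divide_distrib)
      qed
      thus ?thesis using True by auto
    next
      case False
      then obtain l where l: "l \<in> ?U" "l \<notin> E \<inter> E'" by blast
      hence "real l > 0" using EQ(2)[OF E] EQ(2)[OF E'] prime_gt_0_nat by auto
      hence "a l + b l / real l = 0" using l by (auto simp: a_def b_def)
      hence "(\<Prod>l\<in>?U. (a l + b l / real l)) = 0" using l(1) by (intro prod_zero[OF fU] bexI[of _ l])
      thus ?thesis using False by simp
    qed
    have p3: "(\<Prod>l\<in>?U. (\<bar>a l\<bar> + \<bar>b l\<bar>)) \<le> (\<Prod>l\<in>E. real l + 1) * (\<Prod>l\<in>E'. real l + 1)"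
      unfolding ext prod.distrib[symmetric]
    proof (rule prod_mono, intro conjI)
      fix l assume l: "l \<in> ?U"
      hence "l \<ge> 2" using EQ(2)[OF E] EQ(2)[OF E'] prime_ge_2_nat by auto
      hence l2: "real l \<ge> 2" by simp
      hence "real l ^ 2 - 2 * real l \<ge> 0" by (simp add: power2_eq_square)
      thus "\<bar>a l\<bar> + \<bar>b l\<bar> \<le> (if l \<in> E then real l + 1 else 1) * (if l \<in> E' then real l + 1 else 1)"
        using l l2 by (auto simp: a_def b_def power2_eq_square algebra_simps)
    qed auto
    have "\<forall>l\<in>?U. prime l \<and> \<not> l dvd m" using EQ(3)[OF E] EQ(3)[OF E'] by blast
    from sum_prod_local_factors[OF fU this, of a b Y] p3 show ?thesis
      unfolding p1[symmetric] p2 by (rule order_trans)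
  qed
  have absw: "\<bar>w E\<bar> = 1 / real (\<Prod>E)" for E by (simp add: w_def abs_divide power_abs prod_nonneg)
  \<comment> \<open>The product of l + 1 weighted with the absolute value of \<open>w E\<close>; the
    errors of all pairs add up to the square of its sum.\<close>
  define R where "R = (\<lambda>E. (\<Prod>l\<in>E. real l + 1) / real (\<Prod>E))"
  have Rz: "0 \<le> R E" "R E \<le> real z" if "E \<in> ?Q" for E
  proof -
    show "0 \<le> R E" by (auto simp: R_def intro!: divide_nonneg_nonneg prod_nonneg)
    have "R E \<le> real (\<Prod>E)" unfolding R_def by (rule prod_one_plus_le) (use EQ that in auto)
    also have "\<dots> \<le> real z" using EQ(4)[OF that] by (rule of_nat_mono)
    finally show "R E \<le> real z" .
  qed
  have diag: "(w E)\<^sup>2 * (\<Prod>l\<in>E. (real l - 1)) \<le> 1 / real (\<Prod>E)" if E: "E \<in> ?Q" for E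
  proof -
    have "(\<Prod>l\<in>E. (real l - 1)) \<le> (\<Prod>l\<in>E. real l)"
      using EQ(2)[OF E] prime_ge_1_nat by (intro prod_mono) auto
    hence "(w E)\<^sup>2 * (\<Prod>l\<in>E. (real l - 1)) \<le> (w E)\<^sup>2 * real (\<Prod>E)"
      by (intro mult_left_mono) auto
    also have "(w E)\<^sup>2 * real (\<Prod>E) = (1 / real (\<Prod>E))\<^sup>2 * real (\<Prod>E)"
      unfolding absw[symmetric] by simp
    also have "\<dots> = 1 / real (\<Prod>E)"
    proof -
      have "(1 / x)\<^sup>2 * x = 1 / x" if "x > 0" for x :: real using that by (simp add: power2_eq_square)
      moreover have "real (\<Prod>E) > 0" using EQ(5)[OF E] by (simp only: of_nat_0_less_iff)
      ultimately show ?thesis .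
    qed
    finally show ?thesis .
  qed
  have "real (card ?T) * S\<^sup>2 = (\<Sum>n\<in>?T. (F n)\<^sup>2)" using FT by simp
  also have "\<dots> \<le> (\<Sum>n<Y. (F n)\<^sup>2)" by (intro sum_mono2) auto
  also have "\<dots> = (\<Sum>n<Y. \<Sum>E\<in>?Q. \<Sum>E'\<in>?Q. w E * w E' * (\<psi> E n * \<psi> E' n))"
    by (simp add: F_def power2_eq_square sum_product mult_ac)
  also have "\<dots> = (\<Sum>E\<in>?Q. \<Sum>E'\<in>?Q. w E * w E' * (\<Sum>n<Y. \<psi> E n * \<psi> E' n))"
    by (subst sum.swap, intro sum.cong refl, subst sum.swap) (simp add: sum_distrib_left)
  also have "\<dots> \<le> (\<Sum>E\<in>?Q. \<Sum>E'\<in>?Q. (if E = E' then real Y / real (\<Prod>E) else 0) + R E * R E')"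
  proof (intro sum_mono)
    fix E E' assume E: "E \<in> ?Q" and E': "E' \<in> ?Q"
    let ?s = "\<Sum>n<Y. \<psi> E n * \<psi> E' n"
    let ?m = "real Y * (if E = E' then \<Prod>l\<in>E. (real l - 1) else 0)"
    have "w E * w E' * ?s = w E * w E' * ?m + w E * w E' * (?s - ?m)" by (simp add: algebra_simps)
    also have "w E * w E' * ?m \<le> (if E = E' then real Y / real (\<Prod>E) else 0)"
      using mult_left_mono[OF diag[OF E], of "real Y"] by (auto simp: power2_eq_square mult_ac)
    also have "w E * w E' * (?s - ?m) \<le> \<bar>w E\<bar> * \<bar>w E'\<bar> * \<bar>?s - ?m\<bar>"
      by (rule order_trans[OF abs_ge_self]) (simp add: abs_mult)
    also have "\<dots> \<le> \<bar>w E\<bar> * \<bar>w E'\<bar> * ((\<Prod>l\<in>E. real l + 1) * (\<Prod>l\<in>E'. real l + 1))"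
      by (intro mult_left_mono corr E E') auto
    also have "\<dots> = R E * R E'" unfolding absw R_def by simp
    finally show "w E * w E' * ?s \<le> (if E = E' then real Y / real (\<Prod>E) else 0) + R E * R E'" by simp
  qed
  also have "\<dots> = real Y * S + (\<Sum>E\<in>?Q. R E)\<^sup>2"
  proof -
    have "(\<Sum>E\<in>?Q. \<Sum>E'\<in>?Q. if E = E' then real Y / real (\<Prod>E) else 0) = real Y * S"
      using fin by (simp add: S_def sieve_sum_def sum_distrib_left)
    thus ?thesis by (simp only: sum.distrib power2_eq_square sum_product)
  qed
  \<comment> \<open>There are at most \<open>z\<close> sets, each of weight at most
    \<open>z\<close>.\<close>
  also have "(\<Sum>E\<in>?Q. R E)\<^sup>2 \<le> (real z * real z)\<^sup>2"
  proof (rule power_mono)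
    have "(\<Sum>E\<in>?Q. R E) \<le> real (card ?Q) * real z" by (rule sum_bounded_above) (rule Rz)
    also have "\<dots> \<le> real z * real z" using sieve_sets_finite_card(2) by (intro mult_right_mono) auto
    finally show "(\<Sum>E\<in>?Q. R E) \<le> real z * real z" .
  qed (intro sum_nonneg Rz)
  finally have "real (card ?T) * S\<^sup>2 \<le> real Y * S + real z ^ 4"
    by (simp add: power2_eq_square eval_nat_numeral mult_ac)
  hence "real (card ?T) \<le> (real Y * S + real z ^ 4) / S\<^sup>2" using S1 by (simp add: le_divide_eq)
  also have "\<dots> = real Y / S + real z ^ 4 / S\<^sup>2"
    using S1 by (simp add: add_divide_distrib power2_eq_square)
  also have "real z ^ 4 / S\<^sup>2 \<le> real z ^ 4 / 1"
    using S1 by (intro divide_left_mono) (auto simp: one_le_power)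
  finally show ?thesis by (simp add: S_def)
qed

text \<open>This is sigma(m) / m. It stands in for m / phi(m), from which it differs by a bounded
  factor only, and is easier to average over m.\<close>

definition sum_inv_divisors :: "nat \<Rightarrow> real" where
  "sum_inv_divisors m = (\<Sum>d | d dvd m. 1 / real d)"

lemma sum_inv_divisors_ge_1:
  assumes "m > 0" shows "sum_inv_divisors m \<ge> 1"
proof -
  have "(\<Sum>d\<in>{1}. 1 / real d) \<le> sum_inv_divisors m"
    unfolding sum_inv_divisors_def by (rule sum_mono2) (use assms in auto)
  thus ?thesis by simp
qed

lemma prod_prime_factors_squarefree:
  assumes "squarefree (e::nat)" shows "\<Prod>(prime_factors e) = e"
proof -
  have e: "e \<noteq> 0" using assms by (metis not_squarefree_0)
  have "e = (\<Prod>p\<in>prime_factors e. p ^ multiplicity p e)"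
    using e by (simp add: prod_prime_factors)
  also have "\<dots> = (\<Prod>p\<in>prime_factors e. p)"
    using assms e by (intro prod.cong refl) (auto simp: squarefree_factorial_semiring')
  finally show ?thesis by simp
qed

lemma sum_inverse_squares_le: "(\<Sum>j=1..z. 1 / real j ^ 2) \<le> 2"
proof -
  have "(\<Sum>j=1..Suc z. 1 / real j ^ 2) \<le> 2 - 1 / real (Suc z)" for z
  proof (induction z)
    case (Suc z)
    have "1 / real (Suc (Suc z)) ^ 2 \<le> 1 / (real (Suc z) * real (Suc (Suc z)))"
      unfolding power2_eq_square by (intro divide_left_mono mult_right_mono) auto
    also have "\<dots> = 1 / real (Suc z) - 1 / real (Suc (Suc z))" by (simp add: field_simps)
    finally have "1 / real (Suc (Suc z)) ^ 2 \<le> 1 / real (Suc z) - 1 / real (Suc (Suc z))" .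
    thus ?case using Suc by simp
  qed simp
  from order_trans[OF this, of "z - 1" 2] show ?thesis by (cases z) auto
qed

text \<open>Every n up to z is \<open>j\<^sup>2 * d * \<Prod>E\<close> with d dividing m and the primes of E not dividing m.\<close>
lemma ln_le_sieve_sum:
  assumes "m > 0"
  shows "ln (real z + 1) \<le> 2 * sum_inv_divisors m * sieve_sum m z"
proof -
  define j where "j = (\<lambda>n::nat. square_part n)"
  define P where "P = (\<lambda>n::nat. prime_factors (squarefree_part n))"
  define d where "d = (\<lambda>n. \<Prod>(P n \<inter> {p. p dvd m}))"
  define E where "E = (\<lambda>n. P n - {p. p dvd m})"
  define g where "g = (\<lambda>n. (j n, d n, E n))"
  define h where "h = (\<lambda>(j, d, E). 1 / real j ^ 2 * (1 / real d * (1 / real (\<Prod>E :: nat))))"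
  let ?A = "{1..z} \<times> {d. d dvd m} \<times> sieve_sets m z"
  have finP: "finite (P n)" for n by (simp add: P_def)
  have dec: "n = j n ^ 2 * (d n * \<Prod>(E n))" for n
  proof -
    have "d n * \<Prod>(E n) = \<Prod>(P n)"
      unfolding d_def E_def by (rule prod.Int_Diff[OF finP, symmetric])
    also have "\<dots> = squarefree_part n"
      unfolding P_def by (rule prod_prime_factors_squarefree) simp
    finally show ?thesis using squarefree_decompose[of n] by (simp add: j_def mult.commute)
  qed
  have pE: "\<forall>p\<in>E n. prime p \<and> \<not> p dvd m" for n by (auto simp: E_def P_def)
  have gA: "g n \<in> ?A" if n: "n \<in> {1..z}" for n
  proof -
    have dm: "d n dvd m" unfolding d_def
      using finP[of n] by (subst prod_primes_dvd_iff) (auto simp: P_def)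
    have "j n ^ 2 * (d n * \<Prod>(E n)) \<noteq> 0" using dec[of n] n by (metis atLeastAtMost_iff not_one_le_zero)
    hence nz: "j n \<noteq> 0" by simp
    have "\<Prod>(E n) dvd j n ^ 2 * (d n * \<Prod>(E n))" by simp
    hence "\<Prod>(E n) dvd n" by (simp only: dec[of n, symmetric])
    hence "\<Prod>(E n) \<le> z" using dvd_imp_le[of "\<Prod>(E n)" n] n by auto
    moreover have "finite (E n)" by (simp add: E_def finP)
    ultimately have "E n \<in> sieve_sets m z" using pE[of n] unfolding sieve_sets_def by blast
    moreover have "j n dvd j n ^ 2 * (d n * \<Prod>(E n))" by (simp add: power2_eq_square)
    hence "j n dvd n" by (simp only: dec[of n, symmetric])
    hence "j n \<le> z" using dvd_imp_le[of "j n" n] n by auto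
    ultimately show ?thesis using nz dm by (simp add: g_def)
  qed
  have hg: "h (g n) = 1 / real n" for n
  proof -
    have "real n = real (j n ^ 2 * (d n * \<Prod>(E n)))" by (rule arg_cong[OF dec[of n]])
    thus ?thesis by (simp add: h_def g_def)
  qed
  have inj: "inj_on g {1..z}"
  proof (rule inj_onI)
    fix n n' assume "g n = g n'"
    hence "j n ^ 2 * (d n * \<Prod>(E n)) = j n' ^ 2 * (d n' * \<Prod>(E n'))" by (simp add: g_def)
    thus "n = n'" by (simp only: dec[symmetric])
  qed
  have fin: "finite ?A" using assms sieve_sets_finite_card by auto
  have "ln (real z + 1) \<le> harm z" by (rule harm_ge_ln)
  also have "\<dots> = (\<Sum>n\<in>{1..z}. h (g n))" by (simp add: hg harm_def inverse_eq_divide)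
  also have "\<dots> = (\<Sum>t\<in>g ` {1..z}. h t)" by (rule sum.reindex[OF inj, symmetric, unfolded o_def])
  \<comment> \<open>The decomposition is injective, so the sum over its image may be extended to the
    whole box \<open>?A\<close>, where it splits into a product of three sums.\<close>
  also have "\<dots> \<le> (\<Sum>t\<in>?A. h t)"
  proof (rule sum_mono2[OF fin])
    show "g ` {1..z} \<subseteq> ?A" using gA by blast
  qed (auto simp: h_def intro!: mult_nonneg_nonneg divide_nonneg_nonneg prod_nonneg)
  also have "\<dots> = (\<Sum>j\<in>{1..z}. \<Sum>d | d dvd m. \<Sum>E\<in>sieve_sets m z. 1 / real j ^ 2 * (1 / real d * (1 / real (\<Prod>E))))"
    by (simp only: h_def sum.cartesian_product[symmetric] prod.case)
  also have "\<dots> = (\<Sum>j\<in>{1..z}. 1 / real j ^ 2 * (\<Sum>d | d dvd m. 1 / real d * sieve_sum m z))"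
    by (simp only: sum_distrib_left sieve_sum_def)
  also have "\<dots> = (\<Sum>j\<in>{1..z}. 1 / real j ^ 2) * (sum_inv_divisors m * sieve_sum m z)"
    by (simp only: sum_inv_divisors_def sum_distrib_right)
  also have "\<dots> \<le> 2 * (sum_inv_divisors m * sieve_sum m z)"
    using sum_inv_divisors_ge_1[OF assms]
    by (intro mult_right_mono sum_inverse_squares_le mult_nonneg_nonneg)
      (auto simp: sieve_sum_def intro!: sum_nonneg divide_nonneg_nonneg prod_nonneg)
  finally show ?thesis by simp
qed

text \<open>A prime q = m n + 1 above \<open>z\<close> has no prime factor up to \<open>z\<close>,
  so n survives the sieve; the primes up to \<open>z\<close> account for the separate summand
  \<open>z\<close>.\<close>

lemma brun_titchmarsh_finite:
  fixes N m z :: nat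
  assumes m: "m > 0" and z: "z \<ge> 1"
  shows "real (card {q. prime q \<and> q \<le> N \<and> m dvd q - 1})
    \<le> (real N / real m + 1) * (2 * sum_inv_divisors m) / ln (real z + 1) + real z + real z ^ 4"
proof -
  define Y where "Y = N div m + 1"
  let ?T = "{n. n < Y \<and> (\<forall>l. prime l \<and> l \<le> z \<longrightarrow> \<not> l dvd m * n + 1)}"
  have sub: "{q. prime q \<and> q \<le> N \<and> m dvd q - 1} \<subseteq> {1..z} \<union> (\<lambda>n. m * n + 1) ` ?T"
  proof
    fix q assume "q \<in> {q. prime q \<and> q \<le> N \<and> m dvd q - 1}"
    hence q: "prime q" "q \<le> N" "m dvd q - 1" by auto
    have q1: "q \<ge> 1" using q(1) by (rule prime_ge_1_nat)
    obtain n where n: "q - 1 = m * n" using q(3) by (elim dvdE)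
    hence qn: "q = m * n + 1" using q1 by simp
    have "m * n \<le> N" using qn q(2) by simp
    hence "n \<le> N div m" using m by (simp add: less_eq_div_iff_mult_less_eq mult.commute)
    hence nY: "n < Y" by (simp add: Y_def)
    show "q \<in> {1..z} \<union> (\<lambda>n. m * n + 1) ` ?T"
    proof (cases "q \<le> z")
      case False
      have "\<not> l dvd q" if "prime l" "l \<le> z" for l
        using primes_dvd_imp_eq[OF that(1) q(1)] that(2) False by auto
      hence "n \<in> ?T" using nY qn by auto
      thus ?thesis using qn by blast
    qed (use q1 in auto)
  qed
  have finT: "finite ?T" by simp
  have "card {q. prime q \<and> q \<le> N \<and> m dvd q - 1} \<le> card ({1..z} \<union> (\<lambda>n. m * n + 1) ` ?T)"
    using sub finT by (intro card_mono) auto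
  also have "\<dots> \<le> card {1..z} + card ((\<lambda>n. m * n + 1) ` ?T)" by (rule card_Un_le)
  also have "card ((\<lambda>n. m * n + 1) ` ?T) \<le> card ?T" by (rule card_image_le[OF finT])
  finally have "real (card {q. prime q \<and> q \<le> N \<and> m dvd q - 1}) \<le> real z + real (card ?T)" by simp
  also have "real (card ?T) \<le> real Y / sieve_sum m z + real z ^ 4" by (rule selberg_sieve[OF z])
  also have "real Y / sieve_sum m z \<le> (real N / real m + 1) * (2 * sum_inv_divisors m) / ln (real z + 1)"
  proof -
    have S: "sieve_sum m z \<ge> 1" by (rule sieve_sum_ge_1[OF z])
    have L: "ln (real z + 1) > 0" using z by simp
    have s: "sum_inv_divisors m \<ge> 1" by (rule sum_inv_divisors_ge_1[OF m])
    have "real (N div m) \<le> real N / real m" by (simp add: of_nat_div_le_of_nat)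
    hence "real Y \<le> real N / real m + 1" by (simp add: Y_def)
    hence "real Y / sieve_sum m z \<le> (real N / real m + 1) * (1 / sieve_sum m z)"
      using S by (simp add: divide_right_mono)
    also have "1 / sieve_sum m z \<le> 2 * sum_inv_divisors m / ln (real z + 1)"
      using ln_le_sieve_sum[OF m, of z] S L by (simp add: field_simps)
    finally show ?thesis by (simp add: mult_left_mono)
  qed
  finally show ?thesis by simp
qed

text \<open>With z near N^(1/16), the term z^4 is at most N^(1/4), negligible against N / (m ln N)
  for m of order sqrt N. The loss of 16 in ln z and the factor 2 of the sieve give 32; the rounding
  term added to N / m and the term z + z^4 cost half a unit each.\<close>

lemma brun_titchmarsh:
  fixes C :: real
  assumes C: "C > 0"
  shows "\<forall>\<^sub>F N in sequentially. \<forall>m. m > 0 \<and> real m \<le> C * sqrt (real N) \<longrightarrow>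
    real (card {q. prime q \<and> q \<le> N \<and> m dvd q - 1}) \<le> 33 * sum_inv_divisors m * (real N / (real m * ln (real N)))"
proof -
  have 1: "\<forall>\<^sub>F N in sequentially. 2 * real N powr (1/4) \<le> sqrt (real N) / (2 * C * ln (real N))"
    using C by real_asymp
  have 2: "\<forall>\<^sub>F N in sequentially. 64 * C * sqrt (real N) \<le> real N"
    using C by real_asymp
  have 3: "\<forall>\<^sub>F N in sequentially. 3 \<le> (N::nat)" by (rule eventually_ge_at_top)
  show ?thesis using 1 2 3
  proof eventually_elim
    case (elim N)
    show ?case
    proof (intro allI impI, elim conjE)
      fix m :: nat assume m: "m > 0" "real m \<le> C * sqrt (real N)"
      define z where "z = nat \<lfloor>real N powr (1/16)\<rfloor>"
      define s where "s = sum_inv_divisors m"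
      define M where "M = real N / (real m * ln (real N))"
      have N: "real N \<ge> 3" using elim by simp
      have lnN: "ln (real N) > 0" using N by simp
      have zge: "real N powr (1/16) \<ge> 1" using N by (simp add: ge_one_powr_ge_zero)
      have z1: "z \<ge> 1" using zge by (simp add: z_def le_nat_floor)
      have zu: "real z \<le> real N powr (1/16)" using zge by (simp add: z_def)
      have "real N powr (1/16) \<le> real z + 1" unfolding z_def using zge by linarith
      hence "ln (real N powr (1/16)) \<le> ln (real z + 1)" using zge N by (subst ln_le_cancel_iff) auto
      hence lz: "ln (real N) / 16 \<le> ln (real z + 1)" using N by (simp add: ln_powr)
      have s1: "s \<ge> 1" unfolding s_def using m by (intro sum_inv_divisors_ge_1)
      have "real z ^ 4 \<le> (real N powr (1/16)) ^ 4" using zu by (intro power_mono) auto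
      also have "\<dots> = real N powr (1/4)" using N by (simp add: powr_power)
      finally have z4: "real z ^ 4 \<le> real N powr (1/4)" .
      have "real z ^ 1 \<le> real z ^ 4" using z1 by (intro power_increasing) auto
      hence zz: "real z + real z ^ 4 \<le> 2 * real N powr (1/4)" using z4 unfolding power_one_right by linarith
      have "sqrt (real N) / (2 * C * ln (real N)) = real N / (2 * (C * sqrt (real N)) * ln (real N))"
        by (subst real_div_sqrt[of "real N", symmetric]) (simp_all add: mult_ac)
      also have "\<dots> \<le> real N / (2 * real m * ln (real N))"
        using m lnN C N by (intro divide_left_mono mult_right_mono mult_pos_pos) auto
      also have "\<dots> = M / 2" by (simp add: M_def)
      finally have A: "real z + real z ^ 4 \<le> M / 2" using zz elim(1) by linarith
      have M0: "M \<ge> 0" unfolding M_def using lnN by simp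
      have "64 * real m \<le> real N" using m(2) elim(2) by simp
      hence "32 / ln (real N) \<le> M / 2" using m lnN by (simp add: M_def field_simps)
      hence B: "32 * s / ln (real N) \<le> s * (M / 2)" using s1 mult_left_mono[of "32 / ln (real N)" "M/2" s] by (simp add: mult.commute)
      have "real (card {q. prime q \<and> q \<le> N \<and> m dvd q - 1}) \<le> (real N / real m + 1) * (2 * s) / ln (real z + 1) + real z + real z ^ 4"
        unfolding s_def by (rule brun_titchmarsh_finite[OF m(1) z1])
      also have "(real N / real m + 1) * (2 * s) / ln (real z + 1) \<le> (real N / real m + 1) * (2 * s) / (ln (real N) / 16)"
        using lz s1 lnN z1 by (intro divide_left_mono mult_nonneg_nonneg mult_pos_pos) auto
      also have "\<dots> = 32 * s * M + 32 * s / ln (real N)"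
        using m lnN by (simp add: M_def field_simps)
      finally have "real (card {q. prime q \<and> q \<le> N \<and> m dvd q - 1}) \<le> 32 * s * M + s * (M / 2) + M / 2"
        using A B by linarith
      moreover have "M / 2 \<le> s * (M / 2)" using s1 M0 by (simp add: mult_le_cancel_right1)
      ultimately have "real (card {q. prime q \<and> q \<le> N \<and> m dvd q - 1}) \<le> 33 * (s * M)" by (simp add: algebra_simps)
      thus "real (card {q. prime q \<and> q \<le> N \<and> m dvd q - 1}) \<le> 33 * sum_inv_divisors m * (real N / (real m * ln (real N)))"
        by (simp add: s_def M_def)
    qed
  qed
qed

section \<open>Numbers of prime factors\<close>

definition prime_count :: "nat \<Rightarrow> nat" where
  "prime_count N = card {p. prime p \<and> p \<le> N}"

text \<open>\<open>(n + 1) * (n choose k)\<close> is the denominator in Leibniz' harmonic triangle, whose recurrence drives the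
  induction.\<close>
lemma leibniz_denominator_dvd:
  fixes W N :: nat
  assumes "\<And>m. 1 \<le> m \<Longrightarrow> m \<le> N \<Longrightarrow> m dvd W" and "k \<le> n" "n < N"
  shows "real W / (real (n + 1) * real (n choose k)) \<in> \<int>"
  using assms(2,3)
proof (induction k arbitrary: n)
  case 0
  have "n + 1 dvd W" using assms(1)[of "n + 1"] 0 by simp
  then obtain q where "W = (n + 1) * q" by blast
  hence "real W / (real (n + 1) * real (n choose 0)) = real q" by (simp add: field_simps)
  thus ?case by simp
next
  case (Suc k)
  then obtain n' where n': "n = Suc n'" "k \<le> n'" by (metis Suc_le_D Suc_le_mono)
  define a b c where "a = real (n' choose k)" and "b = real (Suc n' choose k)" and "c = real (Suc n' choose Suc k)"
  have pos: "a > 0" "b > 0" "c > 0"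
    unfolding a_def b_def c_def of_nat_0_less_iff zero_less_binomial_iff using n' by auto
  have c: "real (Suc k) * c = real (Suc n') * a"
    unfolding a_def c_def by (simp only: of_nat_mult[symmetric] Suc_times_binomial mult.commute)
  have b: "real (Suc n' - k) * b = real (Suc n') * a"
    unfolding a_def b_def using binomial_absorb_comp[of "Suc n'" k] by (simp only: of_nat_mult[symmetric] diff_Suc_1)
  have k1: "real (Suc n' - k) = real n' + 1 - real k" using n' by (simp add: of_nat_diff)
  define x where "x = real n' + 1"
  have x: "x > 0" by (simp add: x_def)
  have c': "c = x * a / (real k + 1)" using c by (simp add: x_def field_simps)
  have b': "b = x * a / (x - real k)" using b n' unfolding k1 by (simp add: x_def field_simps)
  have xk: "x - real k > 0" using n' by (simp add: x_def)
  define D where "D = (x + 1) * (x * a)"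
  have "1 / ((x + 1) * c) = (real k + 1) / D" "1 / ((x + 1) * b) = (x - real k) / D"
    unfolding c' b' D_def by simp_all
  moreover have "1 / (x * a) = (x + 1) / D" using x by (simp add: D_def)
  ultimately have eq: "1 / ((x + 1) * c) = 1 / (x * a) - 1 / ((x + 1) * b)"
    by (simp add: diff_divide_distrib[symmetric])
  have "real (n + 1) = x + 1" "real (n' + 1) = x" by (simp_all add: x_def n'(1))
  moreover have "real (n choose Suc k) = c" "real (n choose k) = b" by (simp_all only: b_def c_def n'(1))
  ultimately have "real W / (real (n + 1) * real (n choose Suc k))
      = real W / (real (n' + 1) * real (n' choose k)) - real W / (real (n + 1) * real (n choose k))"
    using arg_cong[OF eq, of "(*) (real W)"]
    by (simp only: right_diff_distrib times_divide_eq_right mult_1_right a_def)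
  moreover have "real W / (real (n' + 1) * real (n' choose k)) \<in> \<int>" by (rule Suc.IH) (use Suc.prems n' in auto)
  moreover have "real W / (real (n + 1) * real (n choose k)) \<in> \<int>" by (rule Suc.IH) (use Suc.prems n' in auto)
  ultimately show ?case by simp
qed

text \<open>\<open>W\<close> is the least common multiple of 1, ..., N: each prime up to N enters
  with its largest power not exceeding N, so there is one factor at most N per prime.\<close>

lemma ex_small_common_multiple:
  assumes N: "N \<ge> 1"
  obtains W where "W > 0" "\<And>m. 1 \<le> m \<Longrightarrow> m \<le> N \<Longrightarrow> m dvd W" "W \<le> N ^ prime_count N"
proof -
  let ?P = "{p. prime p \<and> p \<le> N}"
  define e where "e = (\<lambda>p. GREATEST a. p ^ a \<le> N)"
  have bound: "a \<le> N" if "p ^ a \<le> N" "prime p" for p a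
    using that prime_ge_2_nat[of p] less_exp[of a] power_mono[of 2 p a] by (meson le_trans less_imp_le_nat zero_le)
  have e1: "p ^ e p \<le> N" if p: "prime p" for p
    unfolding e_def by (rule GreatestI_nat[of "\<lambda>a. p ^ a \<le> N" 0 N]) (use N in simp, use bound[OF _ p] in blast)
  have e2: "a \<le> e p" if a: "p ^ a \<le> N" and p: "prime p" for p a
    unfolding e_def by (rule Greatest_le_nat[of "\<lambda>a. p ^ a \<le> N" a N, OF a]) (use bound[OF _ p] in blast)
  define W where "W = (\<Prod>p\<in>?P. p ^ e p)"
  have W0: "W > 0" unfolding W_def by (intro prod_pos) (auto intro: prime_gt_0_nat)
  have "m dvd W" if m: "1 \<le> m" "m \<le> N" for m
  proof (rule multiplicity_le_imp_dvd)
    fix p :: nat assume p: "prime p"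
    have "p ^ multiplicity p m dvd m" by (rule multiplicity_dvd)
    hence le: "p ^ multiplicity p m \<le> m" using m by (intro dvd_imp_le) auto
    show "multiplicity p m \<le> multiplicity p W"
    proof (cases "p \<le> N")
      case True
      have "multiplicity p W = e p" unfolding W_def using True p
        by (subst multiplicity_prod_prime_powers) auto
      thus ?thesis using e2[of p "multiplicity p m"] le m p by simp
    next
      case False
      hence "\<not> p dvd m" using m dvd_imp_le[of p m] by auto
      thus ?thesis by (simp add: not_dvd_imp_multiplicity_0)
    qed
  qed (use m in auto)
  moreover have "W \<le> (\<Prod>p\<in>?P. N)" unfolding W_def by (intro prod_mono) (use e1 in auto)
  ultimately show ?thesis using that[of W] W0 by (simp add: prime_count_def)
qed

text \<open>The middle entry of row 2 n of the harmonic triangle has denominator (2 n + 1) times the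
  central binomial coefficient. It is at least 4^n and divides a number that is at most N to the
  power of the number of primes; compare logarithms.\<close>

lemma prime_count_lower_bound:
  assumes "N \<ge> 3"
  shows "real (prime_count N) \<ge> real N / (6 * ln (real N))"
proof -
  define n where "n = (N - 1) div 2"
  define N' where "N' = 2 * n + 1"
  have n: "n \<ge> 1" "N' \<le> N" "N \<le> N' + 1" using assms by (auto simp: n_def N'_def)
  obtain W where W: "W > 0" "\<And>m. 1 \<le> m \<Longrightarrow> m \<le> N' \<Longrightarrow> m dvd W" "W \<le> N' ^ prime_count N'"
    using ex_small_common_multiple[of N'] by (auto simp: N'_def)
  let ?B = "real (2 * n + 1) * real ((2 * n) choose n)"
  have "real W / ?B \<in> \<int>" by (rule leibniz_denominator_dvd[OF W(2)]) (auto simp: N'_def)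
  then obtain q :: int where q: "real W / ?B = of_int q" by (auto elim: Ints_cases)
  have B: "?B > 0" by (simp add: zero_less_binomial_iff)
  have "of_int q > (0::real)" unfolding q[symmetric] using W(1) B by simp
  hence "of_int q \<ge> (1::real)" by simp
  hence "?B \<le> real W" unfolding q[symmetric] using B by (simp add: le_divide_eq)
  moreover have "4 ^ n \<le> ?B"
  proof -
    have "4 ^ n / (2 * real n) \<le> real ((2 * n) choose n)" using central_binomial_lower_bound[of n] n by simp
    hence "4 ^ n \<le> 2 * real n * real ((2 * n) choose n)" using n by (simp add: divide_le_eq mult.commute)
    also have "\<dots> \<le> ?B" by (intro mult_right_mono) auto
    finally show ?thesis .
  qed
  moreover have "real W \<le> real N' ^ prime_count N'" using W(3) by (metis of_nat_le_iff of_nat_power)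
  ultimately have "(4::real) ^ n \<le> real N' ^ prime_count N'" by linarith
  hence "ln ((4::real) ^ n) \<le> ln (real N' ^ prime_count N')" by (intro ln_mono) (auto simp: N'_def)
  hence "real n * ln 4 \<le> real (prime_count N') * ln (real N')" by (simp add: ln_realpow N'_def)
  also have "\<dots> \<le> real (prime_count N) * ln (real N)"
  proof (intro mult_mono)
    have "prime_count N' \<le> prime_count N" unfolding prime_count_def using n(2) by (intro card_mono) auto
    thus "real (prime_count N') \<le> real (prime_count N)" by simp
    show "ln (real N') \<le> ln (real N)" using n(2) by (intro ln_mono) (auto simp: N'_def)
  qed (auto simp: N'_def)
  finally have 1: "real n * ln 4 \<le> real (prime_count N) * ln (real N)" .
  have "exp 1 \<le> (4::real)" using exp_le by simp
  hence "1 \<le> ln (4::real)" by (subst ln_ge_iff) auto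
  hence "real n \<le> real n * ln 4" by (simp add: mult_le_cancel_left1)
  moreover have "real N \<le> 6 * real n" using n by (simp add: N'_def)
  ultimately have "real N \<le> 6 * (real (prime_count N) * ln (real N))" using 1 by linarith
  moreover have "ln (real N) > 0" using assms by simp
  ultimately show ?thesis by (simp add: divide_le_eq mult_ac)
qed

lemma card_multiples_le:
  assumes "d > 0" shows "real (card {m\<in>{1..M}. d dvd m}) \<le> real M / real d"
    "real (card {m\<in>{1..M}. d dvd m}) \<ge> real M / real d - 1"
proof -
  have "{m\<in>{1..M}. d dvd m} = (\<lambda>k. d * k) ` {1..M div d}"
  proof (intro equalityI subsetI)
    fix m assume m: "m \<in> {m\<in>{1..M}. d dvd m}"
    then obtain k where k: "m = d * k" by auto
    have "k \<le> M div d" using k m assms by (simp add: less_eq_div_iff_mult_less_eq mult.commute)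
    thus "m \<in> (\<lambda>k. d * k) ` {1..M div d}" using k m by (cases "k = 0") auto
  next
    fix m assume "m \<in> (\<lambda>k. d * k) ` {1..M div d}"
    then obtain k where "m = d * k" "k \<in> {1..M div d}" by blast
    thus "m \<in> {m\<in>{1..M}. d dvd m}" using assms by (auto simp: less_eq_div_iff_mult_less_eq mult.commute Suc_le_eq)
  qed
  moreover have "inj_on (\<lambda>k. d * k) {1..M div d}" using assms by (auto intro: inj_onI)
  ultimately have c: "card {m\<in>{1..M}. d dvd m} = M div d" by (simp add: card_image)
  have "\<lfloor>real M / real d\<rfloor> = int (M div d)" by (rule floor_divide_of_nat_eq)
  thus "real (card {m\<in>{1..M}. d dvd m}) \<le> real M / real d"
    "real (card {m\<in>{1..M}. d dvd m}) \<ge> real M / real d - 1" unfolding c by linarith+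
qed

section \<open>Typical numbers of prime factors, after Turan\<close>

definition count_factors :: "nat set \<Rightarrow> nat \<Rightarrow> real" where
  "count_factors P n = (\<Sum>l\<in>P. of_bool (l dvd n))"

text \<open>For a set of primes this is the mean value of \<open>count_factors P\<close> over the
  integers.\<close>

definition sum_inv :: "nat set \<Rightarrow> real" where
  "sum_inv P = (\<Sum>l\<in>P. 1 / real l)"

lemma sum_of_bool_interval:
  fixes M :: nat
  shows "(\<Sum>m\<in>{1..M}. of_bool (P m) :: real) = real (card {m\<in>{1..M}. P m})"
proof -
  have "(\<Sum>m\<in>{1..M}. of_bool (P m) :: real) = (\<Sum>m\<in>{m\<in>{1..M}. P m}. 1)"
    unfolding of_bool_def by (rule sum.inter_filter[symmetric]) simp
  thus ?thesis by simp
qed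

lemma sum_swap3: "(\<Sum>a\<in>A. \<Sum>b\<in>B. \<Sum>c\<in>C. f a b c) = (\<Sum>b\<in>B. \<Sum>c\<in>C. \<Sum>a\<in>A. f a b c)"
proof -
  have "(\<Sum>a\<in>A. \<Sum>b\<in>B. \<Sum>c\<in>C. f a b c) = (\<Sum>b\<in>B. \<Sum>a\<in>A. \<Sum>c\<in>C. f a b c)" by (rule sum.swap)
  also have "\<dots> = (\<Sum>b\<in>B. \<Sum>c\<in>C. \<Sum>a\<in>A. f a b c)" by (intro sum.cong refl) (rule sum.swap)
  finally show ?thesis .
qed

text \<open>Divisibility by distinct primes is independent up to rounding, so the terms of size M
  L^2 cancel and the diagonal leaves M L. Rounding down only helps in the second moment; in the
  first moment it costs at most 1 per prime, whence \<open>card P\<close>.\<close>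

lemma turan_variance:
  fixes P :: "nat set"
  assumes P: "finite P" "\<And>l. l \<in> P \<Longrightarrow> prime l"
  shows "(\<Sum>m\<in>{1..M}. (count_factors P m - sum_inv P)\<^sup>2) \<le> sum_inv P * (real M + 2 * real (card P))"
proof -
  let ?L = "sum_inv P"
  have pos: "l > 0" if "l \<in> P" for l using P(2)[OF that] by (rule prime_gt_0_nat)
  have L0: "?L \<ge> 0" unfolding sum_inv_def by (intro sum_nonneg) auto
  have lo: "(\<Sum>m\<in>{1..M}. count_factors P m) \<ge> real M * ?L - real (card P)"
  proof -
    have "(\<Sum>m\<in>{1..M}. count_factors P m) = (\<Sum>l\<in>P. real (card {m\<in>{1..M}. l dvd m}))"
      unfolding count_factors_def by (subst sum.swap) (simp only: sum_of_bool_interval)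
    also have "\<dots> \<ge> (\<Sum>l\<in>P. real M / real l - 1)"
      by (intro sum_mono card_multiples_le pos)
    also have "(\<Sum>l\<in>P. real M / real l - 1) = real M * ?L - real (card P)"
      by (simp add: sum_subtractf sum_inv_def sum_distrib_left)
    finally show ?thesis .
  qed
  have up: "(\<Sum>m\<in>{1..M}. (count_factors P m)\<^sup>2) \<le> real M * ?L\<^sup>2 + real M * ?L"
  proof -
    have "(\<Sum>m\<in>{1..M}. (count_factors P m)\<^sup>2)
        = (\<Sum>m\<in>{1..M}. \<Sum>l\<in>P. \<Sum>l'\<in>P. of_bool (l dvd m \<and> l' dvd m))"
      unfolding count_factors_def power2_eq_square sum_product by (simp only: of_bool_conj)
    also have "\<dots> = (\<Sum>l\<in>P. \<Sum>l'\<in>P. \<Sum>m\<in>{1..M}. of_bool (l dvd m \<and> l' dvd m))"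
      by (rule sum_swap3)
    also have "\<dots> \<le> (\<Sum>l\<in>P. \<Sum>l'\<in>P. real M * (1 / real l * (1 / real l')) + (if l = l' then real M * (1 / real l) else 0))"
    proof (intro sum_mono)
      fix l l' assume l: "l \<in> P" "l' \<in> P"
      show "(\<Sum>m\<in>{1..M}. of_bool (l dvd m \<and> l' dvd m)) \<le> real M * (1 / real l * (1 / real l')) + (if l = l' then real M * (1 / real l) else 0)"
      proof (cases "l = l'")
        case True
        have "(\<Sum>m\<in>{1..M}. of_bool (l dvd m)) \<le> real M / real l"
          unfolding sum_of_bool_interval by (intro card_multiples_le pos l)
        thus ?thesis using True by (simp add: add_increasing)
      next
        case False
        hence "coprime l l'" using primes_coprime P(2) l by blast
        hence "(l dvd m \<and> l' dvd m) = (l * l' dvd m)" for m by (auto intro: divides_mult dest: dvd_mult_left dvd_mult_right)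
        hence "(\<Sum>m\<in>{1..M}. of_bool (l dvd m \<and> l' dvd m)) = real (card {m\<in>{1..M}. l * l' dvd m})"
          by (simp only: sum_of_bool_interval)
        also have "\<dots> \<le> real M / real (l * l')" using pos l by (intro card_multiples_le) auto
        finally show ?thesis using False by simp
      qed
    qed
    also have "\<dots> = (\<Sum>l\<in>P. \<Sum>l'\<in>P. real M * (1 / real l * (1 / real l'))) + (\<Sum>l\<in>P. real M * (1 / real l))"
      using P(1) by (simp add: sum.distrib)
    also have "\<dots> = real M * (\<Sum>l\<in>P. \<Sum>l'\<in>P. 1 / real l * (1 / real l')) + real M * ?L"
      by (simp only: sum_inv_def sum_distrib_left)
    also have "\<dots> = real M * ?L\<^sup>2 + real M * ?L"
      by (simp only: sum_inv_def power2_eq_square sum_product)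
    finally show ?thesis .
  qed
  have "(\<Sum>m\<in>{1..M}. (count_factors P m - ?L)\<^sup>2)
      = (\<Sum>m\<in>{1..M}. (count_factors P m)\<^sup>2) - 2 * ?L * (\<Sum>m\<in>{1..M}. count_factors P m) + real M * ?L\<^sup>2"
    by (simp add: power2_diff sum.distrib sum_subtractf sum_distrib_left mult_ac)
  also have "\<dots> \<le> (real M * ?L\<^sup>2 + real M * ?L) - 2 * ?L * (real M * ?L - real (card P)) + real M * ?L\<^sup>2"
    using up mult_left_mono[OF lo, of "2 * ?L"] L0 by simp
  also have "\<dots> = ?L * (real M + 2 * real (card P))" by (simp add: power2_eq_square algebra_simps)
  finally show ?thesis .
qed

text \<open>The constant 0.85 is such that two integers without few factors have together at least
  1.7 times the mean: 1.6 for the factors of their product and 0.1 for repeated ones.\<close>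

definition few_factors :: "nat set \<Rightarrow> nat \<Rightarrow> bool" where
  "few_factors P m \<longleftrightarrow> count_factors P m < 0.85 * sum_inv P"

text \<open>Chebyshev's inequality for a deviation of 0.15 times the mean; 45 exceeds 1 /
  0.15^2.\<close>

lemma card_few_factors:
  fixes P :: "nat set"
  assumes P: "finite P" "\<And>l. l \<in> P \<Longrightarrow> prime l" and L: "sum_inv P > 0"
  shows "real (card {m\<in>{1..M}. few_factors P m}) \<le> 45 * (real M + 2 * real (card P)) / sum_inv P"
proof -
  let ?L = "sum_inv P" and ?A = "{m\<in>{1..M}. few_factors P m}"
  have "real (card ?A) * (0.15 * ?L)\<^sup>2 = (\<Sum>m\<in>?A. (0.15 * ?L)\<^sup>2)" by simp
  also have "\<dots> \<le> (\<Sum>m\<in>?A. (count_factors P m - ?L)\<^sup>2)"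
  proof (intro sum_mono)
    fix m assume "m \<in> ?A"
    hence "0.15 * ?L \<le> ?L - count_factors P m" by (simp add: few_factors_def)
    hence "(0.15 * ?L)\<^sup>2 \<le> (?L - count_factors P m)\<^sup>2" using L by (intro power_mono) auto
    thus "(0.15 * ?L)\<^sup>2 \<le> (count_factors P m - ?L)\<^sup>2" by (simp add: power2_commute)
  qed
  also have "\<dots> \<le> (\<Sum>m\<in>{1..M}. (count_factors P m - ?L)\<^sup>2)" by (intro sum_mono2) auto
  also have "\<dots> \<le> ?L * (real M + 2 * real (card P))" by (rule turan_variance[OF P])
  finally have "real (card ?A) * (0.0225 * ?L) * ?L \<le> (real M + 2 * real (card P)) * ?L"
    by (simp add: power2_eq_square mult_ac)
  hence "real (card ?A) * (0.0225 * ?L) \<le> real M + 2 * real (card P)" using L by (simp only: mult_le_cancel_right)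
  hence "real (card ?A) * ?L \<le> 45 * (real M + 2 * real (card P))" by (simp add: algebra_simps)
  thus ?thesis using L by (simp add: le_divide_eq)
qed

text \<open>Telescoping: for d \<ge> 2 the term is at most 2 / sqrt (d - 1) - 2 / sqrt d.\<close>

lemma sum_three_halves_le: "(\<Sum>d=1..M. 1 / (real d * sqrt (real d))) \<le> 3"
proof -
  have "(\<Sum>d=1..Suc M. 1 / (real d * sqrt (real d))) \<le> 3 - 2 / sqrt (real (Suc M))" for M
  proof (induction M)
    case (Suc M)
    define a b where "a = sqrt (real (Suc M))" and "b = sqrt (real (Suc (Suc M)))"
    have a: "a > 0" and ab: "a \<le> b" and sq: "b * b = a * a + 1" by (auto simp: a_def b_def)
    have "(b - a) * (a + b) = 1" using sq by (simp add: algebra_simps)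
    hence ba: "b - a = 1 / (a + b)" using a ab by (simp add: field_simps)
    have "1 / (b * b * b) \<le> 1 / (a * b * b)" using a ab by (intro divide_left_mono mult_right_mono) auto
    also have "\<dots> = 2 * (1 / (2 * b)) / (a * b)" by simp
    also have "\<dots> \<le> 2 * (b - a) / (a * b)"
      unfolding ba using a ab by (intro divide_right_mono mult_left_mono divide_left_mono) auto
    also have "\<dots> = 2 / a - 2 / b" using a ab by (simp add: field_simps)
    finally have "1 / (b * b * b) \<le> 2 / a - 2 / b" .
    moreover have "b * b = real (Suc (Suc M))" by (simp add: b_def)
    ultimately have "1 / (real (Suc (Suc M)) * sqrt (real (Suc (Suc M)))) \<le> 2 / a - 2 / b" unfolding b_def by simp
    thus ?case using Suc by (simp add: a_def b_def)
  qed simp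
  from order_trans[OF this, of "M - 1" 3] show ?thesis by (cases M) auto
qed

text \<open>Expand the square over pairs of divisors d, e. The number of m divisible by both is at
  most M / d and at most M / e, hence at most their geometric mean M / sqrt (d e), which separates
  the variables.\<close>

lemma sum_inv_divisors_square_le: "(\<Sum>m\<in>{1..M}. (sum_inv_divisors m)\<^sup>2) \<le> 9 * real M"
proof -
  have "sum_inv_divisors m = (\<Sum>d\<in>{1..M}. 1 / real d * of_bool (d dvd m))" if "m \<in> {1..M}" for m
  proof -
    have "{d. d dvd m} = {d\<in>{1..M}. d dvd m}"
      using that by (auto dest: dvd_imp_le intro: Suc_leI gr0I)
    hence "sum_inv_divisors m = (\<Sum>d\<in>{d\<in>{1..M}. d dvd m}. 1 / real d)" by (simp only: sum_inv_divisors_def)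
    also have "\<dots> = (\<Sum>d\<in>{1..M}. 1 / real d * of_bool (d dvd m))"
      by (subst sum.inter_filter) (auto intro!: sum.cong)
    finally show ?thesis .
  qed
  hence "(\<Sum>m\<in>{1..M}. (sum_inv_divisors m)\<^sup>2)
      = (\<Sum>m\<in>{1..M}. \<Sum>d\<in>{1..M}. \<Sum>e\<in>{1..M}. 1 / real d * (1 / real e) * of_bool (d dvd m \<and> e dvd m))"
    unfolding power2_eq_square by (simp add: sum_product of_bool_conj mult_ac)
  also have "\<dots> = (\<Sum>d\<in>{1..M}. \<Sum>e\<in>{1..M}. 1 / real d * (1 / real e) * (\<Sum>m\<in>{1..M}. of_bool (d dvd m \<and> e dvd m)))"
    unfolding sum_distrib_left by (rule sum_swap3)
  also have "\<dots> \<le> (\<Sum>d\<in>{1..M}. \<Sum>e\<in>{1..M}. real M * (1 / (real d * sqrt (real d)) * (1 / (real e * sqrt (real e)))))"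
  proof (intro sum_mono)
    fix d e assume de: "d \<in> {1..M}" "e \<in> {1..M}"
    define x where "x = (\<Sum>m\<in>{1..M}. of_bool (d dvd m \<and> e dvd m) :: real)"
    have x0: "x \<ge> 0" unfolding x_def by (intro sum_nonneg) auto
    have "x \<le> (\<Sum>m\<in>{1..M}. of_bool (d dvd m))" unfolding x_def by (intro sum_mono) auto
    also have "\<dots> \<le> real M / real d" unfolding sum_of_bool_interval using de by (intro card_multiples_le) auto
    finally have xd: "x \<le> real M / real d" .
    have "x \<le> (\<Sum>m\<in>{1..M}. of_bool (e dvd m))" unfolding x_def by (intro sum_mono) auto
    also have "\<dots> \<le> real M / real e" unfolding sum_of_bool_interval using de by (intro card_multiples_le) auto
    finally have xe: "x \<le> real M / real e" .
    have "x * x \<le> (real M / real d) * (real M / real e)" using x0 xd xe by (intro mult_mono) auto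
    hence "sqrt (x * x) \<le> sqrt ((real M / real d) * (real M / real e))" by (rule real_sqrt_le_mono)
    hence "x \<le> real M / (sqrt (real d) * sqrt (real e))" using x0 by (simp add: real_sqrt_mult real_sqrt_divide)
    hence "1 / real d * (1 / real e) * x \<le> 1 / real d * (1 / real e) * (real M / (sqrt (real d) * sqrt (real e)))"
      by (intro mult_left_mono) auto
    thus "1 / real d * (1 / real e) * x \<le> real M * (1 / (real d * sqrt (real d)) * (1 / (real e * sqrt (real e))))"
      by (simp add: mult_ac)
  qed
  also have "\<dots> = real M * (\<Sum>d\<in>{1..M}. \<Sum>e\<in>{1..M}. 1 / (real d * sqrt (real d)) * (1 / (real e * sqrt (real e))))"
    by (simp only: sum_distrib_left)
  also have "\<dots> = real M * ((\<Sum>d\<in>{1..M}. 1 / (real d * sqrt (real d))) * (\<Sum>d\<in>{1..M}. 1 / (real d * sqrt (real d))))"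
    by (simp only: sum_product)
  also have "\<dots> \<le> real M * (3 * 3)"
    by (intro mult_left_mono mult_mono sum_three_halves_le sum_nonneg) auto
  finally show ?thesis by simp
qed

text \<open>Euler's argument: the expanded product of 1 + 1 / l over the primes up to z contains the
  reciprocals of all squarefree k \<le> z, whose sum is at least half of ln z by
  \<open>ln_le_sieve_sum\<close> with m = 1.\<close>

lemma ex_primes_sum_inv_ge:
  obtains P where "finite P" "\<And>l. l \<in> P \<Longrightarrow> prime l" "sum_inv P \<ge> B"
proof -
  obtain z :: nat where z: "exp (2 * exp B) \<le> real z" using real_arch_simple by blast
  let ?P = "{l. prime l \<and> l \<le> z}"
  have "2 * exp B = ln (exp (2 * exp B))" by simp
  also have "\<dots> \<le> ln (real z + 1)" using z by (intro ln_mono) (auto intro: order_trans)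
  also have "\<dots> \<le> 2 * sum_inv_divisors 1 * sieve_sum 1 z" by (rule ln_le_sieve_sum) simp
  also have "sum_inv_divisors 1 = 1" by (simp add: sum_inv_divisors_def)
  finally have "exp B \<le> sieve_sum 1 z" by simp
  also have "\<dots> \<le> (\<Sum>E\<in>Pow ?P. 1 / real (\<Prod>E))"
    unfolding sieve_sum_def
  proof (rule sum_mono2)
    show "sieve_sets 1 z \<subseteq> Pow ?P"
    proof
      fix E assume "E \<in> sieve_sets 1 z"
      hence E: "finite E" "\<forall>l\<in>E. prime l" "\<Prod>E \<le> z" by (auto simp: sieve_sets_def)
      have "l \<le> z" if "l \<in> E" for l
      proof -
        have "l dvd \<Prod>E" using dvd_prodI[of E l "\<lambda>x. x"] E that by simp
        thus ?thesis using dvd_imp_le[of l "\<Prod>E"] prod_primes_pos[OF E(1,2)] E(3) by linarith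
      qed
      thus "E \<in> Pow ?P" using E by auto
    qed
  qed (auto intro: divide_nonneg_nonneg prod_nonneg)
  also have "\<dots> = (\<Sum>E\<in>Pow ?P. (\<Prod>l\<in>E. 1 / real l) * (\<Prod>l\<in>?P - E. 1))"
    by (simp add: prod_dividef)
  also have "\<dots> = (\<Prod>l\<in>?P. 1 / real l + 1)" by (rule prod_add[symmetric]) simp
  also have "\<dots> \<le> (\<Prod>l\<in>?P. exp (1 / real l))"
    by (intro prod_mono conjI add_nonneg_nonneg) (auto simp: add.commute[of _ 1])
  also have "\<dots> = exp (sum_inv ?P)" by (simp add: sum_inv_def exp_sum)
  finally have B: "B \<le> sum_inv ?P" by simp
  show ?thesis by (rule that[OF _ _ B]) simp_all
qed

section \<open>Prime factors of q - 1 for primes q\<close>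

definition primes_mod :: "nat \<Rightarrow> nat \<Rightarrow> nat set" where
  "primes_mod N m = {q. prime q \<and> q \<le> N \<and> m dvd q - 1}"

lemma le_nat_floor_iff: "y \<ge> 0 \<Longrightarrow> n \<le> nat \<lfloor>y\<rfloor> \<longleftrightarrow> real n \<le> y"
  by (simp add: le_nat_iff le_floor_iff)

lemma finite_primes_mod: "finite (primes_mod N m)"
  by (simp add: primes_mod_def)

text \<open>The product of the primes counted divides \<open>W\<close>. It is at least N to the
  power of half their number, and at most A^k.\<close>

lemma card_large_prime_divisors:
  fixes W N k :: nat
  assumes W: "W > 0" "real W \<le> A ^ k" and A: "A > 1" and N: "N > 1"
  shows "real (card {q. prime q \<and> sqrt (real N) < real q \<and> q dvd W}) \<le> 2 * real k * ln A / ln (real N)"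
proof -
  let ?S = "{q. prime q \<and> sqrt (real N) < real q \<and> q dvd W}"
  have fin: "finite ?S" by (rule finite_subset[OF _ finite_divisors_nat[of W]]) (use W in auto)
  have "\<Prod>?S dvd W" using fin by (subst prod_primes_dvd_iff) auto
  hence le: "\<Prod>?S \<le> W" using W by (intro dvd_imp_le)
  have "sqrt (real N) ^ card ?S = (\<Prod>q\<in>?S. sqrt (real N))" by simp
  also have "\<dots> \<le> (\<Prod>q\<in>?S. real q)" by (intro prod_mono) auto
  also have "\<dots> = real (\<Prod>?S)" by simp
  also have "\<dots> \<le> real W" using le by (rule of_nat_mono)
  also have "\<dots> \<le> A ^ k" by (rule W)
  finally have "ln (sqrt (real N) ^ card ?S) \<le> ln (A ^ k)" using N by (intro ln_mono) auto
  hence "real (card ?S) * (ln (real N) / 2) \<le> real k * ln A" using N A by (simp add: ln_realpow ln_sqrt)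
  thus ?thesis using N by (simp add: le_divide_eq mult_ac)
qed

lemma card_large_prime_divisors_Union:
  fixes W :: "nat \<Rightarrow> nat" and A H :: real
  assumes W: "\<And>k. k \<in> B \<Longrightarrow> W k > 0 \<and> real (W k) \<le> A ^ k" and A: "A > 1" and N: "N > 1"
    and B: "finite B" "\<And>k. k \<in> B \<Longrightarrow> real k \<le> H"
  shows "real (card {q. prime q \<and> sqrt (real N) < real q \<and> (\<exists>k\<in>B. q dvd W k)}) \<le> real (card B) * H * (2 * ln A / ln (real N))"
proof -
  let ?S = "\<lambda>k. {q. prime q \<and> sqrt (real N) < real q \<and> q dvd W k}"
  have "{q. prime q \<and> sqrt (real N) < real q \<and> (\<exists>k\<in>B. q dvd W k)} = (\<Union>k\<in>B. ?S k)" by blast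
  moreover have "real (card (\<Union>k\<in>B. ?S k)) \<le> real (\<Sum>k\<in>B. card (?S k))"
    by (rule of_nat_mono) (rule card_UN_le[OF B(1)])
  ultimately have "real (card {q. prime q \<and> sqrt (real N) < real q \<and> (\<exists>k\<in>B. q dvd W k)}) \<le> (\<Sum>k\<in>B. real (card (?S k)))"
    by (simp only: of_nat_sum)
  also have "\<dots> \<le> (\<Sum>k\<in>B. H * (2 * ln A / ln (real N)))"
  proof (rule sum_mono)
    fix k assume k: "k \<in> B"
    have "real (card (?S k)) \<le> 2 * real k * ln A / ln (real N)"
      using W[OF k] A N by (intro card_large_prime_divisors) auto
    also have "\<dots> = real k * (2 * ln A / ln (real N))" by simp
    also have "\<dots> \<le> H * (2 * ln A / ln (real N))"
      using A N B(2)[OF k] by (intro mult_right_mono divide_nonneg_nonneg) auto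
    finally show "real (card (?S k)) \<le> H * (2 * ln A / ln (real N))" .
  qed
  finally show ?thesis by (simp add: mult_ac)
qed

text \<open>A divisor of l n divides n or is l times a divisor of n.\<close>

lemma sum_inv_divisors_prime_mult:
  assumes "prime l" "n > 0" shows "sum_inv_divisors (l * n) \<le> (1 + 1 / real l) * sum_inv_divisors n"
proof -
  have l: "l > 0" using assms(1) by (rule prime_gt_0_nat)
  have "{d. d dvd l * n} \<subseteq> {d. d dvd n} \<union> (\<lambda>d. l * d) ` {d. d dvd n}"
  proof
    fix d assume d: "d \<in> {d. d dvd l * n}"
    show "d \<in> {d. d dvd n} \<union> (\<lambda>d. l * d) ` {d. d dvd n}"
    proof (cases "l dvd d")
      case True
      then obtain d' where "d = l * d'" by blast
      thus ?thesis using d l by auto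
    next
      case False
      hence "coprime d l" using assms(1) by (metis coprime_commute prime_imp_coprime)
      thus ?thesis using d by (simp add: coprime_dvd_mult_right_iff)
    qed
  qed
  hence "sum_inv_divisors (l * n) \<le> (\<Sum>d\<in>{d. d dvd n} \<union> (\<lambda>d. l * d) ` {d. d dvd n}. 1 / real d)"
    unfolding sum_inv_divisors_def using assms by (intro sum_mono2) auto
  also have "\<dots> \<le> (\<Sum>d\<in>{d. d dvd n}. 1 / real d) + (\<Sum>d\<in>(\<lambda>d. l * d) ` {d. d dvd n}. 1 / real d)"
    using assms by (subst sum.union_inter[symmetric]) (auto intro!: sum_nonneg)
  also have "(\<Sum>d\<in>(\<lambda>d. l * d) ` {d. d dvd n}. 1 / real d) = (1 / real l) * sum_inv_divisors n"
    using l by (subst sum.reindex) (auto simp: inj_on_def sum_inv_divisors_def sum_distrib_left)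
  finally show ?thesis by (simp add: sum_inv_divisors_def algebra_simps)
qed

lemma sum_inv_divisors_1: "sum_inv_divisors (Suc 0) = 1"
  by (simp add: sum_inv_divisors_def)

lemma sum_inv_divisors_prod_le:
  assumes "finite E" "\<forall>l\<in>E. prime l"
  shows "sum_inv_divisors (\<Prod>E) \<le> (\<Prod>l\<in>E. 1 + 1 / real l)"
  using assms
proof (induction E rule: finite_induct)
  case (insert l E)
  have "sum_inv_divisors (l * \<Prod>E) \<le> (1 + 1 / real l) * sum_inv_divisors (\<Prod>E)"
    using insert prod_primes_pos[of E] by (intro sum_inv_divisors_prime_mult) auto
  also have "\<dots> \<le> (1 + 1 / real l) * (\<Prod>l\<in>E. 1 + 1 / real l)"
    using insert by (intro mult_left_mono) auto
  finally show ?case using insert by simp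
qed (simp add: sum_inv_divisors_1)

lemma sum_inverse_squares_set_le:
  assumes "finite P" "\<And>l. l \<in> P \<Longrightarrow> l > 0" shows "(\<Sum>l\<in>P. 1 / real l ^ 2) \<le> 2"
proof -
  have "P \<subseteq> {1..Max P}" using assms by (auto simp: Suc_le_eq)
  hence "(\<Sum>l\<in>P. 1 / real l ^ 2) \<le> (\<Sum>l=1..Max P. 1 / real l ^ 2)" by (intro sum_mono2) auto
  also have "\<dots> \<le> 2" by (rule sum_inverse_squares_le)
  finally show ?thesis .
qed

lemma eventually_le_sqrt: "\<forall>\<^sub>F N in sequentially. real K \<le> sqrt (real N)"
  by real_asymp

lemma brun_titchmarsh_sqrt:
  "\<forall>\<^sub>F N in sequentially. \<forall>m. m > 0 \<and> real m \<le> sqrt (real N) \<longrightarrow>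
    real (card (primes_mod N m)) \<le> 33 * sum_inv_divisors m * (real N / (real m * ln (real N)))"
  using brun_titchmarsh[of 1] unfolding primes_mod_def by simp

text \<open>Markov's inequality: on average q - 1 is divisible by boundedly many squares of primes,
  whatever \<open>P\<close> is. The constant 198 is 33 from the sieve, times 3 for sigma(l^2) / l^2,
  times 2 for the sum of 1 / l^2.\<close>

lemma card_many_square_factors:
  fixes P :: "nat set"
  assumes P: "finite P" "\<And>l. l \<in> P \<Longrightarrow> prime l" and L: "L > 0"
  shows "\<forall>\<^sub>F N in sequentially. real (card {q\<in>primes_mod N 1. L \<le> (\<Sum>l\<in>P. of_bool (l ^ 2 dvd q - 1))})
    \<le> 198 / L * (real N / ln (real N))"
  using brun_titchmarsh_sqrt eventually_le_sqrt[of "\<Sum>l\<in>P. l ^ 2"] eventually_ge_at_top[of 3]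
proof eventually_elim
  case (elim N)
  define T where "T = real N / ln (real N)"
  have T: "T \<ge> 0" using elim(3) by (simp add: T_def)
  let ?S = "{q\<in>primes_mod N 1. L \<le> (\<Sum>l\<in>P. of_bool (l ^ 2 dvd q - 1))}"
  have "real (card ?S) * L = (\<Sum>q\<in>?S. L)" by simp
  also have "\<dots> \<le> (\<Sum>q\<in>?S. \<Sum>l\<in>P. of_bool (l ^ 2 dvd q - 1))" by (intro sum_mono) auto
  also have "\<dots> \<le> (\<Sum>q\<in>primes_mod N 1. \<Sum>l\<in>P. of_bool (l ^ 2 dvd q - 1))"
    by (intro sum_mono2 finite_primes_mod sum_nonneg) auto
  also have "\<dots> = (\<Sum>l\<in>P. real (card (primes_mod N (l ^ 2))))"
  proof (subst sum.swap, intro sum.cong refl)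
    fix l
    have "(\<Sum>q\<in>primes_mod N 1. of_bool (l ^ 2 dvd q - 1) :: real) = (\<Sum>q\<in>{q\<in>primes_mod N 1. l ^ 2 dvd q - 1}. 1)"
      unfolding of_bool_def by (rule sum.inter_filter[symmetric, OF finite_primes_mod])
    also have "{q\<in>primes_mod N 1. l ^ 2 dvd q - 1} = primes_mod N (l ^ 2)" by (auto simp: primes_mod_def)
    finally show "(\<Sum>q\<in>primes_mod N 1. of_bool (l ^ 2 dvd q - 1) :: real) = real (card (primes_mod N (l ^ 2)))" by simp
  qed
  also have "\<dots> \<le> (\<Sum>l\<in>P. 99 * T * (1 / real l ^ 2))"
  proof (rule sum_mono)
    fix l assume l: "l \<in> P"
    have l2: "l \<ge> 2" using P(2)[OF l] by (rule prime_ge_2_nat)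
    have "l ^ 2 \<le> (\<Sum>l\<in>P. l ^ 2)" using l P(1) by (intro member_le_sum) auto
    hence "real (l ^ 2) \<le> real (\<Sum>l\<in>P. l ^ 2)" by (rule of_nat_mono)
    hence le: "real (l ^ 2) \<le> sqrt (real N)" using elim(2) by linarith
    have pos: "0 < l ^ 2" using l2 by simp
    have "real (card (primes_mod N (l ^ 2))) \<le> 33 * sum_inv_divisors (l ^ 2) * (real N / (real (l ^ 2) * ln (real N)))"
      by (rule elim(1)[THEN spec, THEN mp, OF conjI[OF pos le]])
    also have "sum_inv_divisors (l ^ 2) \<le> 3"
    proof -
      have "sum_inv_divisors (l * l) \<le> (1 + 1 / real l) * sum_inv_divisors (l * 1)"
        using P(2)[OF l] l2 by (simp add: sum_inv_divisors_prime_mult)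
      also have "\<dots> \<le> (1 + 1 / real l) * ((1 + 1 / real l) * sum_inv_divisors 1)"
        using P(2)[OF l] by (intro mult_left_mono sum_inv_divisors_prime_mult) auto
      also have "\<dots> \<le> (1 + 1 / 2) * ((1 + 1 / 2) * 1)" using l2
        by (intro mult_mono add_left_mono divide_left_mono) (auto simp: sum_inv_divisors_1)
      finally show ?thesis by (simp add: power2_eq_square)
    qed
    hence "33 * sum_inv_divisors (l ^ 2) * (real N / (real (l ^ 2) * ln (real N))) \<le> 33 * 3 * (real N / (real (l ^ 2) * ln (real N)))"
      using elim(3) by (intro mult_right_mono mult_left_mono divide_nonneg_nonneg) auto
    finally show "real (card (primes_mod N (l ^ 2))) \<le> 99 * T * (1 / real l ^ 2)" by (simp add: T_def mult_ac)
  qed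
  also have "\<dots> = 99 * T * (\<Sum>l\<in>P. 1 / real l ^ 2)" by (simp only: sum_distrib_left)
  also have "\<dots> \<le> 99 * T * 2"
    using P T by (intro mult_left_mono sum_inverse_squares_set_le) (auto intro: prime_gt_0_nat)
  finally have "real (card ?S) * L \<le> 99 * T * 2" .
  hence "real (card ?S) \<le> 99 * T * 2 / L" unfolding pos_le_divide_eq[OF L] .
  also have "\<dots> = 198 / L * (real N / ln (real N))" by (simp add: T_def)
  finally show ?case .
qed

text \<open>Rankin's trick: the number of prime factors in \<open>P\<close> is weighted exponentially.\<close>
lemma card_many_factors:
  fixes P :: "nat set"
  assumes P: "finite P" "\<And>l. l \<in> P \<Longrightarrow> prime l"
  shows "\<forall>\<^sub>F N in sequentially. real (card {q\<in>primes_mod N 1. 1.6 * sum_inv P \<le> count_factors P (q - 1)})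
    \<le> 33 * exp (2 - sum_inv P / 15) * (real N / ln (real N))"
  using brun_titchmarsh_sqrt eventually_le_sqrt[of "\<Prod>P"] eventually_ge_at_top[of 3]
proof eventually_elim
  case (elim N)
  define T where "T = real N / ln (real N)"
  define L where "L = sum_inv P"
  have T: "T \<ge> 0" using elim(3) by (simp add: T_def)
  have L0: "L \<ge> 0" unfolding L_def sum_inv_def by (intro sum_nonneg) auto
  let ?S = "{q\<in>primes_mod N 1. 1.6 * L \<le> count_factors P (q - 1)}"
  \<comment> \<open>2 to the number of prime factors in \<open>P\<close> counts the subsets
    \<open>E\<close> with \<Prod>E dividing q - 1. With ln 2 \<ge> 2 / 3, the threshold 1.6 becomes
    the coefficient 16 / 15, which has to exceed 1.\<close>
  have ge: "exp (16/15 * L) \<le> (\<Sum>E\<in>Pow P. of_bool (\<Prod>E dvd q - 1))" if q: "q \<in> ?S" for q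
  proof -
    let ?D = "{l\<in>P. l dvd q - 1}"
    have cf: "count_factors P (q - 1) = real (card ?D)"
      unfolding count_factors_def of_bool_def using P(1) by (simp flip: sum.inter_filter)
    have "16/15 * L \<le> real (card ?D) * (2/3)" using q cf by simp
    also have "\<dots> \<le> real (card ?D) * ln 2" by (intro mult_left_mono ln2_ge_two_thirds) auto
    finally have "exp (16/15 * L) \<le> exp (real (card ?D) * ln 2)" by simp
    also have "\<dots> = 2 ^ card ?D" by (simp add: exp_of_nat_mult)
    also have "\<dots> = real (card (Pow ?D))" using P(1) by (simp add: card_Pow)
    also have "Pow ?D = {E\<in>Pow P. \<Prod>E dvd q - 1}"
    proof -
      have "\<Prod>E dvd q - 1 \<longleftrightarrow> (\<forall>l\<in>E. l dvd q - 1)" if "E \<subseteq> P" for E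
        using that P by (intro prod_primes_dvd_iff) (auto intro: finite_subset)
      thus ?thesis by auto
    qed
    also have "real (card {E\<in>Pow P. \<Prod>E dvd q - 1}) = (\<Sum>E\<in>Pow P. of_bool (\<Prod>E dvd q - 1))"
      unfolding of_bool_def using P(1) by (simp flip: sum.inter_filter)
    finally show ?thesis .
  qed
  have "real (card ?S) * exp (16/15 * L) = (\<Sum>q\<in>?S. exp (16/15 * L))" by simp
  also have "\<dots> \<le> (\<Sum>q\<in>?S. \<Sum>E\<in>Pow P. of_bool (\<Prod>E dvd q - 1))" by (intro sum_mono ge)
  also have "\<dots> \<le> (\<Sum>q\<in>primes_mod N 1. \<Sum>E\<in>Pow P. of_bool (\<Prod>E dvd q - 1))"
    by (intro sum_mono2 finite_primes_mod sum_nonneg) auto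
  also have "\<dots> = (\<Sum>E\<in>Pow P. real (card (primes_mod N (\<Prod>E))))"
  proof (subst sum.swap, intro sum.cong refl)
    fix E
    have "(\<Sum>q\<in>primes_mod N 1. of_bool (\<Prod>E dvd q - 1) :: real) = (\<Sum>q\<in>{q\<in>primes_mod N 1. \<Prod>E dvd q - 1}. 1)"
      unfolding of_bool_def by (rule sum.inter_filter[symmetric, OF finite_primes_mod])
    also have "{q\<in>primes_mod N 1. \<Prod>E dvd q - 1} = primes_mod N (\<Prod>E)" by (auto simp: primes_mod_def)
    finally show "(\<Sum>q\<in>primes_mod N 1. of_bool (\<Prod>E dvd q - 1) :: real) = real (card (primes_mod N (\<Prod>E)))" by simp
  qed
  also have "\<dots> \<le> (\<Sum>E\<in>Pow P. 33 * T * (\<Prod>l\<in>E. (1 + 1 / real l) / real l))"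
  proof (rule sum_mono)
    fix E assume "E \<in> Pow P"
    hence E: "finite E" "\<forall>l\<in>E. prime l" "E \<subseteq> P" using P finite_subset by auto
    have pos: "\<Prod>E > 0" by (rule prod_primes_pos[OF E(1,2)])
    have "\<Prod>E dvd \<Prod>P" by (rule prod_dvd_prod_subset[OF P(1) E(3)])
    hence "\<Prod>E \<le> \<Prod>P" using prod_primes_pos[of P] P by (intro dvd_imp_le) auto
    hence "real (\<Prod>E) \<le> real (\<Prod>P)" by (rule of_nat_mono)
    hence le: "real (\<Prod>E) \<le> sqrt (real N)" using elim(2) by linarith
    have "real (card (primes_mod N (\<Prod>E))) \<le> 33 * sum_inv_divisors (\<Prod>E) * (real N / (real (\<Prod>E) * ln (real N)))"
      by (rule elim(1)[THEN spec, THEN mp, OF conjI[OF pos le]])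
    also have "\<dots> \<le> 33 * (\<Prod>l\<in>E. 1 + 1 / real l) * (real N / (real (\<Prod>E) * ln (real N)))"
      using elim(3) by (intro mult_right_mono mult_left_mono sum_inv_divisors_prod_le E divide_nonneg_nonneg mult_nonneg_nonneg)
        (auto intro: prod_nonneg)
    also have "\<dots> = 33 * T * ((\<Prod>l\<in>E. 1 + 1 / real l) / real (\<Prod>E))" by (simp add: T_def mult_ac)
    also have "\<dots> = 33 * T * (\<Prod>l\<in>E. (1 + 1 / real l) / real l)" by (simp add: prod_dividef)
    finally show "real (card (primes_mod N (\<Prod>E))) \<le> 33 * T * (\<Prod>l\<in>E. (1 + 1 / real l) / real l)" .
  qed
  \<comment> \<open>The sum over subsets becomes an Euler product, at most exp (L + 2); division by
    exp (16 L / 15) then leaves the decay exp (2 - L / 15).\<close>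
  also have "\<dots> = 33 * T * (\<Sum>E\<in>Pow P. (\<Prod>l\<in>E. (1 + 1 / real l) / real l) * (\<Prod>l\<in>P - E. 1))"
    by (simp add: sum_distrib_left)
  also have "\<dots> = 33 * T * (\<Prod>l\<in>P. (1 + 1 / real l) / real l + 1)" by (subst prod_add[OF P(1)]) (rule refl)
  also have "\<dots> \<le> 33 * T * (\<Prod>l\<in>P. exp (1 / real l + 1 / real l ^ 2))"
  proof (intro mult_left_mono prod_mono conjI)
    fix l
    have "(1 + 1 / real l) / real l + 1 = 1 + (1 / real l + 1 / real l ^ 2)"
      by (simp add: add_divide_distrib power2_eq_square)
    also have "\<dots> \<le> exp (1 / real l + 1 / real l ^ 2)" by (rule exp_ge_add_one_self)
    finally show "(1 + 1 / real l) / real l + 1 \<le> exp (1 / real l + 1 / real l ^ 2)" .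
  qed (use T in auto)
  also have "(\<Prod>l\<in>P. exp (1 / real l + 1 / real l ^ 2)) = exp (L + (\<Sum>l\<in>P. 1 / real l ^ 2))"
    using P(1) by (simp add: L_def sum_inv_def exp_sum flip: sum.distrib)
  also have "33 * T * exp (L + (\<Sum>l\<in>P. 1 / real l ^ 2)) \<le> 33 * T * exp (L + 2)"
    using T P sum_inverse_squares_set_le[of P] by (intro mult_left_mono) (auto intro: prime_gt_0_nat)
  finally have "real (card ?S) * exp (16/15 * L) \<le> 33 * T * exp (L + 2)" .
  hence "real (card ?S) \<le> 33 * T * (exp (L + 2) / exp (16/15 * L))" by (simp add: le_divide_eq)
  also have "exp (L + 2) / exp (16/15 * L) = exp (2 - L / 15)" by (simp flip: exp_diff)
  finally show ?case by (simp add: T_def L_def mult_ac)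
qed

text \<open>Serves to discard the primes that are not comparable with N, so that the cofactor m
  cannot be too small. The factor 66 is twice 33, as ln (\<delta> N - 1) is eventually at least half
  of ln N.\<close>

lemma card_primes_le_small:
  assumes "\<delta> > 0"
  shows "\<forall>\<^sub>F N in sequentially. real (card {q. prime q \<and> real q \<le> \<delta> * real N}) \<le> 66 * \<delta> * (real N / ln (real N))"
proof -
  define f where "f = (\<lambda>N::nat. nat \<lfloor>\<delta> * real N\<rfloor>)"
  have "filterlim f at_top sequentially" unfolding f_def using assms by real_asymp
  from eventually_compose_filterlim[OF brun_titchmarsh_sqrt this]
  have 1: "\<forall>\<^sub>F N in sequentially. \<forall>m. m > 0 \<and> real m \<le> sqrt (real (f N)) \<longrightarrow>
      real (card (primes_mod (f N) m)) \<le> 33 * sum_inv_divisors m * (real (f N) / (real m * ln (real (f N))))" .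
  have 2: "\<forall>\<^sub>F N in sequentially. ln (real N) / 2 \<le> ln (\<delta> * real N - 1) \<and> \<delta> * real N \<ge> 4 \<and> real N \<ge> 3"
    using assms by (intro eventually_conj) real_asymp+
  show ?thesis using 1 2
  proof eventually_elim
    case (elim N)
    have f: "real (f N) \<le> \<delta> * real N" "\<delta> * real N - 1 \<le> real (f N)" unfolding f_def using elim(2) by linarith+
    have "{q. prime q \<and> real q \<le> \<delta> * real N} = primes_mod (f N) 1"
      unfolding f_def primes_mod_def using assms by (simp add: le_nat_floor_iff)
    moreover have "1 \<le> sqrt (real (f N))" using f elim(2) by simp
    ultimately have "real (card {q. prime q \<and> real q \<le> \<delta> * real N}) \<le> 33 * (real (f N) / ln (real (f N)))"
      using elim(1)[THEN spec, of 1] by (simp add: sum_inv_divisors_1)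
    also have "real (f N) / ln (real (f N)) \<le> (\<delta> * real N) / (ln (real N) / 2)"
    proof (rule frac_le)
      have "ln (real N) / 2 \<le> ln (\<delta> * real N - 1)" using elim by blast
      also have "\<dots> \<le> ln (real (f N))" using f elim(2) by (intro ln_mono) auto
      finally show "ln (real N) / 2 \<le> ln (real (f N))" .
    qed (use f elim in auto)
    finally show ?case by (simp add: mult_ac)
  qed
qed

section \<open>Primes q with a divisor of q - 1 of order sqrt q\<close>

text \<open>A prime dividing both \<open>k\<close> and \<open>m\<close> is counted twice on the
  left; then its square divides the product.\<close>

lemma count_factors_mult_le:
  assumes "\<And>l. l \<in> P \<Longrightarrow> prime l"
  shows "count_factors P k + count_factors P m \<le> count_factors P (k * m) + (\<Sum>l\<in>P. of_bool (l ^ 2 dvd k * m))"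
  unfolding count_factors_def sum.distrib[symmetric]
proof (rule sum_mono)
  fix l assume "l \<in> P"
  have "l ^ 2 dvd k * m" if "l dvd k" "l dvd m" using mult_dvd_mono[OF that] by (simp add: power2_eq_square)
  thus "of_bool (l dvd k) + of_bool (l dvd m) \<le> of_bool (l dvd k * m) + (of_bool (l ^ 2 dvd k * m) :: real)"
    by (auto simp: of_bool_def)
qed

text \<open>The sieve bounds the primes for each m, and r and R are of the same order in the
  application. That there are few such m is not enough by itself, because sigma(m) / m is unbounded;
  the parameter \<open>D\<close> cuts it off.\<close>

lemma card_primes_with_few_cofactors:
  fixes P :: "nat set" and N :: nat
  assumes P: "finite P" "\<And>l. l \<in> P \<Longrightarrow> prime l" and L: "sum_inv P > 0" and N: "N \<ge> 3"
    and bt: "\<And>m. m > 0 \<Longrightarrow> real m \<le> R \<Longrightarrow>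
      real (card (primes_mod N m)) \<le> 33 * sum_inv_divisors m * (real N / (real m * ln (real N)))"
    and r: "r > 0" and PR: "2 * real (card P) \<le> R" and D: "D > 0"
  shows "real (card (\<Union>m\<in>{m. few_factors P m \<and> r \<le> real m \<and> real m \<le> R}. primes_mod N m))
    \<le> 33 / r * (R * (90 * D / sum_inv P + 9 / D)) * (real N / ln (real N))"
proof -
  define T where "T = real N / ln (real N)"
  define M where "M = nat \<lfloor>R\<rfloor>"
  have T: "T \<ge> 0" using N by (simp add: T_def)
  have R: "R \<ge> 0" using PR by linarith
  have M: "real M \<le> R" unfolding M_def using R by simp
  let ?F = "{m\<in>{1..M}. few_factors P m}"
  let ?B = "{m. few_factors P m \<and> r \<le> real m \<and> real m \<le> R}"
  have sub: "?B \<subseteq> ?F" unfolding M_def using r by (auto simp: le_nat_floor intro: Suc_leI gr0I)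
  hence fin: "finite ?B" by (rule finite_subset) simp
  have s0: "sum_inv_divisors m \<ge> 0" for m unfolding sum_inv_divisors_def by (intro sum_nonneg) auto
  have "real (card (\<Union>m\<in>?B. primes_mod N m)) \<le> real (\<Sum>m\<in>?B. card (primes_mod N m))"
    by (rule of_nat_mono) (rule card_UN_le[OF fin])
  also have "\<dots> = (\<Sum>m\<in>?B. real (card (primes_mod N m)))" by (rule of_nat_sum)
  also have "\<dots> \<le> (\<Sum>m\<in>?B. 33 / r * T * sum_inv_divisors m)"
  proof (rule sum_mono)
    fix m assume m: "m \<in> ?B"
    have m0: "m > 0" "real m > 0" using m r by auto
    have "real (card (primes_mod N m)) \<le> 33 * sum_inv_divisors m * (real N / (real m * ln (real N)))"
      using bt m m0 by blast
    also have "\<dots> = 33 * sum_inv_divisors m * T * (1 / real m)" by (simp add: T_def)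
    also have "\<dots> \<le> 33 * sum_inv_divisors m * T * (1 / r)"
      using m r m0 T s0 by (intro mult_left_mono divide_left_mono mult_nonneg_nonneg) auto
    finally show "real (card (primes_mod N m)) \<le> 33 / r * T * sum_inv_divisors m" by (simp add: mult_ac)
  qed
  also have "\<dots> \<le> (\<Sum>m\<in>?F. 33 / r * T * sum_inv_divisors m)"
    using sub r T s0 by (intro sum_mono2) (auto intro!: mult_nonneg_nonneg)
  also have "\<dots> = 33 / r * T * (\<Sum>m\<in>?F. sum_inv_divisors m)" by (simp only: sum_distrib_left)
  also have "\<dots> \<le> 33 / r * T * (R * (90 * D / sum_inv P + 9 / D))"
  proof (rule mult_left_mono)
    \<comment> \<open>The first summand is paid for by the rarity of integers with few factors, the
      second by the mean square of sigma(m) / m.\<close>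
    have "(\<Sum>m\<in>?F. sum_inv_divisors m) \<le> (\<Sum>m\<in>?F. D + (sum_inv_divisors m)\<^sup>2 * (1 / D))"
    proof (rule sum_mono)
      fix m
      have "0 \<le> (D - sum_inv_divisors m)\<^sup>2 + D * sum_inv_divisors m" using D s0 by (intro add_nonneg_nonneg mult_nonneg_nonneg) auto
      hence "sum_inv_divisors m * D \<le> D * D + (sum_inv_divisors m)\<^sup>2" by (simp add: power2_eq_square algebra_simps)
      hence "sum_inv_divisors m \<le> (D * D + (sum_inv_divisors m)\<^sup>2) / D" using D by (simp add: pos_le_divide_eq)
      thus "sum_inv_divisors m \<le> D + (sum_inv_divisors m)\<^sup>2 * (1 / D)" using D by (simp add: add_divide_distrib)
    qed
    also have "\<dots> = D * real (card ?F) + (\<Sum>m\<in>?F. (sum_inv_divisors m)\<^sup>2) * (1 / D)"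
      by (simp add: sum.distrib sum_divide_distrib)
    also have "\<dots> \<le> D * (45 * (real M + 2 * real (card P)) / sum_inv P) + (9 * real M) * (1 / D)"
    proof (intro add_mono mult_left_mono mult_right_mono)
      show "real (card ?F) \<le> 45 * (real M + 2 * real (card P)) / sum_inv P" by (rule card_few_factors[OF P L])
      have "(\<Sum>m\<in>?F. (sum_inv_divisors m)\<^sup>2) \<le> (\<Sum>m\<in>{1..M}. (sum_inv_divisors m)\<^sup>2)" by (intro sum_mono2) auto
      also have "\<dots> \<le> 9 * real M" by (rule sum_inv_divisors_square_le)
      finally show "(\<Sum>m\<in>?F. (sum_inv_divisors m)\<^sup>2) \<le> 9 * real M" .
    qed (use D in auto)
    also have "\<dots> \<le> D * (45 * (R + R) / sum_inv P) + (9 * R) * (1 / D)"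
      using D L M PR by (intro add_mono mult_left_mono mult_right_mono divide_right_mono) auto
    also have "\<dots> = R * (90 * D / sum_inv P + 9 / D)" by (simp add: algebra_simps)
    finally show "(\<Sum>m\<in>?F. sum_inv_divisors m) \<le> R * (90 * D / sum_inv P + 9 / D)" .
    show "0 \<le> 33 / r * T" using T r by simp
  qed
  finally show ?thesis by (simp only: T_def mult_ac)
qed

text \<open>For most \<open>q\<close> the cofactor \<open>m\<close> of \<open>k\<close> in \<open>q - 1\<close> is also of order \<open>sqrt q\<close>.  A typical integer of either size
  has about \<open>sum_inv P\<close> prime factors in \<open>P\<close>, and so has \<open>q - 1\<close> for a typical prime \<open>q\<close>; hence \<open>k\<close>, \<open>m\<close> or \<open>q - 1\<close> is
  atypical.  Atypical \<open>k\<close> are discarded by counting the prime divisors of \<open>W k\<close>, atypical \<open>m\<close> and \<open>q - 1\<close> by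
  the sieve.\<close>
lemma card_sqrt_divisor_primes:
  fixes W :: "nat \<Rightarrow> nat" and A C \<epsilon> :: real
  assumes W: "\<And>k. k > 0 \<Longrightarrow> W k > 0 \<and> real (W k) \<le> A ^ k" and A: "A > 1" and C: "C > 0" and \<epsilon>: "\<epsilon> > 0"
  shows "\<forall>\<^sub>F N in sequentially. real (card {q. prime q \<and> q \<le> N \<and>
      (\<exists>k>0. real k \<le> C * sqrt (real q) \<and> k dvd q - 1 \<and> q dvd W k)}) \<le> 8 * \<epsilon> * (real N / ln (real N))"
proof -
  \<comment> \<open>\<open>c\<close> is such that the primes dividing some \<open>W k\<close> with k
    \<le> c sqrt N number at most \<epsilon> N / ln N. \<open>K\<close> is the value of 33 R / r for
    cofactors between r = \<delta> sqrt N / (2 C) and R = sqrt N / c, and \<open>D\<close> reduces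
    the mean square term to \<epsilon>.\<close>
  define H where "H = ln A"
  define c where "c = sqrt (\<epsilon> / (2 * H))"
  define \<delta> where "\<delta> = \<epsilon> / 66"
  define K where "K = 66 * C / (\<delta> * c)"
  define D where "D = 9 * K / \<epsilon>"
  have H: "H > 0" using A by (simp add: H_def)
  have c: "c > 0" "2 * H * c\<^sup>2 = \<epsilon>" using H \<epsilon> by (simp_all add: c_def)
  have \<delta>: "\<delta> > 0" using \<epsilon> by (simp add: \<delta>_def)
  have K: "K > 0" using C \<delta> c by (simp add: K_def)
  have D: "D > 0" "K * (9 / D) = \<epsilon>" using K \<epsilon> by (simp_all add: D_def)
  \<comment> \<open>\<open>P\<close> comes last, since its reciprocal sum must beat constants that
    involve \<open>D\<close>. After the 1, the summands serve in this order the atypical cofactors,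
    the atypical k, repeated factors of q - 1 (1980 = 198 / 0.1) and an excess of factors of q -
    1.\<close>
  obtain P where P: "finite P" "\<And>l. l \<in> P \<Longrightarrow> prime l"
    and PB: "sum_inv P \<ge> 1 + 90 * K * D / \<epsilon> + 180 * H * C\<^sup>2 / \<epsilon> + 1980 / \<epsilon> + 15 * (2 + \<bar>ln (\<epsilon> / 33)\<bar>)"
    using ex_primes_sum_inv_ge by blast
  define L where "L = sum_inv P"
  have parts: "90 * K * D / \<epsilon> \<ge> 0" "180 * H * C\<^sup>2 / \<epsilon> \<ge> 0" "1980 / \<epsilon> \<ge> 0" using K D H \<epsilon> by auto
  have L: "L \<ge> 1" "L \<ge> 90 * K * D / \<epsilon>" "L \<ge> 180 * H * C\<^sup>2 / \<epsilon>" "L \<ge> 1980 / \<epsilon>" "L \<ge> 15 * (2 - ln (\<epsilon> / 33))"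
    using PB parts abs_ge_zero[of "ln (\<epsilon> / 33)"] abs_ge_minus_self[of "ln (\<epsilon> / 33)"]
    unfolding L_def distrib_left right_diff_distrib by linarith+
  have L0: "L > 0" using L(1) by simp
  have LD: "K * (90 * D / L) \<le> \<epsilon>" and LC: "180 * H * C\<^sup>2 / L \<le> \<epsilon>" and L6: "198 / (0.1 * L) \<le> \<epsilon>"
    using L(2,3,4) L0 \<epsilon> by (simp_all add: divide_le_eq pos_divide_le_eq mult_ac)
  have L7: "33 * exp (2 - L / 15) \<le> \<epsilon>"
  proof -
    have "exp (2 - L / 15) \<le> exp (ln (\<epsilon> / 33))" using L(5) by simp
    thus ?thesis using \<epsilon> by simp
  qed
  have e1: "\<forall>\<^sub>F N in sequentially. sqrt (real N) + 1 \<le> \<epsilon> * (real N / ln (real N))" using \<epsilon> by real_asymp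
  have e2: "\<forall>\<^sub>F N in sequentially. 2 * real (card P) \<le> C * sqrt (real N)" using C by real_asymp
  have e3: "\<forall>\<^sub>F N in sequentially. 2 * real (card P) \<le> 1 / c * sqrt (real N)" using c(1) by real_asymp
  have e4: "\<forall>\<^sub>F N in sequentially. \<forall>m. m > 0 \<and> real m \<le> 1 / c * sqrt (real N) \<longrightarrow>
      real (card (primes_mod N m)) \<le> 33 * sum_inv_divisors m * (real N / (real m * ln (real N)))"
    unfolding primes_mod_def using c(1) by (intro brun_titchmarsh) simp
  have e5: "\<forall>\<^sub>F N in sequentially. real (card {q. prime q \<and> real q \<le> \<delta> * real N}) \<le> 66 * \<delta> * (real N / ln (real N))"
    by (rule card_primes_le_small[OF \<delta>])
  have e6: "\<forall>\<^sub>F N in sequentially. real (card {q\<in>primes_mod N 1. 0.1 * L \<le> (\<Sum>l\<in>P. of_bool (l ^ 2 dvd q - 1))})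
      \<le> 198 / (0.1 * L) * (real N / ln (real N))"
    using L0 by (intro card_many_square_factors P) auto
  have e7: "\<forall>\<^sub>F N in sequentially. real (card {q\<in>primes_mod N 1. 1.6 * L \<le> count_factors P (q - 1)})
      \<le> 33 * exp (2 - L / 15) * (real N / ln (real N))"
    unfolding L_def by (rule card_many_factors[OF P])
  have e8: "\<forall>\<^sub>F N in sequentially. (3::nat) \<le> N" by (rule eventually_ge_at_top)
  show ?thesis using e1 e2 e3 e4 e5 e6 e7 e8
  proof eventually_elim
    case (elim N)
    define T where "T = real N / ln (real N)"
    define x where "x = sqrt (real N)"
    have N: "real N \<ge> 3" using elim(8) by simp
    have T: "T \<ge> 0" using N by (simp add: T_def)
    have x: "x > 0" "x * x = real N" using N by (simp_all add: x_def)
    \<comment> \<open>The primes up to sqrt N go into \<open>S1\<close>, so that only O(k / ln N) of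
      the remaining ones can divide a single \<open>W k\<close>.\<close>
    define big where "big = (\<lambda>B. {q. prime q \<and> sqrt (real N) < real q \<and> (\<exists>k\<in>B. q dvd W k)})"
    define S1 where "S1 = {q::nat. real q \<le> x}"
    define B2 where "B2 = {1..nat \<lfloor>c * x\<rfloor>}"
    define B3 where "B3 = {k\<in>{1..nat \<lfloor>C * x\<rfloor>}. few_factors P k}"
    define S4 where "S4 = {q. prime q \<and> real q \<le> \<delta> * real N}"
    define S5 where "S5 = (\<Union>m\<in>{m. few_factors P m \<and> \<delta> * x / (2 * C) \<le> real m \<and> real m \<le> 1 / c * x}. primes_mod N m)"
    define S6 where "S6 = {q\<in>primes_mod N 1. 0.1 * L \<le> (\<Sum>l\<in>P. of_bool (l ^ 2 dvd q - 1))}"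
    define S7 where "S7 = {q\<in>primes_mod N 1. 1.6 * L \<le> count_factors P (q - 1)}"
    let ?Bad = "{q. prime q \<and> q \<le> N \<and> (\<exists>k>0. real k \<le> C * sqrt (real q) \<and> k dvd q - 1 \<and> q dvd W k)}"
    have S1eq: "S1 = {..nat \<lfloor>x\<rfloor>}" unfolding S1_def using x(1) by (auto simp: le_nat_floor_iff)
    have S1: "real (card S1) \<le> \<epsilon> * T"
    proof -
      have "real (card S1) \<le> x + 1" unfolding S1eq using x(1) by simp
      thus ?thesis using elim(1) by (simp add: T_def x_def)
    qed
    have bigB: "real (card (big B)) \<le> b * y * (2 * H / ln (real N))"
      if "finite B" "\<And>k. k \<in> B \<Longrightarrow> 0 < k \<and> real k \<le> y" "real (card B) \<le> b" "y \<ge> 0" for B b y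
    proof -
      have "real (card (big B)) \<le> real (card B) * y * (2 * ln A / ln (real N))" unfolding big_def
        using that W A N by (intro card_large_prime_divisors_Union) auto
      also have "\<dots> \<le> b * y * (2 * ln A / ln (real N))"
        using that A N by (intro mult_right_mono divide_nonneg_nonneg) auto
      finally show ?thesis by (simp add: H_def)
    qed
    have S2: "real (card (big B2)) \<le> \<epsilon> * T"
    proof -
      have "real (card (big B2)) \<le> (c * x) * (c * x) * (2 * H / ln (real N))"
      proof (rule bigB)
        fix k assume "k \<in> B2"
        thus "0 < k \<and> real k \<le> c * x" unfolding B2_def using c x by (simp add: le_nat_floor_iff)
      qed (use c x in \<open>auto simp: B2_def\<close>)
      also have "\<dots> = 2 * H * c\<^sup>2 * ((x * x) / ln (real N))" by (simp add: power2_eq_square)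
      finally show ?thesis by (simp only: c(2) x(2) T_def)
    qed
    have S3: "real (card (big B3)) \<le> \<epsilon> * T"
    proof -
      have M: "real (nat \<lfloor>C * x\<rfloor>) \<le> C * x" using C x by simp
      have "real (card (big B3)) \<le> (90 * (C * x) / L) * (C * x) * (2 * H / ln (real N))"
      proof (rule bigB)
        fix k assume "k \<in> B3"
        thus "0 < k \<and> real k \<le> C * x" unfolding B3_def using M by auto
      next
        have "real (card B3) \<le> 45 * (real (nat \<lfloor>C * x\<rfloor>) + 2 * real (card P)) / L"
          unfolding B3_def L_def using L0 by (intro card_few_factors P) (auto simp: L_def)
        also have "\<dots> \<le> 45 * (C * x + C * x) / L"
          using M elim(2) L0 by (intro divide_right_mono mult_left_mono add_mono) (auto simp: x_def)
        finally show "real (card B3) \<le> 90 * (C * x) / L" by simp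
      qed (use C x in \<open>auto simp: B3_def\<close>)
      also have "\<dots> = 180 * H * C\<^sup>2 / L * ((x * x) / ln (real N))" by (simp add: power2_eq_square)
      also have "\<dots> \<le> \<epsilon> * T" unfolding x(2) T_def[symmetric] by (rule mult_right_mono[OF LC T])
      finally show ?thesis .
    qed
    have S4: "real (card S4) \<le> \<epsilon> * T" using elim(5) by (simp add: S4_def \<delta>_def T_def)
    have S5: "real (card S5) \<le> 2 * \<epsilon> * T"
    proof -
      have "real (card S5) \<le> 33 / (\<delta> * x / (2 * C)) * ((1 / c * x) * (90 * D / L + 9 / D)) * T"
        unfolding S5_def L_def T_def using elim(3,4,8) \<delta> x C D L0
        by (intro card_primes_with_few_cofactors P) (auto simp: L_def x_def)
      also have "33 / (\<delta> * x / (2 * C)) * ((1 / c * x) * (90 * D / L + 9 / D)) = K * (90 * D / L + 9 / D)"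
        using x(1) by (simp add: K_def)
      also have "\<dots> \<le> 2 * \<epsilon>" using LD D(2) by (simp only: distrib_left)
      finally show ?thesis using T by (simp add: mult_right_mono)
    qed
    have S6: "real (card S6) \<le> \<epsilon> * T"
      using elim(6) mult_right_mono[OF L6 T] unfolding S6_def T_def by linarith
    have S7: "real (card S7) \<le> \<epsilon> * T"
      using elim(7) mult_right_mono[OF L7 T] unfolding S7_def T_def by linarith
    have cover: "?Bad \<subseteq> S1 \<union> (big B2 \<inter> {..N}) \<union> (big B3 \<inter> {..N}) \<union> S4 \<union> S5 \<union> S6 \<union> S7"
    proof
      fix q assume "q \<in> ?Bad"
      then obtain k where q: "prime q" "q \<le> N" and k: "k > 0" "real k \<le> C * sqrt (real q)" "k dvd q - 1" "q dvd W k" by blast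
      show "q \<in> S1 \<union> (big B2 \<inter> {..N}) \<union> (big B3 \<inter> {..N}) \<union> S4 \<union> S5 \<union> S6 \<union> S7"
      proof (rule ccontr)
        assume neg: "q \<notin> S1 \<union> (big B2 \<inter> {..N}) \<union> (big B3 \<inter> {..N}) \<union> S4 \<union> S5 \<union> S6 \<union> S7"
        have q2: "q \<ge> 2" using q(1) by (rule prime_ge_2_nat)
        have qx: "x < real q" using neg by (auto simp: S1_def)
        have q\<delta>: "\<delta> * real N < real q" using neg q(1) by (auto simp: S4_def)
        have "sqrt (real q) \<le> x" unfolding x_def using q(2) by simp
        hence kC: "real k \<le> C * x" using k(2) C by (meson mult_left_mono order_trans less_imp_le)
        have "k \<notin> B2" "k \<notin> B3" using neg q k qx unfolding big_def x_def by auto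
        hence kc: "c * x < real k" and fk: "\<not> few_factors P k"
          using k(1) kC c x C unfolding B2_def B3_def by (auto simp: le_nat_floor_iff not_le Suc_le_eq)
        obtain m where m: "q - 1 = k * m" using k(3) by blast
        have km: "real k * real m = real q - 1" using m q2 by (metis of_nat_mult of_nat_diff of_nat_1 one_le_numeral order_trans)
        have m0: "m > 0" using m q2 by (intro gr0I) auto
        have qmod: "q \<in> primes_mod N m" "q \<in> primes_mod N 1" using q m by (auto simp: primes_mod_def)
        \<comment> \<open>The upper bound for m comes from k > c x and k m \<le> N, the lower one
          from k \<le> C x, q > \<delta> N and q - 1 \<ge> q / 2.\<close>
        have "real m * (c * x) \<le> real m * real k" using kc by (intro mult_left_mono) auto
        also have "\<dots> \<le> x * x" using km q(2) x(2) by (simp add: mult.commute)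
        finally have "real m * c \<le> x" using x(1) by (simp add: mult.assoc[symmetric])
        hence mR: "real m \<le> 1 / c * x" using c(1) by (simp add: pos_le_divide_eq)
        have "\<delta> * (x * x) / 2 \<le> real q / 2" using q\<delta> x(2) by simp
        also have "\<dots> \<le> real k * real m" using km q2 by simp
        also have "\<dots> \<le> (C * x) * real m" using kC by (intro mult_right_mono) auto
        finally have "(\<delta> * x / 2) * x \<le> (C * real m) * x" by (simp add: mult_ac)
        hence "\<delta> * x / 2 \<le> C * real m" using x(1) by (simp only: mult_le_cancel_right_pos)
        hence mr: "\<delta> * x / (2 * C) \<le> real m" using C by (simp add: divide_le_eq mult_ac)
        have fm: "\<not> few_factors P m" using neg mR mr qmod(1) by (auto simp: S5_def)
        \<comment> \<open>Twice 0.85 is 1.7, so one of the thresholds 1.6 and 0.1 is reached,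
          contrary to q lying outside \<open>S6\<close> and \<open>S7\<close>.\<close>
        have "1.7 * L \<le> count_factors P k + count_factors P m" using fk fm by (simp add: few_factors_def L_def)
        also have "\<dots> \<le> count_factors P (q - 1) + (\<Sum>l\<in>P. of_bool (l ^ 2 dvd q - 1))"
          unfolding m by (rule count_factors_mult_le[OF P(2)])
        finally have "1.6 * L \<le> count_factors P (q - 1) \<or> 0.1 * L \<le> (\<Sum>l\<in>P. of_bool (l ^ 2 dvd q - 1))" by linarith
        thus False using neg qmod(2) by (auto simp: S6_def S7_def)
      qed
    qed
    have finbig: "finite (big B)" if "finite B" "\<And>k. k \<in> B \<Longrightarrow> 0 < k" for B
    proof (rule finite_subset)
      show "big B \<subseteq> (\<Union>k\<in>B. {q. q dvd W k})" by (auto simp: big_def)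
      show "finite (\<Union>k\<in>B. {q. q dvd W k})" using that W by (intro finite_UN_I finite_divisors_nat) auto
    qed
    have fb: "finite (big B2)" "finite (big B3)" by (rule finbig; auto simp: B2_def B3_def)+
    have fin: "finite S1" "finite S4" "finite S5" "finite S6" "finite S7"
    proof -
      show "finite S1" by (simp add: S1eq)
      show "finite S4" unfolding S4_def
        by (rule finite_subset[of _ "{..nat \<lfloor>\<delta> * real N\<rfloor>}"]) (use \<delta> in \<open>auto simp: le_nat_floor_iff\<close>)
      show "finite S5" by (rule finite_subset[of _ "{..N}"]) (auto simp: S5_def primes_mod_def)
      show "finite S6" "finite S7" unfolding S6_def S7_def using finite_primes_mod by auto
    qed
    have "card ?Bad \<le> card (S1 \<union> (big B2 \<inter> {..N}) \<union> (big B3 \<inter> {..N}) \<union> S4 \<union> S5 \<union> S6 \<union> S7)"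
      using fin by (intro card_mono cover) auto
    also have "\<dots> \<le> card S1 + card (big B2 \<inter> {..N}) + card (big B3 \<inter> {..N}) + card S4 + card S5 + card S6 + card S7"
      by (meson add_le_mono1 card_Un_le order_trans)
    finally have le: "card ?Bad \<le> card S1 + card (big B2 \<inter> {..N}) + card (big B3 \<inter> {..N}) + card S4 + card S5 + card S6 + card S7" .
    have "card (big B2 \<inter> {..N}) \<le> card (big B2)" "card (big B3 \<inter> {..N}) \<le> card (big B3)"
      using fb by (auto intro: card_mono)
    with le have "real (card ?Bad) \<le> real (card S1) + real (card (big B2)) + real (card (big B3)) + real (card S4)
        + real (card S5) + real (card S6) + real (card S7)" by linarith
    \<comment> \<open>Seven sets, of which \<open>S5\<close> counts twice.\<close>
    hence "real (card ?Bad) \<le> 8 * \<epsilon> * T" using S1 S2 S3 S4 S5 S6 S7 by linarith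
    thus ?case by (simp add: T_def)
  qed
qed

text \<open>By Chebyshev's bound N / ln N is at most 6 times the number of primes up to N, so o(N /
  ln N) primes are negligible among all primes.\<close>

lemma prime_density_one:
  assumes sparse: "\<And>\<epsilon>. \<epsilon> > 0 \<Longrightarrow> \<forall>\<^sub>F N in sequentially. real (card {q\<in>B. prime q \<and> q \<le> N}) \<le> \<epsilon> * (real N / ln (real N))"
  shows "prime_density {q. prime q \<and> q \<notin> B} 1"
  unfolding prime_density_def
proof (rule LIMSEQ_I)
  fix r :: real assume r: "r > 0"
  hence r12: "r / 12 > 0" by simp
  have "\<forall>\<^sub>F N in sequentially. norm (real (card {p \<in> {q. prime q \<and> q \<notin> B}. prime p \<and> p \<le> N}) / real (card {p. prime p \<and> p \<le> N}) - 1) < r"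
    using sparse[OF r12] eventually_ge_at_top[of 3]
  proof eventually_elim
    case (elim N)
    let ?G = "{p \<in> {q. prime q \<and> q \<notin> B}. prime p \<and> p \<le> N}" and ?B = "{q\<in>B. prime q \<and> q \<le> N}"
    define t where "t = real N / ln (real N)"
    have t: "t > 0" using elim(2) by (simp add: t_def)
    have eq: "{p. prime p \<and> p \<le> N} = ?G \<union> ?B" by blast
    have "card (?G \<union> ?B) = card ?G + card ?B" by (intro card_Un_disjoint) auto
    hence "prime_count N = card ?G + card ?B" unfolding prime_count_def eq .
    hence sum: "real (prime_count N) = real (card ?G) + real (card ?B)" by (simp only: of_nat_add)
    have pc: "real (prime_count N) \<ge> t / 6" using prime_count_lower_bound[OF elim(2)] by (simp add: t_def)
    hence pc0: "real (prime_count N) > 0" using t by linarith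
    have "real (card ?G) / real (prime_count N) - 1 = - (real (card ?B) / real (prime_count N))"
      using pc0 sum by (simp add: field_simps)
    hence "norm (real (card ?G) / real (prime_count N) - 1) = real (card ?B) / real (prime_count N)" by simp
    also have "\<dots> \<le> (r / 12 * t) / (t / 6)"
      using pc t elim(1) r by (intro frac_le) (auto simp: t_def)
    also have "\<dots> = r / 2" using t by simp
    also have "\<dots> < r" using r by simp
    finally show ?case by (simp add: prime_count_def)
  qed
  thus "\<exists>no. \<forall>n\<ge>no. norm (real (card {p \<in> {q. prime q \<and> q \<notin> B}. prime p \<and> p \<le> n}) / real (card {p. prime p \<and> p \<le> n}) - 1) < r"
    by (simp add: eventually_sequentially)
qed

section \<open>Cosets of open subgroups\<close>

definition subgrp :: "'a::ab_group_add set \<Rightarrow> bool" where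
  "subgrp H \<longleftrightarrow> 0 \<in> H \<and> (\<forall>x\<in>H. \<forall>y\<in>H. x - y \<in> H)"

definition coset :: "'a::ab_group_add set \<Rightarrow> 'a \<Rightarrow> 'a set" where
  "coset H x = {y. y - x \<in> H}"

text \<open>The number of cosets of \<open>H\<close> that meet \<open>K\<close>, which is the index
  when \<open>H\<close> is a subgroup of \<open>K\<close>. Arbitrary sets \<open>K\<close> are
  allowed so that the same count gives densities for the Haar measure. An infinite count yields 0,
  hence the finiteness premises below.\<close>

definition idx :: "'a::ab_group_add set \<Rightarrow> 'a set \<Rightarrow> nat" where
  "idx K H = card (coset H ` K)"

abbreviation additive_map :: "('a::ab_group_add \<Rightarrow> 'a) \<Rightarrow> bool" where
  "additive_map f \<equiv> \<forall>x y. f (x + y) = f x + f y"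

lemma additive_map_diff:
  assumes "additive_map f" shows "f (x - y) = f x - f y"
  by (metis add_diff_cancel assms diff_add_cancel)

lemma additive_map_0:
  assumes "additive_map f" shows "f 0 = 0"
  using additive_map_diff[OF assms, of 0 0] by simp

lemma subgrpD:
  assumes "subgrp H"
  shows "0 \<in> H" "x \<in> H \<Longrightarrow> y \<in> H \<Longrightarrow> x - y \<in> H" "x \<in> H \<Longrightarrow> - x \<in> H"
    "x \<in> H \<Longrightarrow> y \<in> H \<Longrightarrow> x + y \<in> H" "x - y \<in> H \<longleftrightarrow> y - x \<in> H"
proof -
  show 0: "0 \<in> H" and d: "x \<in> H \<Longrightarrow> y \<in> H \<Longrightarrow> x - y \<in> H" for x y
    using assms by (auto simp: subgrp_def)
  show m: "x \<in> H \<Longrightarrow> - x \<in> H" for x using d[OF 0, of x] by simp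
  show "x \<in> H \<Longrightarrow> y \<in> H \<Longrightarrow> x + y \<in> H" for x y using d[of x "- y"] m[of y] by simp
  show "x - y \<in> H \<longleftrightarrow> y - x \<in> H" using m[of "x - y"] m[of "y - x"] by auto
qed

lemma coset_eq_iff:
  assumes "subgrp H" shows "coset H x = coset H y \<longleftrightarrow> x - y \<in> H"
proof
  assume "coset H x = coset H y"
  moreover have "x \<in> coset H x" using subgrpD(1)[OF assms] by (simp add: coset_def)
  ultimately show "x - y \<in> H" by (auto simp: coset_def)
next
  assume xy: "x - y \<in> H"
  have "z - x \<in> H \<longleftrightarrow> z - y \<in> H" for z
    using subgrpD(4)[OF assms, of "z - x" "x - y"] subgrpD(2)[OF assms, of "z - y" "x - y"] xy by auto
  thus "coset H x = coset H y" by (auto simp: coset_def)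
qed

text \<open>On \<open>A\<close> the map \<open>q\<close> factors through \<open>p\<close>.\<close>

lemma card_image_le_card_image:
  assumes "finite (p ` A)" "\<And>x y. x \<in> A \<Longrightarrow> y \<in> A \<Longrightarrow> p x = p y \<Longrightarrow> q x = q y"
  shows "finite (q ` A)" "card (q ` A) \<le> card (p ` A)"
proof -
  have "q ` A \<subseteq> (\<lambda>c. q (SOME x. x \<in> A \<and> p x = c)) ` (p ` A)"
  proof
    fix c assume "c \<in> q ` A"
    then obtain x where x: "x \<in> A" "c = q x" by blast
    have "(SOME y. y \<in> A \<and> p y = p x) \<in> A \<and> p (SOME y. y \<in> A \<and> p y = p x) = p x"
      by (rule someI[of _ x]) (use x in simp)
    hence "q (SOME y. y \<in> A \<and> p y = p x) = q x" using assms(2) x(1) by blast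
    thus "c \<in> (\<lambda>c. q (SOME x. x \<in> A \<and> p x = c)) ` (p ` A)" using x by force
  qed
  thus "finite (q ` A)" "card (q ` A) \<le> card (p ` A)"
    using assms(1) by (rule finite_surj[rotated], intro surj_card_le)
qed

lemma card_image_eq_card_image:
  assumes "\<And>x y. x \<in> A \<Longrightarrow> y \<in> A \<Longrightarrow> p x = p y \<longleftrightarrow> q x = q y"
  shows "card (q ` A) = card (p ` A)"
proof (cases "finite (p ` A)")
  case True
  note 1 = card_image_le_card_image[OF True, of q] 
  have fq: "finite (q ` A)" using 1 assms by blast
  show ?thesis using 1 assms card_image_le_card_image[OF fq, of p] by (meson le_antisym)
next
  case False
  hence "\<not> finite (q ` A)" using card_image_le_card_image(1)[of q A p] assms by blast
  thus ?thesis using False by simp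
qed

text \<open>Beyond subgroups this covers unions \<open>G\<close> of cosets of \<open>K\<close>, as
  needed for refining coset densities. Representatives \<open>s\<close> identify the cosets of
  \<open>H\<close> in \<open>G\<close> with pairs of a coset of \<open>K\<close> in \<open>G\<close>
  and a coset of \<open>H\<close> in \<open>K\<close>.\<close>

lemma idx_tower_saturated:
  assumes G: "\<And>x k. x \<in> G \<Longrightarrow> k \<in> K \<Longrightarrow> x + k \<in> G" and K: "subgrp K" and H: "subgrp H" "H \<subseteq> K"
  shows "idx G H = idx G K * idx K H"
proof -
  define s where "s = (\<lambda>C. SOME x. x \<in> G \<and> coset K x = C)"
  have s: "s (coset K x) \<in> G" "coset K (s (coset K x)) = coset K x" if "x \<in> G" for x
    unfolding s_def using someI[of "\<lambda>y. y \<in> G \<and> coset K y = coset K x" x] that by auto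
  define \<phi> where "\<phi> = (\<lambda>x. (coset K x, coset H (x - s (coset K x))))"
  have "card (\<phi> ` G) = card (coset H ` G)"
  proof (rule card_image_eq_card_image)
    fix x y assume "x \<in> G" "y \<in> G"
    have "coset H x = coset H y \<Longrightarrow> coset K x = coset K y"
      using H by (auto simp: coset_eq_iff[OF H(1)] coset_eq_iff[OF K])
    thus "(coset H x = coset H y) = (\<phi> x = \<phi> y)"
      by (auto simp: \<phi>_def coset_eq_iff[OF H(1)])
  qed
  moreover have "\<phi> ` G = (coset K ` G) \<times> (coset H ` K)"
  proof (intro equalityI subsetI)
    fix t assume "t \<in> \<phi> ` G"
    then obtain x where x: "x \<in> G" "t = \<phi> x" by blast
    have "x - s (coset K x) \<in> K" using s(2)[OF x(1)] by (metis coset_eq_iff[OF K])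
    thus "t \<in> (coset K ` G) \<times> (coset H ` K)" using x by (auto simp: \<phi>_def)
  next
    fix t assume "t \<in> (coset K ` G) \<times> (coset H ` K)"
    then obtain x k where t: "x \<in> G" "k \<in> K" "t = (coset K x, coset H k)" by auto
    let ?y = "s (coset K x) + k"
    have "?y \<in> G" using t s G by blast
    moreover have "coset K ?y = coset K x"
      using t s(2)[OF t(1)] by (metis K add_diff_cancel_left' coset_eq_iff)
    ultimately show "t \<in> \<phi> ` G" using t(3) by (intro image_eqI[of _ _ ?y]) (auto simp: \<phi>_def)
  qed
  ultimately show ?thesis by (simp add: idx_def card_cartesian_product)
qed

lemma idx_tower:
  assumes "subgrp G" "subgrp K" "K \<subseteq> G" "subgrp H" "H \<subseteq> K"
  shows "idx G H = idx G K * idx K H"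
  using assms subgrpD(4)[OF assms(1)] by (intro idx_tower_saturated) auto

lemma idx_le_injective:
  assumes f: "additive_map f" and H: "subgrp H" and H': "subgrp H'"
    and "f ` K \<subseteq> K'" "finite (coset H' ` K')"
    and "\<And>x y. x \<in> K \<Longrightarrow> y \<in> K \<Longrightarrow> f (x - y) \<in> H' \<Longrightarrow> x - y \<in> H"
  shows "idx K H \<le> idx K' H'"
proof -
  have fin: "finite ((\<lambda>x. coset H' (f x)) ` K)"
    by (rule finite_subset[OF _ assms(5)]) (use assms(4) in blast)
  have "idx K H \<le> card ((\<lambda>x. coset H' (f x)) ` K)" unfolding idx_def
    by (rule card_image_le_card_image[OF fin])
      (use assms(6) in \<open>auto simp: coset_eq_iff[OF H] coset_eq_iff[OF H'] additive_map_diff[OF f]\<close>)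
  also have "\<dots> \<le> idx K' H'" unfolding idx_def
    by (rule card_mono[OF assms(5)]) (use assms(4) in blast)
  finally show ?thesis .
qed

lemma idx_le_surjective:
  assumes f: "additive_map f" and H: "subgrp H" and H': "subgrp H'"
    and "K' \<subseteq> f ` K" "finite (coset H ` K)" "f ` H \<subseteq> H'"
  shows "finite (coset H' ` K')" "idx K' H' \<le> idx K H"
proof -
  have *: "coset H' (f x) = coset H' (f y)" if "coset H x = coset H y" for x y
    using that assms(6) by (auto simp: coset_eq_iff[OF H] coset_eq_iff[OF H'] simp flip: additive_map_diff[OF f])
  note c = card_image_le_card_image[OF assms(5), of "\<lambda>x. coset H' (f x)", OF *]
  have sub: "coset H' ` K' \<subseteq> (\<lambda>x. coset H' (f x)) ` K" using assms(4) by blast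
  show "finite (coset H' ` K')" using finite_subset[OF sub c(1)] .
  show "idx K' H' \<le> idx K H" using card_mono[OF c(1) sub] c(2) by (simp add: idx_def)
qed

lemma card_le_idx:
  assumes "subgrp H" "finite (coset H ` K)" "S \<subseteq> K" "\<And>x y. x \<in> S \<Longrightarrow> y \<in> S \<Longrightarrow> x - y \<in> H \<Longrightarrow> x = y"
  shows "finite S" "card S \<le> idx K H"
proof -
  have inj: "inj_on (coset H) S"
    by (rule inj_onI) (use assms(4) coset_eq_iff[OF assms(1)] in blast)
  have fin: "finite (coset H ` S)" using assms(2,3) by (meson finite_subset image_mono)
  show "finite S" using fin inj by (rule finite_imageD)
  show "card S \<le> idx K H"
    using card_image[OF inj] card_mono[OF assms(2) image_mono[OF assms(3)]] by (simp add: idx_def)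
qed

lemma ex_transversal:
  assumes "subgrp H"
  obtains S where "S \<subseteq> K" "card S = idx K H" "\<And>x y. x \<in> S \<Longrightarrow> y \<in> S \<Longrightarrow> x - y \<in> H \<Longrightarrow> x = y"
    "finite (coset H ` K) \<Longrightarrow> finite S"
proof -
  let ?s = "\<lambda>C. SOME x. x \<in> K \<and> coset H x = C"
  have s: "?s C \<in> K \<and> coset H (?s C) = C" if "C \<in> coset H ` K" for C
    using someI_ex[of "\<lambda>x. x \<in> K \<and> coset H x = C"] that by auto
  let ?S = "?s ` (coset H ` K)"
  have inj: "inj_on ?s (coset H ` K)" using s by (intro inj_onI) metis
  show ?thesis
  proof (rule that[of ?S])
    show "?S \<subseteq> K" using s by blast
    show "card ?S = idx K H" using card_image[OF inj] by (simp add: idx_def)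
    show "x = y" if "x \<in> ?S" "y \<in> ?S" "x - y \<in> H" for x y
    proof -
      have "coset H x = coset H y" using that(3) coset_eq_iff[OF assms] by blast
      thus ?thesis using that(1,2) s by (metis (no_types, lifting) imageE)
    qed
    show "finite (coset H ` K) \<Longrightarrow> finite ?S" by simp
  qed
qed

lemma idx_Int_le:
  assumes "subgrp A" "subgrp B" "finite (range (coset A))" "finite (range (coset B))"
  shows "idx UNIV (A \<inter> B) \<le> idx UNIV A * idx UNIV B"
proof -
  have AB: "subgrp (A \<inter> B)" using assms by (auto simp: subgrp_def)
  have fin: "finite ((\<lambda>x. (coset A x, coset B x)) ` UNIV)"
    by (rule finite_subset[of _ "range (coset A) \<times> range (coset B)"]) (use assms in auto)
  have "idx UNIV (A \<inter> B) \<le> card ((\<lambda>x. (coset A x, coset B x)) ` UNIV)" unfolding idx_def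
    by (rule card_image_le_card_image[OF fin]) (use assms in \<open>auto simp: coset_eq_iff AB\<close>)
  also have "\<dots> \<le> card (range (coset A) \<times> range (coset B))"
    by (rule card_mono) (use assms in auto)
  finally show ?thesis by (simp add: idx_def card_cartesian_product)
qed

section \<open>Open subgroups of a compact zero-dimensional group\<close>

definition opsub :: "'a::topological_ab_group_add set \<Rightarrow> bool" where
  "opsub H \<longleftrightarrow> open H \<and> subgrp H"

lemma open_coset:
  assumes "open (H :: 'a::topological_ab_group_add set)" shows "open (coset H x)"
proof -
  have "coset H x = (\<lambda>y. y - x) -` H" by (auto simp: coset_def)
  thus ?thesis by (auto intro!: open_vimage assms continuous_intros)
qed

lemma opsub_coset_finite:
  assumes "compact (UNIV :: 'a::topological_ab_group_add set)" "opsub (H :: 'a set)"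
  shows "finite (coset H ` K)"
proof -
  have H: "subgrp H" "open H" using assms by (auto simp: opsub_def)
  have "UNIV \<subseteq> (\<Union>x. coset H x)" using subgrpD(1)[OF H(1)] by (auto simp: coset_def)
  then obtain D where D: "finite D" "UNIV \<subseteq> (\<Union>x\<in>D. coset H x)"
    using compactE_image[OF assms(1), of UNIV "coset H"] open_coset[OF H(2)] by auto
  have "range (coset H) \<subseteq> coset H ` D"
  proof
    fix C assume "C \<in> range (coset H)"
    then obtain x where x: "C = coset H x" by blast
    obtain y where "y \<in> D" "x - y \<in> H" using D(2) by (auto simp: coset_def)
    thus "C \<in> coset H ` D" using x coset_eq_iff[OF H(1)] by blast
  qed
  hence "finite (range (coset H))" using D(1) finite_surj by blast
  thus ?thesis by (rule rev_finite_subset) auto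
qed

lemma opsub_closed: "opsub H \<Longrightarrow> closed (H :: 'a::topological_ab_group_add set)"
proof -
  assume H: "opsub H"
  hence s: "subgrp H" and o: "open H" by (auto simp: opsub_def)
  have "- H = (\<Union>x\<in>-H. coset H x)"
  proof (intro equalityI subsetI)
    fix y assume "y \<in> (\<Union>x\<in>-H. coset H x)"
    then obtain x where x: "x \<notin> H" "y - x \<in> H" by (auto simp: coset_def)
    show "y \<in> - H" using x subgrpD(2)[OF s, of y "y - x"] by auto
  qed (use subgrpD(1)[OF s] in \<open>force simp: coset_def\<close>)
  moreover have "open (\<Union>x\<in>-H. coset H x)" using open_coset[OF o] by blast
  ultimately show "closed H" by (simp add: closed_def)
qed

context
  assumes comp: "compact (UNIV :: 'a::{metric_space, topological_ab_group_add} set)"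
begin

text \<open>The metric is not assumed to be translation invariant; uniform continuity of subtraction
  on the compact square takes the place of invariance, since the diagonal is sent to 0.\<close>

lemma small_diff_in_open:
  assumes "open (U :: 'a set)" "0 \<in> U"
  obtains \<epsilon> where "\<epsilon> > 0" "\<And>x y. dist x y \<le> \<epsilon> \<Longrightarrow> x - y \<in> U"
proof -
  obtain \<delta> where \<delta>: "\<delta> > 0" "ball 0 \<delta> \<subseteq> U" using assms openE by blast
  have "continuous_on UNIV (\<lambda>p :: 'a \<times> 'a. fst p - snd p)" by (intro continuous_intros)
  moreover have "compact (UNIV :: ('a \<times> 'a) set)" using compact_Times[OF comp comp] by simp
  ultimately have "uniformly_continuous_on UNIV (\<lambda>p :: 'a \<times> 'a. fst p - snd p)"
    by (rule compact_uniformly_continuous)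
  then obtain e where e: "e > 0" "\<And>p q :: 'a \<times> 'a. dist q p < e \<Longrightarrow> dist (fst q - snd q) (fst p - snd p) < \<delta>"
    using \<delta>(1) unfolding uniformly_continuous_on_def by (metis UNIV_I)
  show ?thesis
  proof (rule that[of "e / 2"])
    fix x y :: 'a assume "dist x y \<le> e / 2"
    hence "dist (x, y) (y, y) < e" using e(1) by (simp add: dist_Pair_Pair)
    from e(2)[OF this] show "x - y \<in> U" using \<delta>(2) by (auto simp: dist_commute)
  qed (use e in simp)
qed

lemma close_of_small_diff:
  assumes "\<epsilon> > 0"
  obtains \<delta> where "\<delta> > 0" "\<And>x h :: 'a. dist h 0 < \<delta> \<Longrightarrow> dist (x + h) x < \<epsilon>"
proof -
  have "continuous_on UNIV (\<lambda>p :: 'a \<times> 'a. fst p + snd p)" by (intro continuous_intros)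
  moreover have "compact (UNIV :: ('a \<times> 'a) set)" using compact_Times[OF comp comp] by simp
  ultimately have "uniformly_continuous_on UNIV (\<lambda>p :: 'a \<times> 'a. fst p + snd p)"
    by (rule compact_uniformly_continuous)
  then obtain e where e: "e > 0" "\<And>p q :: 'a \<times> 'a. dist q p < e \<Longrightarrow> dist (fst q + snd q) (fst p + snd p) < \<epsilon>"
    using assms unfolding uniformly_continuous_on_def by (metis UNIV_I)
  show ?thesis
  proof (rule that[OF e(1)])
    fix x h :: 'a assume "dist h 0 < e"
    hence "dist (x, h) (x, 0) < e" by (simp add: dist_Pair_Pair)
    from e(2)[OF this] show "dist (x + h) x < \<epsilon>" by simp
  qed
qed

text \<open>Take for \<open>H\<close> the translations that preserve a clopen neighbourhood
  \<open>V\<close> of 0. They form a subgroup inside \<open>V\<close>, and a Lebesgue number of the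
  cover by \<open>V\<close> and its complement shows that it contains a ball.\<close>

lemma opsub_basis:
  assumes zd: "zero_dim_space (UNIV :: 'a set)" and W: "open (W :: 'a set)" "0 \<in> W"
  obtains H where "opsub H" "H \<subseteq> W"
proof -
  obtain V where V: "open V" "closed V" "0 \<in> V" "V \<subseteq> W"
    using zd W unfolding zero_dim_space_def by blast
  obtain d where d: "d > 0" "\<And>x. \<exists>G\<in>{V, - V}. ball x d \<subseteq> G"
  proof (rule Heine_Borel_lemma[OF comp, of "{V, - V}"])
  qed (use V(1,2) in \<open>auto simp: open_Compl\<close>)
  obtain \<delta> where \<delta>: "\<delta> > 0" "\<And>x h :: 'a. dist h 0 < \<delta> \<Longrightarrow> dist (x + h) x < d"
    using close_of_small_diff[OF d(1)] by blast
  define H :: "'a set" where "H = {h. \<forall>x. x + h \<in> V \<longleftrightarrow> x \<in> V}"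
  have N: "ball 0 \<delta> \<subseteq> H"
  proof
    fix h :: 'a assume "h \<in> ball 0 \<delta>"
    hence "dist (x + h) x < d" for x using \<delta>(2) by (simp add: dist_commute)
    hence "x + h \<in> ball x d" "x \<in> ball x d" for x using d(1) by (simp_all add: dist_commute)
    hence "x + h \<in> V \<longleftrightarrow> x \<in> V" for x using d(2)[of x] by blast
    thus "h \<in> H" by (simp add: H_def)
  qed
  have sub: "subgrp H"
    unfolding subgrp_def
  proof (intro conjI ballI)
    show "0 \<in> H" by (simp add: H_def)
    fix a b assume "a \<in> H" "b \<in> H"
    hence a: "x + a \<in> V \<longleftrightarrow> x \<in> V" and b: "x + b \<in> V \<longleftrightarrow> x \<in> V" for x by (auto simp: H_def)
    have "x + (a - b) \<in> V \<longleftrightarrow> x \<in> V" for x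
      using a[of "x - b"] b[of "x - b"] by (simp add: algebra_simps)
    thus "a - b \<in> H" by (simp add: H_def)
  qed
  have "open H"
  proof (subst open_subopen, intro ballI)
    fix x assume x: "x \<in> H"
    have "coset (ball 0 \<delta>) x \<subseteq> H"
    proof
      fix y assume "y \<in> coset (ball 0 \<delta>) x"
      hence "y - x \<in> H" using N by (auto simp: coset_def)
      from subgrpD(4)[OF sub this x] show "y \<in> H" by simp
    qed
    moreover have "x \<in> coset (ball 0 \<delta>) x" using \<delta>(1) by (simp add: coset_def)
    ultimately show "\<exists>T. open T \<and> x \<in> T \<and> T \<subseteq> H" using open_coset[OF open_ball] by blast
  qed
  moreover have "H \<subseteq> W" using V(3,4) unfolding H_def by (metis (mono_tags, lifting) add_0 mem_Collect_eq subset_iff)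
  ultimately show ?thesis using that sub by (simp add: opsub_def)
qed

end

section \<open>Growth of coset counts\<close>

locale zd_action =
  fixes \<alpha> :: "int^'d \<Rightarrow> 'a::{metric_space, topological_ab_group_add} \<Rightarrow> 'a"
  assumes comp: "compact (UNIV :: 'a set)"
    and zd: "zero_dim_space (UNIV :: 'a set)"
    and act: "cont_aut_action \<alpha>"
begin

lemma act_0 [simp]: "\<alpha> 0 x = x"
  using act by (simp add: cont_aut_action_def)

lemma act_add: "\<alpha> (m + n) x = \<alpha> m (\<alpha> n x)"
  using act by (simp add: cont_aut_action_def)

lemma act_commute: "\<alpha> m (\<alpha> n x) = \<alpha> n (\<alpha> m x)"
  by (metis act_add add.commute)

lemma act_additive: "additive_map (\<alpha> n)"
  using act by (simp add: cont_aut_action_def)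

lemma act_plus: "\<alpha> n (x + y) = \<alpha> n x + \<alpha> n y"
  using act_additive by blast

lemma act_diff: "\<alpha> n (x - y) = \<alpha> n x - \<alpha> n y"
  by (rule additive_map_diff[OF act_additive])

lemma act_zero [simp]: "\<alpha> n 0 = 0"
  by (rule additive_map_0[OF act_additive])

lemma act_cont: "continuous_on UNIV (\<alpha> n)"
  using act by (simp add: cont_aut_action_def)

text \<open>The analogue of a Bowen ball around 0; for a subgroup \<open>U\<close> its index counts
  orbit pieces over \<open>F\<close> up to \<open>U\<close>.\<close>

definition window :: "'a set \<Rightarrow> (int^'d) set \<Rightarrow> 'a set" where
  "window U F = {x. \<forall>v\<in>F. \<alpha> v x \<in> U}"

lemma window_subgrp:
  assumes "subgrp U" shows "subgrp (window U F)"
  using subgrpD[OF assms] by (auto simp: subgrp_def window_def act_diff)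

lemma window_Un: "window U (F \<union> G) = window U F \<inter> window U G"
  by (auto simp: window_def)

lemma window_mono: "F \<subseteq> G \<Longrightarrow> window U G \<subseteq> window U F"
  by (auto simp: window_def)

lemma window_opsub:
  assumes "opsub U" "finite F" shows "opsub (window U F)"
proof -
  have "window U F = (\<Inter>v\<in>F. \<alpha> v -` U)" by (auto simp: window_def)
  moreover have "open (\<alpha> v -` U)" for v
    using assms act_cont by (auto simp: opsub_def intro: open_vimage)
  ultimately have "open (window U F)" using assms(2) by (simp add: open_INT)
  thus ?thesis using assms window_subgrp by (simp add: opsub_def)
qed

lemma finite_cosets: "opsub (H :: 'a set) \<Longrightarrow> finite (coset H ` K)"
  by (rule opsub_coset_finite[OF comp])

lemma idx_pos:
  assumes "opsub (H :: 'a set)" "x \<in> K" shows "idx K H > 0"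
  using finite_cosets[OF assms(1), of K] assms(2) by (auto simp: idx_def card_gt_0_iff)

lemma idx_window_le:
  assumes U: "opsub U" and F: "finite F"
  shows "idx UNIV (window U F) \<le> idx UNIV U ^ card F"
  using F
proof (induction F rule: finite_induct)
  case empty
  have "window U {} = UNIV" by (simp add: window_def)
  hence "range (coset (window U {})) = {UNIV}" by (auto simp: coset_def)
  thus ?case by (simp add: idx_def)
next
  case (insert v F)
  have 1: "opsub (window U {v})" "opsub (window U F)" using U insert by (auto intro: window_opsub)
  have "idx UNIV (window U {v}) \<le> idx UNIV U"
    using 1 U by (intro idx_le_injective[OF act_additive[of v]] finite_cosets)
      (auto simp: opsub_def window_def)
  moreover have "idx UNIV (window U (insert v F)) \<le> idx UNIV (window U {v}) * idx UNIV (window U F)"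
    using idx_Int_le[of "window U {v}" "window U F"] 1 finite_cosets[OF 1(1)] finite_cosets[OF 1(2)]
      window_Un[of U "{v}" F] by (simp add: opsub_def)
  ultimately have "idx UNIV (window U (insert v F)) \<le> idx UNIV U * idx UNIV U ^ card F"
    using insert.IH by (meson mult_le_mono order_trans)
  thus ?case using insert by simp
qed

lemma opsub_small:
  assumes "\<epsilon> > 0"
  obtains H :: "'a set" where "opsub H" "\<And>x y. x - y \<in> H \<Longrightarrow> dist x y < \<epsilon>"
proof -
  obtain \<delta> where \<delta>: "\<delta> > 0" "\<And>x h :: 'a. dist h 0 < \<delta> \<Longrightarrow> dist (x + h) x < \<epsilon>"
    using close_of_small_diff[OF comp assms] by blast
  obtain H where H: "opsub H" "H \<subseteq> ball (0::'a) \<delta>"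
    using opsub_basis[OF comp zd, of "ball 0 \<delta>"] \<delta>(1) by auto
  have "dist x y < \<epsilon>" if "x - y \<in> H" for x y
  proof -
    have "dist (x - y) 0 < \<delta>" using that H(2) by (auto simp: dist_commute)
    from \<delta>(2)[OF this, of y] show ?thesis by simp
  qed
  thus ?thesis using that H(1) by blast
qed

section \<open>Windows along a line and topological entropy\<close>

definition line_window :: "int^'d \<Rightarrow> 'a set \<Rightarrow> int set \<Rightarrow> 'a set" where
  "line_window e U J = window U ((\<lambda>i. i *s e) ` J)"

lemma mem_line_window: "x \<in> line_window e U J \<longleftrightarrow> (\<forall>i\<in>J. \<alpha> (i *s e) x \<in> U)"
  by (auto simp: line_window_def window_def)

lemma line_window_opsub: "opsub U \<Longrightarrow> finite J \<Longrightarrow> opsub (line_window e U J)"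
  unfolding line_window_def by (intro window_opsub) auto

lemma line_window_subgrp: "subgrp U \<Longrightarrow> subgrp (line_window e U J)"
  unfolding line_window_def by (rule window_subgrp)

lemma act_multiple_add: "\<alpha> ((i + j) *s e) x = \<alpha> (i *s e) (\<alpha> (j *s e) x)"
  by (simp add: vector_sadd_rdistrib act_add)

lemma act_multiple_Suc: "\<alpha> (int (Suc i) *s e) x = \<alpha> (int i *s e) (\<alpha> e x)"
  using act_multiple_add[of "int i" 1 e x] by (simp add: add.commute)

lemma act_funpow: "(\<alpha> e ^^ k) x = \<alpha> (int k *s e) x"
proof (induction k arbitrary: x)
  case (Suc k)
  thus ?case by (simp add: funpow_Suc_right act_multiple_Suc del: funpow.simps of_nat_Suc)
qed simp

text \<open>The successive quotients \<open>step_idx\<close> of the windows \<open>{0..<j}\<close> decrease in \<open>j\<close>; their eventual value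
  \<open>growth\<close> is the exponential growth rate of the index of these windows.\<close>
definition step_idx :: "int^'d \<Rightarrow> 'a set \<Rightarrow> nat \<Rightarrow> nat" where
  "step_idx e U j = idx (line_window e U {0..<int j}) (line_window e U {0..<int (Suc j)})"

definition growth :: "int^'d \<Rightarrow> 'a set \<Rightarrow> nat" where
  "growth e U = Inf (range (step_idx e U))"

text \<open>\<open>\<alpha> e\<close> maps each window into the one shorter by a step and is
  injective on the successive quotients.\<close>

lemma step_idx_Suc_le:
  assumes U: "opsub U" shows "step_idx e U (Suc j) \<le> step_idx e U j"
  unfolding step_idx_def
proof (rule idx_le_injective[OF act_additive[of e]])
  have sU: "subgrp U" using U by (simp add: opsub_def)
  let ?V = "\<lambda>j. line_window e U {0..<int j}"
  have mem: "x \<in> ?V j \<longleftrightarrow> (\<forall>i<j. \<alpha> (int i *s e) x \<in> U)" for j x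
    unfolding mem_line_window
    by (metis atLeastLessThan_iff int_nat_eq nat_less_iff of_nat_0_le_iff of_nat_less_iff zero_le_imp_eq_int)
  show "subgrp (?V (Suc (Suc j)))" "subgrp (?V (Suc j))"
    using line_window_subgrp[OF sU] by blast+
  show "\<alpha> e ` ?V (Suc j) \<subseteq> ?V j"
  proof (intro subsetI, elim imageE)
    fix y x assume "y = \<alpha> e x" "x \<in> ?V (Suc j)"
    thus "y \<in> ?V j" unfolding mem
      by (metis Suc_less_eq act_multiple_Suc)
  qed
  show "finite (coset (?V (Suc j)) ` ?V j)"
    by (intro finite_cosets line_window_opsub U) auto
  show "x - y \<in> ?V (Suc (Suc j))"
    if "x \<in> ?V (Suc j)" "y \<in> ?V (Suc j)" "\<alpha> e (x - y) \<in> ?V (Suc j)" for x y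
  proof -
    have 1: "x - y \<in> ?V (Suc j)" using that line_window_subgrp[OF sU] subgrpD(2) by blast
    show ?thesis unfolding mem
    proof (intro allI impI)
      fix i assume "i < Suc (Suc j)"
      show "\<alpha> (int i *s e) (x - y) \<in> U"
      proof (cases i)
        case 0 thus ?thesis using 1 unfolding mem by blast
      next
        case (Suc k)
        hence "k < Suc j" using \<open>i < Suc (Suc j)\<close> by simp
        thus ?thesis using that(3) unfolding mem Suc act_multiple_Suc by blast
      qed
    qed
  qed
qed

lemma step_idx_antimono:
  assumes U: "opsub U" and "i \<le> j" shows "step_idx e U j \<le> step_idx e U i"
  using assms(2) by (induction rule: dec_induct) (auto intro: order_trans[OF step_idx_Suc_le[OF U]])

lemma growth_le: "growth e U \<le> step_idx e U j"
  unfolding growth_def by (rule cInf_lower) auto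

lemma growth_pos: "opsub U \<Longrightarrow> growth e U > 0"
proof -
  assume U: "opsub U"
  have "growth e U \<in> range (step_idx e U)" unfolding growth_def by (rule Inf_nat_def1) auto
  moreover have "step_idx e U j > 0" for j unfolding step_idx_def
  proof (rule idx_pos)
    show "opsub (line_window e U {0..<int (Suc j)})" by (intro line_window_opsub U) auto
    show "0 \<in> line_window e U {0..<int j}"
      using line_window_subgrp[of U] U subgrpD(1) by (auto simp: opsub_def)
  qed
  ultimately show ?thesis by auto
qed

lemma idx_line_window_Suc:
  assumes U: "opsub U"
  shows "idx UNIV (line_window e U {0..<int (Suc j)}) = idx UNIV (line_window e U {0..<int j}) * step_idx e U j"
  unfolding step_idx_def
proof (rule idx_tower)
  show "line_window e U {0..<int (Suc j)} \<subseteq> line_window e U {0..<int j}"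
    unfolding line_window_def by (intro window_mono image_mono) auto
qed (use U line_window_subgrp in \<open>auto simp: opsub_def subgrp_def[of UNIV]\<close>)

lemma idx_line_window_empty: "idx UNIV (line_window e U {}) = Suc 0"
proof -
  have "line_window e U {} = UNIV" by (simp add: line_window_def window_def)
  hence "range (coset (line_window e U {})) = {UNIV}" by (auto simp: coset_def)
  thus ?thesis by (simp add: idx_def)
qed

lemma growth_power_le:
  assumes U: "opsub U" shows "growth e U ^ j \<le> idx UNIV (line_window e U {0..<int j})"
proof (induction j)
  case (Suc j)
  thus ?case unfolding idx_line_window_Suc[OF U]
    using growth_le[of e U j] by (simp add: mult.commute mult_le_mono)
qed (simp add: idx_line_window_empty)

text \<open>A decreasing sequence of naturals reaches its infimum, here at \<open>k\<close>; the
  first \<open>k\<close> quotients are at most \<open>D\<close> each and go into the constant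
  D^k.\<close>

lemma idx_le_growth_power:
  assumes U: "opsub U"
  obtains C where "\<And>j. idx UNIV (line_window e U {0..<int j}) \<le> C * growth e U ^ j"
proof -
  have "growth e U \<in> range (step_idx e U)" unfolding growth_def by (rule Inf_nat_def1) auto
  then obtain k where k: "growth e U = step_idx e U k" by blast
  define D where "D = step_idx e U 0"
  have D1: "D \<ge> 1" using growth_pos[OF U, of e] growth_le[of e U 0] by (simp add: D_def)
  have g1: "growth e U \<ge> 1" using growth_pos[OF U, of e] by simp
  have "idx UNIV (line_window e U {0..<int j}) \<le> D ^ min j k * growth e U ^ j" for j
  proof (induction j)
    case (Suc j)
    have "step_idx e U j * D ^ min j k \<le> D ^ min (Suc j) k * growth e U"
    proof (cases "j < k")
      case True
      hence "D ^ min (Suc j) k = D * D ^ min j k" by simp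
      moreover have "step_idx e U j \<le> D" unfolding D_def by (rule step_idx_antimono[OF U]) simp
      ultimately show ?thesis using g1 by (metis mult.right_neutral mult_le_mono mult_le_mono1)
    next
      case False
      hence "step_idx e U j \<le> growth e U" using k step_idx_antimono[OF U, of k j e] by simp
      thus ?thesis using False by (simp add: mult.commute)
    qed
    hence 1: "(step_idx e U j * D ^ min j k) * growth e U ^ j \<le> (D ^ min (Suc j) k * growth e U) * growth e U ^ j"
      by (rule mult_le_mono1)
    have "idx UNIV (line_window e U {0..<int (Suc j)}) \<le> (D ^ min j k * growth e U ^ j) * step_idx e U j"
      unfolding idx_line_window_Suc[OF U] by (rule mult_le_mono1[OF Suc])
    also have "\<dots> = (step_idx e U j * D ^ min j k) * growth e U ^ j" by (simp only: mult_ac)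
    also note 1
    finally show ?case by (simp only: power_Suc mult_ac)
  qed (simp add: idx_line_window_empty)
  moreover have "D ^ min j k \<le> D ^ k" for j using D1 by (intro power_increasing) auto
  ultimately show ?thesis using that[of "D ^ k"] by (meson mult_le_mono1 order_trans)
qed

text \<open>Makes the supremum in \<open>max_separated\<close> meaningful: on the naturals
  \<open>Sup\<close> is an upper bound only for sets that are bounded above.\<close>

lemma separated_card_bounded:
  assumes "\<epsilon> > 0"
  obtains B where "\<And>E. separated_set (\<alpha> e) n \<epsilon> E \<Longrightarrow> card E \<le> B"
proof -
  obtain H :: "'a set" where H: "opsub H" "\<And>x y. x - y \<in> H \<Longrightarrow> dist x y < \<epsilon>" using opsub_small[OF assms] by blast
  let ?V = "line_window e H {0..<int n}"
  have V: "opsub ?V" by (intro line_window_opsub H(1)) auto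
  have "card E \<le> idx UNIV ?V" if E: "separated_set (\<alpha> e) n \<epsilon> E" for E
  proof (rule card_le_idx)
    show "subgrp ?V" "finite (range (coset ?V))" using V finite_cosets by (auto simp: opsub_def)
    fix x y assume xy: "x \<in> E" "y \<in> E" "x - y \<in> ?V"
    show "x = y"
    proof (rule ccontr)
      assume "x \<noteq> y"
      then obtain k where k: "k < n" "dist ((\<alpha> e ^^ k) x) ((\<alpha> e ^^ k) y) > \<epsilon>"
        using E xy unfolding separated_set_def by blast
      have "\<alpha> (int k *s e) (x - y) \<in> H" using xy(3) k(1) unfolding mem_line_window by auto
      hence "dist (\<alpha> (int k *s e) x) (\<alpha> (int k *s e) y) < \<epsilon>" by (intro H(2)) (simp add: act_diff)
      thus False using k(2) by (simp add: act_funpow)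
    qed
  qed auto
  thus ?thesis using that by blast
qed

text \<open>Two representatives of distinct cosets of the window differ by an element whose orbit
  leaves \<open>U\<close>, so they are separated at a scale \<epsilon> that depends on
  \<open>U\<close> only.\<close>

lemma idx_le_max_separated:
  assumes U: "opsub U"
  obtains \<epsilon> where "\<epsilon> > 0" "\<And>n. idx UNIV (line_window e U {0..<int n}) \<le> max_separated (\<alpha> e) n \<epsilon>"
proof -
  have U': "open U" "0 \<in> U" using U by (auto simp: opsub_def subgrp_def)
  obtain \<epsilon> where \<epsilon>: "\<epsilon> > 0" "\<And>x y. dist x y \<le> \<epsilon> \<Longrightarrow> x - y \<in> U"
    using small_diff_in_open[OF comp U'] by blast
  have "idx UNIV (line_window e U {0..<int n}) \<le> max_separated (\<alpha> e) n \<epsilon>" for n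
  proof -
    let ?V = "line_window e U {0..<int n}"
    have V: "opsub ?V" by (intro line_window_opsub U) auto
    obtain S where S: "card S = idx UNIV ?V" "\<And>x y. x \<in> S \<Longrightarrow> y \<in> S \<Longrightarrow> x - y \<in> ?V \<Longrightarrow> x = y"
      "finite (range (coset ?V)) \<Longrightarrow> finite S"
      using V ex_transversal[of ?V UNIV] by (metis opsub_def)
    have "separated_set (\<alpha> e) n \<epsilon> S"
      unfolding separated_set_def
    proof (intro ballI impI, rule ccontr)
      fix x y assume xy: "x \<in> S" "y \<in> S" "x \<noteq> y"
        and neg: "\<not> (\<exists>k<n. \<epsilon> < dist ((\<alpha> e ^^ k) x) ((\<alpha> e ^^ k) y))"
      have "\<alpha> (i *s e) (x - y) \<in> U" if "i \<in> {0..<int n}" for i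
      proof -
        obtain k where k: "i = int k" "k < n" using \<open>i \<in> {0..<int n}\<close>
          by (metis atLeastLessThan_iff of_nat_less_iff zero_le_imp_eq_int)
        hence "dist (\<alpha> (i *s e) x) (\<alpha> (i *s e) y) \<le> \<epsilon>" using neg
          unfolding k(1) act_funpow[symmetric] by (meson not_less)
        thus ?thesis using \<epsilon>(2) by (simp add: act_diff)
      qed
      hence "x - y \<in> ?V" by (simp add: mem_line_window)
      thus False using S(2) xy by blast
    qed
    moreover have "finite S" using S(3) finite_cosets[OF V] by blast
    ultimately have "card S \<in> {card E | E. finite E \<and> separated_set (\<alpha> e) n \<epsilon> E}" by blast
    moreover obtain B where "\<And>E. separated_set (\<alpha> e) n \<epsilon> E \<Longrightarrow> card E \<le> B"
      using separated_card_bounded[OF \<epsilon>(1)] by blast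
    hence "bdd_above {card E | E. finite E \<and> separated_set (\<alpha> e) n \<epsilon> E}" by (intro bdd_aboveI[of _ B]) auto
    ultimately have "card S \<le> max_separated (\<alpha> e) n \<epsilon>" unfolding max_separated_def by (rule cSup_upper)
    thus ?thesis using S(1) by simp
  qed
  thus ?thesis using that \<epsilon>(1) by blast
qed

lemma ln_growth_le_entropy:
  assumes U: "opsub U" shows "ereal (ln (real (growth e U))) \<le> top_entropy (\<alpha> e)"
proof -
  obtain \<epsilon> where \<epsilon>: "\<epsilon> > 0" "\<And>n. idx UNIV (line_window e U {0..<int n}) \<le> max_separated (\<alpha> e) n \<epsilon>"
    using idx_le_max_separated[OF U] by blast
  have g: "growth e U \<ge> 1" using growth_pos[OF U, of e] by simp
  have "ereal (ln (real (growth e U))) \<le> ereal (ln (real (max_separated (\<alpha> e) n \<epsilon>)) / real n)" if "n > 0" for n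
  proof -
    have "growth e U ^ n \<le> max_separated (\<alpha> e) n \<epsilon>"
      using growth_power_le[OF U] \<epsilon>(2) order_trans by blast
    hence "real (growth e U) ^ n \<le> real (max_separated (\<alpha> e) n \<epsilon>)" by (metis of_nat_le_iff of_nat_power)
    hence "ln (real (growth e U) ^ n) \<le> ln (real (max_separated (\<alpha> e) n \<epsilon>))"
      using g by (intro ln_mono) auto
    thus ?thesis using that g by (simp add: ln_realpow field_simps)
  qed
  hence "ereal (ln (real (growth e U))) \<le> limsup (\<lambda>n. ereal (ln (real (max_separated (\<alpha> e) n \<epsilon>)) / real n))"
    by (intro le_Limsup) (auto intro: eventually_mono[OF eventually_gt_at_top[of 0]])
  also have "\<dots> \<le> top_entropy (\<alpha> e)"
    unfolding top_entropy_def using \<epsilon>(1) by (intro SUP_upper) auto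
  finally show ?thesis .
qed

text \<open>Finite entropy enters here: growth rates are natural numbers bounded by exp of the
  entropy of \<open>\<alpha> e\<close>, so the largest one is attained.\<close>

lemma ex_max_growth:
  assumes ent: "top_entropy (\<alpha> e) < \<infinity>" and U0: "opsub U0"
  obtains U where "opsub U" "U \<subseteq> U0" "\<And>U'. opsub U' \<Longrightarrow> U' \<subseteq> U0 \<Longrightarrow> growth e U' \<le> growth e U"
proof -
  define h where "h = real_of_ereal (top_entropy (\<alpha> e))"
  have "ereal 0 \<le> ereal (ln (real (growth e U0)))" using growth_pos[OF U0, of e] by simp
  also note ln_growth_le_entropy[OF U0]
  finally have h: "top_entropy (\<alpha> e) = ereal h" unfolding h_def
    using ent by (cases "top_entropy (\<alpha> e)") auto
  have bound: "growth e U' \<le> nat \<lfloor>exp h\<rfloor>" if "opsub U'" for U'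
  proof -
    have "ln (real (growth e U')) \<le> h" using ln_growth_le_entropy[OF that, of e] h by simp
    hence "real (growth e U') \<le> exp h" using growth_pos[OF that, of e]
      by (metis exp_le_cancel_iff exp_ln of_nat_0_less_iff)
    thus ?thesis by (simp add: le_nat_floor)
  qed
  let ?P = "\<lambda>r. \<exists>U. opsub U \<and> U \<subseteq> U0 \<and> growth e U = r"
  have "?P (Greatest ?P)" using U0 bound by (intro GreatestI_nat[of ?P "growth e U0" "nat \<lfloor>exp h\<rfloor>"]) auto
  then obtain U where U: "opsub U" "U \<subseteq> U0" "growth e U = Greatest ?P" by blast
  show ?thesis
  proof (rule that[OF U(1,2)])
    fix U' assume "opsub U'" "U' \<subseteq> U0"
    thus "growth e U' \<le> growth e U" unfolding U(3)
      using bound by (intro Greatest_le_nat[of ?P _ "nat \<lfloor>exp h\<rfloor>"]) auto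
  qed
qed

end

section \<open>Counting points of finite period\<close>

definition cube :: "nat \<Rightarrow> (int^'d) set" where
  "cube R = {v. \<forall>k. \<bar>v $ k\<bar> \<le> int R}"

lemma finite_cube: "finite (cube R :: (int^'d) set)"
proof (rule finite_subset)
  show "cube R \<subseteq> (\<lambda>f. \<chi> k. f k) ` (PiE UNIV (\<lambda>_. {- int R..int R}) :: ('d \<Rightarrow> int) set)"
  proof
    fix v :: "int^'d" assume "v \<in> cube R"
    hence "(\<lambda>k. v $ k) \<in> PiE UNIV (\<lambda>_. {- int R..int R})" by (auto simp: cube_def abs_le_iff minus_le_iff)
    moreover have "v = (\<chi> k. v $ k)" by simp
    ultimately show "v \<in> (\<lambda>f. \<chi> k. f k) ` (PiE UNIV (\<lambda>_. {- int R..int R}) :: ('d \<Rightarrow> int) set)" by blast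
  qed
qed (intro finite_imageI finite_PiE, auto)

lemma zero_in_cube: "0 \<in> cube R"
  by (simp add: cube_def)

lemma cube_mono: "R \<le> S \<Longrightarrow> cube R \<subseteq> cube S"
  unfolding cube_def by (rule Collect_mono) (meson of_nat_mono order_trans)

lemma cube_add: "v \<in> cube R \<Longrightarrow> w \<in> cube S \<Longrightarrow> v + w \<in> cube (R + S)"
  by (auto simp: cube_def intro: order_trans[OF abs_triangle_ineq] add_mono)

lemma cube_Suc_split:
  assumes "v \<in> cube (Suc R)"
  obtains v' w where "v' \<in> cube R" "w \<in> cube 1" "v = v' + w"
proof -
  \<comment> \<open>One step away from 0 in every nonzero coordinate, so that v - w is one step
    closer to 0.\<close>
  define w :: "int^'a" where "w = (\<chi> k. sgn (v $ k))"
  have "v - w \<in> cube R" "w \<in> cube 1"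
    using assms by (auto simp: cube_def w_def sgn_if) (smt (verit))+
  thus ?thesis using that[of "v - w" w] by simp
qed

lemma ex_cube: obtains R where "(v :: int^'d) \<in> cube R"
proof -
  have "\<bar>v $ k\<bar> \<le> int (nat (\<Sum>k\<in>UNIV. \<bar>v $ k\<bar>))" for k
    using member_le_sum[of k UNIV "\<lambda>k. \<bar>v $ k\<bar>"] by simp
  thus ?thesis using that[of "nat (\<Sum>k\<in>UNIV. \<bar>v $ k\<bar>)"] by (simp add: cube_def)
qed

context zd_action
begin

lemma mem_window: "x \<in> window U F \<longleftrightarrow> (\<forall>v\<in>F. \<alpha> v x \<in> U)"
  by (simp add: window_def)

lemma mem_line_window_0: "0 \<in> J \<Longrightarrow> x \<in> line_window e U J \<Longrightarrow> x \<in> U"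
  by (auto simp: mem_line_window)

text \<open>When \<open>U\<close> has maximal growth, passing from \<open>U\<close> to \<open>window U (cube 1)\<close> costs only a bounded index on
  the full orbit windows.  The finite quotient is permuted by \<open>\<alpha> e\<close>, so a factorial power of \<open>\<alpha> e\<close>
  acts trivially on it, and compactness replaces the full orbit by a finite window.\<close>
lemma ex_shrinking_endomorphism:
  assumes ent: "top_entropy (\<alpha> e) < \<infinity>" and U0: "opsub U0"
  obtains U m L where "opsub U" "U \<subseteq> U0" "(m::nat) > 0"
    "\<And>x. x \<in> line_window e U {- int L..int L} \<Longrightarrow> \<alpha> (int m *s e) x - x \<in> window U (cube 1)"
proof -
  obtain U where U: "opsub U" "U \<subseteq> U0" and max: "\<And>U'. opsub U' \<Longrightarrow> U' \<subseteq> U0 \<Longrightarrow> growth e U' \<le> growth e U"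
    using ex_max_growth[OF ent U0] by blast
  define U' where "U' = window U (cube 1)"
  have U': "opsub U'" unfolding U'_def by (intro window_opsub U finite_cube)
  have sU: "subgrp U" and sU': "subgrp U'" using U U' by (auto simp: opsub_def)
  have sub: "U' \<subseteq> U" unfolding U'_def using zero_in_cube by (force simp: mem_window)
  define \<rho> where "\<rho> = growth e U"
  have \<rho>1: "\<rho> \<ge> 1" using growth_pos[OF U(1), of e] by (simp add: \<rho>_def)
  obtain C where C: "\<And>j. idx UNIV (line_window e U' {0..<int j}) \<le> C * growth e U' ^ j"
    using idx_le_growth_power[OF U'] by blast
  have g: "growth e U' \<le> \<rho>" unfolding \<rho>_def using max[OF U'] sub U(2) by blast
  have mono: "line_window e U' J \<subseteq> line_window e U J" for J using sub by (auto simp: mem_line_window subset_iff)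
  \<comment> \<open>The windows of \<open>U\<close> have index at least \<rho>^j and those of
    \<open>U'\<close> at most C \<rho>^j, the latter because the growth of \<open>U\<close> is
    maximal. The relative index is therefore bounded independently of j.\<close>
  have C0: "idx (line_window e U {0..<int j}) (line_window e U' {0..<int j}) \<le> C" for j
  proof -
    let ?a = "idx UNIV (line_window e U {0..<int j})"
    have "idx UNIV (line_window e U' {0..<int j})
        = ?a * idx (line_window e U {0..<int j}) (line_window e U' {0..<int j})" (is "_ = _ * ?b")
      by (intro idx_tower line_window_subgrp sU sU' mono) (auto simp: subgrp_def)
    hence "\<rho> ^ j * ?b \<le> idx UNIV (line_window e U' {0..<int j})"
      using growth_power_le[OF U(1), of e j] by (simp add: \<rho>_def mult_le_mono1)
    also have "\<dots> \<le> C * \<rho> ^ j" using C[of j] power_mono[OF g, of j] by (meson le_trans mult_le_mono2 zero_le)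
    finally show ?thesis using \<rho>1 by (simp add: mult.commute)
  qed
  let ?V = "\<lambda>j. line_window e U {- int j..int j}" and ?V' = "\<lambda>j. line_window e U' {- int j..int j}"
  have C1: "idx (?V j) (?V' j) \<le> C" for j
  proof -
    let ?f = "\<alpha> (- int j *s e)"
    have f: "\<alpha> (i *s e) (?f x) = \<alpha> ((i - int j) *s e) x" for i x
      using act_multiple_add[of i "- int j" e x] by simp
    have "idx (?V j) (?V' j) \<le> idx (line_window e U {0..<int (2 * j + 1)}) (line_window e U' {0..<int (2 * j + 1)})"
    proof (rule idx_le_injective[OF act_additive[of "- int j *s e"]])
      show "?f ` ?V j \<subseteq> line_window e U {0..<int (2 * j + 1)}"
      proof (intro subsetI, elim imageE)
        fix y x assume y: "y = ?f x" "x \<in> ?V j"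
        show "y \<in> line_window e U {0..<int (2 * j + 1)}" unfolding mem_line_window y(1) f
        proof
          fix i assume "i \<in> {0..<int (2 * j + 1)}"
          hence "i - int j \<in> {- int j..int j}" by auto
          thus "\<alpha> ((i - int j) *s e) x \<in> U" using y(2) unfolding mem_line_window by blast
        qed
      qed
      show "finite (coset (line_window e U' {0..<int (2 * j + 1)}) ` line_window e U {0..<int (2 * j + 1)})"
        by (intro finite_cosets line_window_opsub U') auto
      fix x y assume *: "?f (x - y) \<in> line_window e U' {0..<int (2 * j + 1)}"
      show "x - y \<in> ?V' j" unfolding mem_line_window
      proof
        fix i assume "i \<in> {- int j..int j}"
        hence "i + int j \<in> {0..<int (2 * j + 1)}" by auto
        hence "\<alpha> ((i + int j) *s e) (?f (x - y)) \<in> U'" using * unfolding mem_line_window by blast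
        thus "\<alpha> (i *s e) (x - y) \<in> U'" by (simp only: f add_diff_cancel_right')
      qed
    qed (intro line_window_subgrp sU')+
    thus ?thesis using C0[of "2 * j + 1"] by simp
  qed
  let ?X = "line_window e U UNIV" and ?X' = "line_window e U' UNIV"
  have sX': "subgrp ?X'" by (rule line_window_subgrp[OF sU'])
  have shift: "\<alpha> (k *s e) x \<in> ?X' \<longleftrightarrow> x \<in> ?X'" for k x
  proof -
    have "\<alpha> (i *s e) (\<alpha> (k *s e) x) = \<alpha> ((i + k) *s e) x" for i by (rule act_multiple_add[symmetric])
    thus ?thesis unfolding mem_line_window by (metis UNIV_I diff_add_cancel)
  qed
  have shiftX: "x \<in> ?X \<Longrightarrow> \<alpha> (k *s e) x \<in> ?X" for k x
    unfolding mem_line_window by (metis UNIV_I act_multiple_add)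
  \<comment> \<open>The exponent d found below for x is at most \<open>C\<close> but depends on x;
    the factorial is a multiple of all of them.\<close>
  define m where "m = (fact C :: nat)"
  have key: "\<alpha> (int m *s e) x - x \<in> ?X'" if x: "x \<in> ?X" for x
  proof -
    define y where "y = (\<lambda>a. \<alpha> (int a *s e) x)"
    have "\<exists>a b. a < b \<and> b \<le> C \<and> y b - y a \<in> ?X'"
    proof (rule ccontr)
      assume neg: "\<not> (\<exists>a b. a < b \<and> b \<le> C \<and> y b - y a \<in> ?X')"
      have neg': "y a - y b \<notin> ?X'" if "a \<le> C" "b \<le> C" "a \<noteq> b" for a b
        using neg that subgrpD(5)[OF sX', of "y a" "y b"] by (metis nat_neq_iff)
      hence "\<exists>i. \<alpha> (i *s e) (y a - y b) \<notin> U'" if "a \<le> C" "b \<le> C" "a \<noteq> b" for a b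
        using that unfolding mem_line_window by blast
      then obtain I where I: "\<And>a b. a \<le> C \<Longrightarrow> b \<le> C \<Longrightarrow> a \<noteq> b \<Longrightarrow> \<alpha> (I a b *s e) (y a - y b) \<notin> U'"
        by metis
      \<comment> \<open>Finitely many pairs are told apart already on a finite window, where the
        index bound \<open>C\<close> contradicts the presence of C + 1 distinct cosets.\<close>
      define j where "j = (\<Sum>a\<le>C. \<Sum>b\<le>C. nat \<bar>I a b\<bar>)"
      have Ij: "I a b \<in> {- int j..int j}" if "a \<le> C" "b \<le> C" for a b
      proof -
        have "nat \<bar>I a b\<bar> \<le> (\<Sum>b\<le>C. nat \<bar>I a b\<bar>)" using that by (intro member_le_sum) auto
        also have "\<dots> \<le> j" unfolding j_def using that by (intro member_le_sum[of a "{..C}" "\<lambda>a. \<Sum>b\<le>C. nat \<bar>I a b\<bar>"]) auto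
        finally show ?thesis by auto
      qed
      have dist: "y a - y b \<notin> ?V' j" if "a \<le> C" "b \<le> C" "a \<noteq> b" for a b
        using I[OF that] Ij[OF that(1,2)] unfolding mem_line_window by blast
      have V': "opsub (?V' j)" by (intro line_window_opsub U') auto
      have inj: "inj_on y {..C}"
      proof (rule inj_onI, rule ccontr)
        fix a b assume "a \<in> {..C}" "b \<in> {..C}" "y a = y b" "a \<noteq> b"
        thus False using dist[of a b] V' by (simp add: opsub_def subgrp_def)
      qed
      have "card (y ` {..C}) \<le> idx (?V j) (?V' j)"
      proof (rule card_le_idx)
        show "y ` {..C} \<subseteq> ?V j" using shiftX[OF x] unfolding y_def by (auto simp: mem_line_window)
        show "u = v" if "u \<in> y ` {..C}" "v \<in> y ` {..C}" "u - v \<in> ?V' j" for u v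
          using that dist by blast
      qed (use V' finite_cosets in \<open>auto simp: opsub_def\<close>)
      thus False using C1[of j] card_image[OF inj] by simp
    qed
    then obtain a b where ab: "a < b" "b \<le> C" "y b - y a \<in> ?X'" by blast
    define d where "d = b - a"
    have "y b = \<alpha> (int a *s e) (\<alpha> (int d *s e) x)"
      unfolding y_def using ab(1) act_multiple_add[of "int a" "int d" e x] by (simp add: d_def of_nat_diff)
    hence "y b - y a = \<alpha> (int a *s e) (\<alpha> (int d *s e) x - x)" by (simp add: y_def act_diff)
    hence d: "\<alpha> (int d *s e) x - x \<in> ?X'" using ab(3) shift by simp
    have mult: "\<alpha> (int (k * d) *s e) x - x \<in> ?X'" for k
    proof (induction k)
      case 0 thus ?case using subgrpD(1)[OF sX'] by simp
    next
      case (Suc k)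
      have "int (Suc k * d) = int d + int (k * d)" by simp
      hence "\<alpha> (int (Suc k * d) *s e) x - x = \<alpha> (int d *s e) (\<alpha> (int (k * d) *s e) x - x) + (\<alpha> (int d *s e) x - x)"
        by (simp only: act_multiple_add act_diff) simp
      thus ?case using Suc d shift subgrpD(4)[OF sX'] by metis
    qed
    have "d dvd m" unfolding m_def using ab by (intro dvd_fact) (auto simp: d_def)
    then obtain k where "m = k * d" by (metis dvdE mult.commute)
    thus ?thesis using mult by simp
  qed
  define g where "g = (\<lambda>x. \<alpha> (int m *s e) x - x)"
  have contg: "continuous_on UNIV g" unfolding g_def by (intro continuous_intros act_cont)
  have oU': "open U'" using U' by (simp add: opsub_def)
  \<comment> \<open>This is \<open>key\<close> read pointwise: either x leaves \<open>U\<close> at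
    some time, which a finite window sees, or g x lies in \<open>U'\<close>. The sets are open
    because open subgroups are closed.\<close>
  have "UNIV \<subseteq> (\<Union>j. - (?V j) \<union> g -` U')"
  proof
    fix x
    show "x \<in> (\<Union>j. - (?V j) \<union> g -` U')"
    proof (cases "x \<in> ?X")
      case True
      hence "\<alpha> (0 *s e) (g x) \<in> U'" using key unfolding mem_line_window g_def by blast
      thus ?thesis by simp
    next
      case False
      then obtain i where i: "\<alpha> (i *s e) x \<notin> U" unfolding mem_line_window by blast
      have "i \<in> {- int (nat \<bar>i\<bar>)..int (nat \<bar>i\<bar>)}" by auto
      hence "x \<notin> ?V (nat \<bar>i\<bar>)" using i unfolding mem_line_window by blast
      thus ?thesis by blast
    qed
  qed
  moreover have "open (- (?V j) \<union> g -` U')" for j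
  proof -
    have "opsub (?V j)" by (intro line_window_opsub U) auto
    thus ?thesis by (intro open_Un open_Compl opsub_closed open_vimage oU' contg)
  qed
  ultimately obtain D where D: "finite D" "UNIV \<subseteq> (\<Union>j\<in>D. - (?V j) \<union> g -` U')"
    using compactE_image[OF comp, of UNIV "\<lambda>j. - (?V j) \<union> g -` U'"] by auto
  define L where "L = Max (insert 0 D)"
  show ?thesis
  proof (rule that[OF U, of m L])
    show "m > 0" by (simp add: m_def)
    fix x assume x: "x \<in> ?V L"
    obtain j where j: "j \<in> D" "x \<in> - (?V j) \<union> g -` U'" using D(2) by blast
    have "j \<le> L" unfolding L_def using D(1) j(1) by simp
    hence "x \<in> ?V j" using x by (auto simp: mem_line_window)
    thus "\<alpha> (int m *s e) x - x \<in> window U (cube 1)" using j(2) by (auto simp: g_def U'_def)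
  qed
qed

text \<open>The endomorphism g = \<alpha> (m e) - 1 trades L steps along the line for one step in
  all directions, so its R-th power maps a line window of half-length L R into the window over the
  cube of size R. As it is surjective, the index of the latter is at most that of the line
  window.\<close>

lemma idx_cube_le:
  assumes surj: "\<And>n. n \<noteq> 0 \<Longrightarrow> surj (\<lambda>x. \<alpha> n x - x)"
    and e: "e \<noteq> 0" and ent: "top_entropy (\<alpha> e) < \<infinity>" and U0: "opsub U0"
  obtains U L where "opsub U" "U \<subseteq> U0" "\<And>R. idx UNIV (window U (cube R)) \<le> idx UNIV U ^ (2 * L * R + 1)"
proof -
  obtain U m L where U: "opsub U" "U \<subseteq> U0" and m: "(m::nat) > 0"
    and shrink: "\<And>x. x \<in> line_window e U {- int L..int L} \<Longrightarrow> \<alpha> (int m *s e) x - x \<in> window U (cube 1)"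
    using ex_shrinking_endomorphism[OF ent U0] by blast
  define g where "g = (\<lambda>x. \<alpha> (int m *s e) x - x)"
  obtain k where "e $ k \<noteq> 0" using e by (metis vec_eq_iff zero_index)
  hence "(int m *s e) $ k \<noteq> 0" using m by simp
  hence "int m *s e \<noteq> 0" by (metis zero_index)
  hence sg: "surj g" unfolding g_def by (rule surj)
  have g_act: "g (\<alpha> v x) = \<alpha> v (g x)" for v x
    unfolding g_def by (simp add: act_diff act_commute[of _ v])
  have gpow_act: "(g ^^ R) (\<alpha> v x) = \<alpha> v ((g ^^ R) x)" for R v x
    by (induction R) (simp_all add: g_act)
  have g_add: "additive_map (g ^^ R)" for R
    by (induction R) (simp_all add: g_def act_plus)
  have shrink_pow: "(g ^^ R) x \<in> window U (cube R)" if "x \<in> line_window e U {- int (L * R)..int (L * R)}" for R x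
    using that
  proof (induction R arbitrary: x)
    case 0
    have x: "x \<in> U" using mem_line_window_0[OF _ 0] by simp
    show ?case unfolding mem_window
    proof
      fix v :: "int^'d" assume "v \<in> cube 0"
      hence "v = 0" by (simp add: cube_def vec_eq_iff)
      thus "\<alpha> v ((g ^^ 0) x) \<in> U" using x by simp
    qed
  next
    case (Suc R)
    show ?case unfolding mem_window
    proof
      fix v :: "int^'d" assume "v \<in> cube (Suc R)"
      then obtain v' w where v: "v' \<in> cube R" "w \<in> cube 1" "v = v' + w" using cube_Suc_split by metis
      \<comment> \<open>The translate of x by a time i of the shorter window still lies in the line
        window of half-length L, so g moves it into \<open>window U (cube 1)\<close>. This gives the
        premise of the induction hypothesis.\<close>
      have "\<alpha> w (g x) \<in> line_window e U {- int (L * R)..int (L * R)}" unfolding mem_line_window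
      proof
        fix i assume i: "i \<in> {- int (L * R)..int (L * R)}"
        have "\<alpha> (i *s e) x \<in> line_window e U {- int L..int L}" unfolding mem_line_window
        proof
          fix l assume "l \<in> {- int L..int L}"
          hence "l + i \<in> {- int (L * Suc R)..int (L * Suc R)}" using i by auto
          hence "\<alpha> ((l + i) *s e) x \<in> U" using Suc.prems unfolding mem_line_window by blast
          thus "\<alpha> (l *s e) (\<alpha> (i *s e) x) \<in> U" by (simp only: act_multiple_add)
        qed
        from shrink[OF this] v(2) have "\<alpha> w (g (\<alpha> (i *s e) x)) \<in> U" by (simp add: g_def mem_window)
        thus "\<alpha> (i *s e) (\<alpha> w (g x)) \<in> U" by (metis g_act act_commute)
      qed
      from Suc.IH[OF this] v(1) have "\<alpha> v' ((g ^^ R) (\<alpha> w (g x))) \<in> U" by (simp add: mem_window)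
      moreover have "(g ^^ Suc R) x = (g ^^ R) (g x)" by (simp add: funpow_swap1)
      ultimately show "\<alpha> v ((g ^^ Suc R) x) \<in> U" by (simp only: v(3) act_add gpow_act)
    qed
  qed
  have "idx UNIV (window U (cube R)) \<le> idx UNIV U ^ (2 * L * R + 1)" for R
  proof -
    let ?V = "line_window e U {- int (L * R)..int (L * R)}"
    have V: "opsub ?V" by (intro line_window_opsub U) auto
    have W: "opsub (window U (cube R))" by (intro window_opsub U finite_cube)
    have "surj (g ^^ R)"
    proof (induction R)
      case (Suc R)
      show ?case using comp_surj[OF Suc sg] by simp
    qed simp
    hence "idx UNIV (window U (cube R)) \<le> idx UNIV ?V"
      using V W shrink_pow by (intro idx_le_surjective(2)[OF g_add[of R]] finite_cosets) (auto simp: opsub_def)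
    also have "\<dots> \<le> idx UNIV U ^ card ((\<lambda>i. i *s e) ` {- int (L * R)..int (L * R)})"
      unfolding line_window_def by (intro idx_window_le U) auto
    also have "\<dots> \<le> idx UNIV U ^ (2 * L * R + 1)"
    proof (rule power_increasing)
      have "card ((\<lambda>i. i *s e) ` {- int (L * R)..int (L * R)}) \<le> card {- int (L * R)..int (L * R)}"
        by (rule card_image_le) simp
      also have "card {- int (L * R)..int (L * R)} = 2 * L * R + 1"
        unfolding card_atLeastAtMost_int by (simp only: nat_eq_iff) simp
      finally show "card ((\<lambda>i. i *s e) ` {- int (L * R)..int (L * R)}) \<le> 2 * L * R + 1" by simp
      show "1 \<le> idx UNIV U" using idx_pos[OF U(1), of 0 UNIV] by simp
    qed
    finally show ?thesis .
  qed
  thus ?thesis using that U by blast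
qed

text \<open>A finite set \<open>F\<close> of fixed points multiplies the index: with a section p of
  \<alpha> n - 1, the points p y + f, for f in \<open>F\<close> and y in a transversal of the window
  of size R, are distinct modulo the window of size R + s. Iterating j times bounds the j-th power
  of \<open>card F\<close> by a constant times D^(2 L s j), and the constant disappears as j
  grows.\<close>

lemma fixed_points_bound:
  assumes surj: "\<And>n. n \<noteq> 0 \<Longrightarrow> surj (\<lambda>x. \<alpha> n x - x)"
    and U: "opsub U" and expansive: "\<And>x. (\<And>v. \<alpha> v x \<in> U) \<Longrightarrow> x = 0"
    and growth: "\<And>R. idx UNIV (window U (cube R)) \<le> idx UNIV U ^ (2 * L * R + 1)"
    and n: "n \<noteq> 0" "n \<in> cube s"
  shows "finite {x. \<alpha> n x = x}" "card {x. \<alpha> n x = x} \<le> idx UNIV U ^ (2 * L * s)"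
proof -
  define D where "D = idx UNIV U"
  define h where "h = (\<lambda>R. idx UNIV (window U (cube R)))"
  have W: "opsub (window U (cube R))" for R by (intro window_opsub U finite_cube)
  have sW: "subgrp (window U (cube R))" for R using W by (simp add: opsub_def)
  have D1: "D \<ge> 1" using idx_pos[OF U, of 0 UNIV] by (simp add: D_def)
  \<comment> \<open>Finiteness of the set of all fixed points is part of the claim, so finite
    subsets are treated first.\<close>
  have bound: "card F \<le> D ^ (2 * L * s)" if F: "finite F" "F \<subseteq> {x. \<alpha> n x = x}" for F
  proof -
    have "\<exists>v. \<alpha> v (x - y) \<notin> U" if "x \<noteq> y" for x y
      using expansive[of "x - y"] that by auto
    then obtain w where w: "\<And>x y. x \<noteq> y \<Longrightarrow> \<alpha> (w x y) (x - y) \<notin> U" by metis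
    obtain r where r: "\<And>v :: int^'d. v \<in> cube (r v)" using ex_cube by metis
    \<comment> \<open>From this size on, the window separates the elements of \<open>F\<close>, by
      expansiveness.\<close>
    define R0 where "R0 = (\<Sum>x\<in>F. \<Sum>y\<in>F. r (w x y))"
    have R0: "x = y" if "x \<in> F" "y \<in> F" "x - y \<in> window U (cube R)" "R0 \<le> R" for x y R
    proof (rule ccontr)
      assume "x \<noteq> y"
      have "r (w x y) \<le> (\<Sum>y\<in>F. r (w x y))" using that F by (intro member_le_sum) auto
      also have "\<dots> \<le> R0" unfolding R0_def using that F by (intro member_le_sum[of x F "\<lambda>x. \<Sum>y\<in>F. r (w x y)"]) auto
      finally have "w x y \<in> cube R" using r[of "w x y"] that(4) cube_mono[of "r (w x y)" R] by auto
      thus False using that(3) w[OF \<open>x \<noteq> y\<close>] by (simp add: mem_window)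
    qed
    have step: "card F * h R \<le> h (R + s)" if R: "R0 \<le> R" for R
    proof -
      obtain S where S: "card S = h R" "\<And>x y. x \<in> S \<Longrightarrow> y \<in> S \<Longrightarrow> x - y \<in> window U (cube R) \<Longrightarrow> x = y"
        using ex_transversal[OF sW[of R], of UNIV] unfolding h_def by metis
      define p where "p = inv_into UNIV (\<lambda>x. \<alpha> n x - x)"
      have p: "\<alpha> n (p y) - p y = y" for y unfolding p_def by (rule surj_f_inv_f[OF surj[OF n(1)]])
      define \<psi> where "\<psi> = (\<lambda>(f, y). p y + f)"
      \<comment> \<open>Applying \<alpha> n - 1 to a difference of two such points removes the fixed
        points and leaves y - y'; the additional size s of the cube allows for the shift by
        n.\<close>
      have sep: "f = f' \<and> y = y'" if "f \<in> F" "f' \<in> F" "y \<in> S" "y' \<in> S"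
        and d: "\<psi> (f, y) - \<psi> (f', y') \<in> window U (cube (R + s))" for f f' y y'
      proof -
        define z where "z = \<psi> (f, y) - \<psi> (f', y')"
        have fixf: "\<alpha> n f = f" "\<alpha> n f' = f'" using that(1,2) F by auto
        have "\<alpha> n z - z = (\<alpha> n (p y) - p y) - (\<alpha> n (p y') - p y')"
          by (simp add: z_def \<psi>_def act_diff act_plus fixf)
        hence yz: "y - y' = \<alpha> n z - z" by (simp add: p)
        have "\<alpha> n z \<in> window U (cube R)" unfolding mem_window
        proof
          fix v :: "int^'d" assume "v \<in> cube R"
          hence "v + n \<in> cube (R + s)" using n(2) by (rule cube_add)
          hence "\<alpha> (v + n) z \<in> U" using d unfolding z_def mem_window by blast
          thus "\<alpha> v (\<alpha> n z) \<in> U" by (simp only: act_add)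
        qed
        moreover have zR: "z \<in> window U (cube R)"
          using d window_mono[OF cube_mono[of R "R + s"], of U] by (auto simp: z_def)
        ultimately have "y - y' \<in> window U (cube R)" unfolding yz using subgrpD(2)[OF sW] by blast
        hence yy: "y = y'" by (rule S(2)[OF that(3,4)])
        hence "f - f' \<in> window U (cube R)" using zR by (simp add: z_def \<psi>_def)
        thus ?thesis using R0 that(1,2) R yy by blast
      qed
      have inj: "inj_on \<psi> (F \<times> S)"
      proof (rule inj_onI)
        fix a b assume ab: "a \<in> F \<times> S" "b \<in> F \<times> S" "\<psi> a = \<psi> b"
        obtain f y f' y' where "a = (f, y)" "b = (f', y')" by fastforce
        thus "a = b" using sep[of f f' y y'] ab subgrpD(1)[OF sW] by auto
      qed
      have "card (\<psi> ` (F \<times> S)) \<le> idx UNIV (window U (cube (R + s)))"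
      proof (rule card_le_idx(2)[OF sW finite_cosets[OF W]])
        fix a b assume ab: "a \<in> \<psi> ` (F \<times> S)" "b \<in> \<psi> ` (F \<times> S)" "a - b \<in> window U (cube (R + s))"
        then obtain f y f' y' where "a = \<psi> (f, y)" "b = \<psi> (f', y')" "f \<in> F" "y \<in> S" "f' \<in> F" "y' \<in> S" by blast
        thus "a = b" using sep[of f f' y y'] ab(3) by auto
      qed auto
      thus ?thesis using card_image[OF inj] S(1) by (simp add: card_cartesian_product h_def)
    qed
    have iter: "card F ^ j \<le> h (R0 + j * s)" for j
    proof (induction j)
      case 0
      show ?case using idx_pos[OF W[of R0], of 0 UNIV] by (simp add: h_def)
    next
      case (Suc j)
      have "card F ^ Suc j \<le> card F * h (R0 + j * s)" using Suc by simp
      also have "\<dots> \<le> h (R0 + j * s + s)" by (rule step) simp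
      finally show ?case by (simp add: add_ac)
    qed
    define K where "K = real (D ^ (2 * L * s))"
    define A where "A = real (D ^ (2 * L * R0 + 1))"
    have K1: "K \<ge> 1" using D1 by (simp add: K_def)
    have le: "(real (card F) / K) ^ j \<le> A" for j
    proof -
      have "card F ^ j \<le> D ^ (2 * L * (R0 + j * s) + 1)"
        using iter[of j] growth[of "R0 + j * s"] unfolding h_def D_def by (rule order_trans)
      also have "2 * L * (R0 + j * s) + 1 = (2 * L * R0 + 1) + 2 * L * s * j" by (simp add: algebra_simps)
      finally have "real (card F ^ j) \<le> real (D ^ ((2 * L * R0 + 1) + 2 * L * s * j))" by (rule of_nat_mono)
      also have "\<dots> = A * K ^ j" by (simp only: A_def K_def power_add power_mult of_nat_mult of_nat_power)
      finally show ?thesis using K1 by (simp add: power_divide divide_le_eq)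
    qed
    have "real (card F) / K \<le> 1"
    proof (rule ccontr)
      assume "\<not> real (card F) / K \<le> 1"
      then obtain j where "A < (real (card F) / K) ^ j" using real_arch_pow[of "real (card F) / K" A] by auto
      thus False using le[of j] by simp
    qed
    hence "real (card F) \<le> K" using K1 by (simp add: divide_le_eq)
    thus ?thesis unfolding K_def by (simp only: of_nat_le_iff)
  qed
  show fin: "finite {x. \<alpha> n x = x}"
  proof (rule ccontr)
    assume "infinite {x. \<alpha> n x = x}"
    then obtain F where "finite F" "card F = Suc (D ^ (2 * L * s))" "F \<subseteq> {x. \<alpha> n x = x}"
      using infinite_arbitrarily_large by blast
    thus False using bound[of F] by simp
  qed
  show "card {x. \<alpha> n x = x} \<le> idx UNIV U ^ (2 * L * s)" using bound[OF fin] by (simp add: D_def)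
qed

end

section \<open>Haar measure\<close>

text \<open>For a subgroup \<open>H\<close> these are the unions of cosets of
  \<open>H\<close>.\<close>

definition saturated :: "'a::ab_group_add set \<Rightarrow> 'a set \<Rightarrow> bool" where
  "saturated H A \<longleftrightarrow> (\<forall>x\<in>A. \<forall>h\<in>H. x + h \<in> A)"

definition coset_density :: "'a::ab_group_add set \<Rightarrow> 'a set \<Rightarrow> real" where
  "coset_density H A = real (idx A H) / real (idx UNIV H)"

lemma saturated_mono: "saturated H A \<Longrightarrow> K \<subseteq> H \<Longrightarrow> saturated K A"
  by (auto simp: saturated_def)

lemma saturated_set_ops:
  assumes "subgrp H" "saturated H A" "saturated H B"
  shows "saturated H (A \<union> B)" "saturated H (A - B)"
proof -
  show "saturated H (A \<union> B)" using assms by (auto simp: saturated_def)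
  have "x \<in> B" if "x + h \<in> B" "h \<in> H" for x h
    using assms(3) that subgrpD(3)[OF assms(1) that(2)] unfolding saturated_def
    by (metis add_minus_cancel add.commute)
  thus "saturated H (A - B)" using assms(2) by (auto simp: saturated_def)
qed

lemma saturated_coset_disjoint:
  assumes "subgrp H" "saturated H A" "A \<inter> B = {}"
  shows "coset H ` A \<inter> coset H ` B = {}"
proof -
  have False if "a \<in> A" "b \<in> B" "coset H a = coset H b" for a b
  proof -
    have "b - a \<in> H" using that(3) assms(1) coset_eq_iff subgrpD(5) by blast
    hence "a + (b - a) \<in> A" using assms(2) that(1) unfolding saturated_def by blast
    thus False using that assms(3) by auto
  qed
  thus ?thesis by blast
qed

lemma idx_translate:
  assumes "subgrp H" shows "idx ((\<lambda>y. x + y) ` A) H = idx A H"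
proof -
  have "card ((\<lambda>y. coset H (x + y)) ` A) = card (coset H ` A)"
    by (rule card_image_eq_card_image) (simp add: coset_eq_iff[OF assms])
  thus ?thesis by (simp add: idx_def image_image)
qed

context
  assumes comp: "compact (UNIV :: 'a::{metric_space, topological_ab_group_add} set)"
    and zd: "zero_dim_space (UNIV :: 'a set)"
begin

definition coset_algebra :: "'a set set" where
  "coset_algebra = {A. \<exists>H. opsub H \<and> saturated H A}"

text \<open>The chosen \<open>H\<close> does not matter: two choices are compared on their
  intersection.\<close>

definition coset_measure :: "'a set \<Rightarrow> real" where
  "coset_measure A = coset_density (SOME H. opsub H \<and> saturated H A) A"

lemma opsub_Int: "opsub H \<Longrightarrow> opsub K \<Longrightarrow> opsub (H \<inter> K :: 'a set)"
  by (auto simp: opsub_def subgrp_def)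

lemma opsub_idx_pos:
  assumes "opsub (H :: 'a set)" shows "idx UNIV H > 0"
  using opsub_coset_finite[OF comp assms, of UNIV] by (auto simp: idx_def card_gt_0_iff)

lemma coset_density_refine:
  assumes H: "opsub (H :: 'a set)" "saturated H A" and K: "opsub K" "K \<subseteq> H"
  shows "coset_density K A = coset_density H A"
proof -
  have s: "subgrp H" "subgrp K" using H K by (auto simp: opsub_def)
  have "idx A K = idx A H * idx H K"
    using H(2) by (intro idx_tower_saturated s K) (auto simp: saturated_def)
  moreover have "idx UNIV K = idx UNIV H * idx H K"
    by (intro idx_tower_saturated s K) auto
  moreover have "idx H K \<noteq> 0" using opsub_idx_pos[OF K(1)] calculation(2) by auto
  ultimately show ?thesis by (simp add: coset_density_def)
qed

lemma coset_measure_eq: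
  assumes H: "opsub H" "saturated H A" shows "coset_measure A = coset_density H A"
proof -
  define K where "K = (SOME H. opsub H \<and> saturated H A)"
  have K: "opsub K" "saturated K A"
    using someI[of "\<lambda>H. opsub H \<and> saturated H A" H] H by (auto simp: K_def)
  have "coset_density (H \<inter> K) A = coset_density H A" "coset_density (H \<inter> K) A = coset_density K A"
    using coset_density_refine[OF H, of "H \<inter> K"] coset_density_refine[OF K, of "H \<inter> K"] opsub_Int[OF H(1) K(1)]
    by auto
  thus ?thesis by (simp add: coset_measure_def K_def)
qed

lemma coset_algebra_common:
  assumes "A \<in> coset_algebra" "B \<in> coset_algebra"
  obtains H where "opsub H" "saturated H A" "saturated H B"
proof -
  obtain H K where "opsub H" "saturated H A" "opsub K" "saturated K B"
    using assms unfolding coset_algebra_def by blast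
  hence "opsub (H \<inter> K)" "saturated (H \<inter> K) A" "saturated (H \<inter> K) B"
    using opsub_Int[of H K] saturated_mono[of H A "H \<inter> K"] saturated_mono[of K B "H \<inter> K"] by simp_all
  thus ?thesis by (rule that)
qed

lemma UNIV_in_coset_algebra: "UNIV \<in> coset_algebra"
  unfolding coset_algebra_def
  by (auto simp: saturated_def opsub_def subgrp_def intro: exI[of _ UNIV])

lemma coset_algebra_algebra: "Sigma_Algebra.algebra UNIV coset_algebra"
proof (rule algebra_iff_Un[THEN iffD2], intro conjI ballI)
  show "{} \<in> coset_algebra" unfolding coset_algebra_def
    by (auto simp: saturated_def opsub_def subgrp_def intro: exI[of _ UNIV])
  fix A B assume A: "A \<in> coset_algebra"
  obtain H where "opsub H" "saturated H A" "saturated H UNIV"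
    using coset_algebra_common[OF A UNIV_in_coset_algebra] by blast
  thus "UNIV - A \<in> coset_algebra"
    using saturated_set_ops(2)[of H UNIV A] unfolding coset_algebra_def opsub_def by blast
  assume "B \<in> coset_algebra"
  then obtain H where "opsub H" "saturated H A" "saturated H B" using coset_algebra_common[OF A] by blast
  thus "A \<union> B \<in> coset_algebra"
    using saturated_set_ops(1)[of H A B] unfolding coset_algebra_def opsub_def by blast
qed auto

lemma coset_algebra_clopen:
  assumes "A \<in> coset_algebra" shows "open A" "closed A"
proof -
  have op: "open B" if B: "B \<in> coset_algebra" for B
  proof -
    obtain H where H: "opsub H" "saturated H B" using B unfolding coset_algebra_def by blast
    have "B = (\<Union>x\<in>B. coset H x)"
    proof (intro equalityI subsetI)
      fix y assume "y \<in> (\<Union>x\<in>B. coset H x)"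
      then obtain x where "x \<in> B" "y - x \<in> H" by (auto simp: coset_def)
      hence "x + (y - x) \<in> B" using H(2) unfolding saturated_def by blast
      thus "y \<in> B" by simp
    next
      fix y assume "y \<in> B"
      moreover have "y \<in> coset H y" using H(1) by (auto simp: coset_def opsub_def subgrp_def)
      ultimately show "y \<in> (\<Union>x\<in>B. coset H x)" by blast
    qed
    moreover have "open (\<Union>x\<in>B. coset H x)" using H(1) open_coset by (auto simp: opsub_def)
    ultimately show "open B" by simp
  qed
  show "open A" by (rule op[OF assms])
  have "- A \<in> coset_algebra" using Sigma_Algebra.algebra.axioms(1)[OF coset_algebra_algebra] assms
    by (metis Compl_eq_Diff_UNIV UNIV_in_coset_algebra ring_of_sets.Diff)
  thus "closed A" using op by (simp add: closed_def)
qed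

lemma coset_in_algebra:
  assumes "opsub H" shows "coset H x \<in> coset_algebra"
proof -
  have "saturated H (coset H x)" unfolding saturated_def coset_def
    using assms subgrpD(4)[of H] by (auto simp: opsub_def diff_add_eq[symmetric])
  thus ?thesis using assms unfolding coset_algebra_def by blast
qed

text \<open>A countable family of cosets is a base of the topology: countably many open subgroups
  shrinking to 0, each with finitely many cosets.\<close>

lemma sigma_coset_algebra: "sigma_sets UNIV coset_algebra = sets (borel :: 'a measure)"
proof
  show "sigma_sets UNIV coset_algebra \<subseteq> sets (borel :: 'a measure)"
    using coset_algebra_clopen by (intro sets.sigma_sets_subset') auto
  have "\<exists>H :: 'a set. opsub H \<and> H \<subseteq> ball 0 (1 / real (Suc n))" for n
    using opsub_basis[OF comp zd, of "ball 0 (1 / real (Suc n))"] by auto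
  then obtain H :: "nat \<Rightarrow> 'a set" where H: "\<And>n. opsub (H n)" "\<And>n. H n \<subseteq> ball 0 (1 / real (Suc n))" by metis
  define \<C> where "\<C> = (\<Union>n. range (coset (H n)))"
  have cC: "countable \<C>" unfolding \<C>_def
    using opsub_coset_finite[OF comp H(1)] by (auto intro: countable_finite)
  have CA: "\<C> \<subseteq> coset_algebra" unfolding \<C>_def using coset_in_algebra[OF H(1)] by blast
  have "O' \<in> sigma_sets UNIV coset_algebra" if O': "open (O' :: 'a set)" for O'
  proof -
    have "O' = \<Union>{C \<in> \<C>. C \<subseteq> O'}"
    proof (intro equalityI subsetI)
      fix x assume x: "x \<in> O'"
      have "(\<lambda>h. x + h) -` O' = {h. x + h \<in> O'}" by auto
      moreover have "open ((\<lambda>h. x + h) -` O')" by (intro open_vimage O' continuous_intros)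
      ultimately obtain e where e: "e > 0" "ball 0 e \<subseteq> {h. x + h \<in> O'}"
        using x by (metis add.right_neutral mem_Collect_eq open_contains_ball)
      obtain n where "inverse (real (Suc n)) < e" using reals_Archimedean[OF e(1)] by blast
      hence "1 / real (Suc n) \<le> e" by (simp add: inverse_eq_divide)
      hence "H n \<subseteq> ball 0 e" by (intro order_trans[OF H(2) subset_ball])
      hence "coset (H n) x \<subseteq> O'" using e(2)
        by (auto simp: coset_def)
      moreover have "x \<in> coset (H n) x" using H(1)[of n] by (auto simp: coset_def opsub_def subgrp_def)
      moreover have "coset (H n) x \<in> \<C>" by (auto simp: \<C>_def)
      ultimately show "x \<in> \<Union>{C \<in> \<C>. C \<subseteq> O'}" by blast
    qed auto
    moreover have "\<Union>{C \<in> \<C>. C \<subseteq> O'} \<in> sigma_sets UNIV coset_algebra"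
      using CA by (intro sigma_sets_UNION countable_subset[OF _ cC]) (auto intro: sigma_sets.Basic)
    ultimately show ?thesis by simp
  qed
  thus "sets (borel :: 'a measure) \<subseteq> sigma_sets UNIV coset_algebra"
    unfolding borel_def by (simp add: sets_measure_of) (intro sigma_sets_mono, auto)
qed

lemma coset_measure_simps:
  shows "coset_measure {} = 0" "coset_measure UNIV = 1" "coset_measure A \<ge> 0"
    "A \<in> coset_algebra \<Longrightarrow> B \<in> coset_algebra \<Longrightarrow> A \<inter> B = {} \<Longrightarrow> coset_measure (A \<union> B) = coset_measure A + coset_measure B"
    "A \<in> coset_algebra \<Longrightarrow> (\<lambda>y. x + y) ` A \<in> coset_algebra"
    "A \<in> coset_algebra \<Longrightarrow> coset_measure ((\<lambda>y. x + y) ` A) = coset_measure A"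
proof -
  have u: "opsub (UNIV :: 'a set)" by (auto simp: opsub_def subgrp_def)
  have sat: "saturated UNIV ({} :: 'a set)" "saturated UNIV (UNIV :: 'a set)" by (auto simp: saturated_def)
  show "coset_measure {} = 0" "coset_measure UNIV = 1"
    using coset_measure_eq[OF u sat(1)] coset_measure_eq[OF u sat(2)] opsub_idx_pos[OF u]
    by (auto simp: coset_density_def idx_def[of "{}"])
  show "coset_measure A \<ge> 0" by (simp add: coset_measure_def coset_density_def)
  show "coset_measure (A \<union> B) = coset_measure A + coset_measure B"
    if A: "A \<in> coset_algebra" and B: "B \<in> coset_algebra" and "A \<inter> B = {}"
  proof -
    obtain H where H: "opsub H" "saturated H A" "saturated H B" using coset_algebra_common[OF A B] by blast
    have s: "subgrp H" using H by (simp add: opsub_def)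
    have "idx (A \<union> B) H = idx A H + idx B H" unfolding idx_def image_Un
      by (intro card_Un_disjoint opsub_coset_finite[OF comp] H saturated_coset_disjoint s that)
    thus ?thesis using H saturated_set_ops(1)[OF s H(2,3)]
      by (simp add: coset_measure_eq[OF H(1)] coset_density_def add_divide_distrib)
  qed
  show tr: "(\<lambda>y. x + y) ` A \<in> coset_algebra" if "A \<in> coset_algebra" for A x
    using that unfolding coset_algebra_def by (fastforce simp: saturated_def add.assoc)
  show "coset_measure ((\<lambda>y. x + y) ` A) = coset_measure A" if A: "A \<in> coset_algebra"
  proof -
    obtain H where H: "opsub H" "saturated H A" "saturated H ((\<lambda>y. x + y) ` A)"
      using coset_algebra_common A tr[OF A] by metis
    thus ?thesis using idx_translate[of H x A]
      by (simp add: coset_measure_eq[OF H(1)] coset_density_def opsub_def)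
  qed
qed

text \<open>Compactness yields the continuity at the empty set that Caratheodory's extension of
  \<open>coset_measure\<close> requires.\<close>

lemma decreasing_clopen_empty:
  assumes "\<And>i. closed (A i :: 'a set)" "decseq A" "(\<Inter>i. A i) = {}"
  shows "\<exists>k. \<forall>i\<ge>k. A i = {}"
proof -
  have cover: "UNIV \<subseteq> (\<Union>i. - A i)" using assms(3) by blast
  have op: "open (- A i)" for i using assms(1) by (rule open_Compl)
  obtain D where D: "D \<subseteq> UNIV" "finite D" "UNIV \<subseteq> (\<Union>i\<in>D. - A i)"
    by (rule compactE_image[OF comp op cover])
  have "A i = {}" if "i \<ge> Max (insert 0 D)" for i
  proof -
    have "A i \<subseteq> A j" if "j \<in> D" for j
    proof -
      have "j \<le> Max (insert 0 D)" using D(2) that by simp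
      hence "j \<le> i" using \<open>i \<ge> Max (insert 0 D)\<close> by linarith
      thus ?thesis by (rule decseqD[OF assms(2)])
    qed
    thus ?thesis using D(3) by blast
  qed
  thus ?thesis by blast
qed

text \<open>\<open>mixing_action\<close> quantifies over all Haar measures, so it says something
  only once one exists.\<close>

lemma haar_measure_exists: "\<exists>\<mu> :: 'a measure. haar_measure \<mu>"
proof -
  interpret A: Sigma_Algebra.algebra UNIV coset_algebra by (rule coset_algebra_algebra)
  let ?f = "\<lambda>A. ennreal (coset_measure A)"
  note cm = coset_measure_simps
  have "\<exists>\<mu>. (\<forall>s\<in>coset_algebra. \<mu> s = ?f s) \<and> measure_space UNIV (sigma_sets UNIV coset_algebra) \<mu>"
  proof (rule A.caratheodory_empty_continuous)
    show "positive coset_algebra ?f" by (simp add: positive_def cm)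
    show "additive coset_algebra ?f" unfolding additive_def by (auto simp: cm)
    fix A :: "nat \<Rightarrow> 'a set" assume A: "range A \<subseteq> coset_algebra" "decseq A" "(\<Inter>i. A i) = {}"
    have "closed (A i)" for i using A(1) coset_algebra_clopen by blast
    then obtain k where k: "\<forall>i\<ge>k. A i = {}" using decreasing_clopen_empty A(2,3) by blast
    have "\<forall>\<^sub>F i in sequentially. ?f (A i) = 0"
      using eventually_ge_at_top[of k] by eventually_elim (use k cm(1) in auto)
    thus "(\<lambda>i. ?f (A i)) \<longlonglongrightarrow> 0" by (rule tendsto_eventually)
  qed simp
  then obtain \<mu> where \<mu>: "\<And>s. s \<in> coset_algebra \<Longrightarrow> \<mu> s = ?f s"
    "measure_space UNIV (sets (borel :: 'a measure)) \<mu>" unfolding sigma_coset_algebra by blast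
  define M where "M = measure_of UNIV (sets (borel :: 'a measure)) \<mu>"
  have sM [simp]: "sets M = sets borel" "space M = UNIV"
    unfolding M_def using sets.sigma_sets_eq[of "borel :: 'a measure"] by (simp_all add: sets_measure_of_conv space_measure_of_conv)
  have em: "emeasure M B = \<mu> B" if "B \<in> sets borel" for B
    using \<mu>(2) that unfolding M_def measure_space_def by (intro emeasure_measure_of_sigma) auto
  have clb: "B \<in> sets borel" if "B \<in> coset_algebra" for B using coset_algebra_clopen(1)[OF that] by simp
  have emc: "emeasure M B = ?f B" if "B \<in> coset_algebra" for B using em[OF clb[OF that]] \<mu>(1)[OF that] by simp
  have one: "emeasure M UNIV = 1" using emc[OF UNIV_in_coset_algebra] by (simp add: cm)
  interpret P: prob_space M by (rule prob_spaceI) (simp add: one)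
  have inv: "measure M ((\<lambda>y. x + y) ` B) = measure M B" if B: "B \<in> sets borel" for B x
  proof -
    have meas: "(\<lambda>y. y - x) \<in> measurable M borel"
      unfolding measurable_cong_sets[OF sM(1) refl] by (intro borel_measurable_continuous_onI continuous_intros)
    have im: "(\<lambda>y. x + y) ` C = (\<lambda>y. y - x) -` C" for C
      by (auto simp: image_iff) (metis add.commute diff_add_cancel)
    \<comment> \<open>The measure and its translate agree on the coset algebra, which is stable
      under intersection and generates the Borel sets.\<close>
    have "M = distr M borel (\<lambda>y. y - x)"
    proof (rule measure_eqI_generator_eq[where E=coset_algebra and \<Omega>=UNIV and A="\<lambda>_. UNIV"])
      show "Int_stable coset_algebra" using A.Int by (auto simp: Int_stable_def)
      fix X assume X: "X \<in> coset_algebra"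
      have "emeasure (distr M borel (\<lambda>y. y - x)) X = emeasure M ((\<lambda>y. x + y) ` X)"
        using meas clb[OF X] by (simp add: emeasure_distr im)
      also have "\<dots> = emeasure M X" using X by (simp add: emc cm)
      finally show "emeasure M X = emeasure (distr M borel (\<lambda>y. y - x)) X" by simp
    qed (use sigma_coset_algebra UNIV_in_coset_algebra one in auto)
    hence "emeasure M B = emeasure (distr M borel (\<lambda>y. y - x)) B" by simp
    also have "\<dots> = emeasure M ((\<lambda>y. x + y) ` B)" using meas B by (simp add: emeasure_distr im)
    finally show ?thesis by (simp add: measure_def)
  qed
  have "haar_measure M" unfolding haar_measure_def using P.prob_space_axioms inv by simp
  thus ?thesis by blast
qed

end

context zd_action
begin

text \<open>Otherwise the image \<open>Y\<close> is a proper closed subgroup and lies in a proper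
  open subgroup \<open>W\<close>. As \<alpha> n acts trivially modulo \<open>W\<close>, all natural
  multiples of n preserve \<open>W\<close>, and mixing along them gives p = p^2 for its measure p.
  But \<open>W\<close> has finitely many and at least two cosets, all of measure p, which excludes
  both 0 and 1.\<close>

lemma mixing_imp_surj:
  assumes mix: "mixing_action \<alpha>" and n: "n \<noteq> 0"
  shows "surj (\<lambda>x. \<alpha> n x - x)"
proof (rule ccontr)
  define Y where "Y = range (\<lambda>x. \<alpha> n x - x)"
  assume "\<not> surj (\<lambda>x. \<alpha> n x - x)"
  then obtain z where z: "z \<notin> Y" by (auto simp: Y_def)
  have "continuous_on UNIV (\<lambda>x. \<alpha> n x - x)" by (intro continuous_intros act_cont)
  hence "compact Y" unfolding Y_def by (rule compact_continuous_image[OF _ comp])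
  hence cl: "closed Y" by (rule compact_imp_closed)
  have sY: "subgrp Y" unfolding subgrp_def Y_def
  proof (intro conjI ballI)
    show "0 \<in> range (\<lambda>x. \<alpha> n x - x)" by (intro range_eqI[of _ _ 0]) simp
    fix a b assume "a \<in> range (\<lambda>x. \<alpha> n x - x)" "b \<in> range (\<lambda>x. \<alpha> n x - x)"
    then obtain x y where "a = \<alpha> n x - x" "b = \<alpha> n y - y" by blast
    thus "a - b \<in> range (\<lambda>x. \<alpha> n x - x)" by (intro range_eqI[of _ _ "x - y"]) (simp add: act_diff)
  qed
  \<comment> \<open>\<open>H\<close> is taken so small that z - \<open>H\<close> misses
    \<open>Y\<close>; hence z stays outside \<open>Y\<close> + \<open>H\<close>.\<close>
  have "open ((\<lambda>h. z - h) -` (- Y))" using cl by (intro open_vimage continuous_intros) auto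
  then obtain H where H: "opsub H" "H \<subseteq> (\<lambda>h. z - h) -` (- Y)"
    using opsub_basis[OF comp zd, of "(\<lambda>h. z - h) -` (- Y)"] z by auto
  have sH: "subgrp H" using H by (simp add: opsub_def)
  define W where "W = (\<Union>y\<in>Y. coset H y)"
  have memW: "w \<in> W \<longleftrightarrow> (\<exists>y\<in>Y. w - y \<in> H)" for w by (auto simp: W_def coset_def)
  have zW: "z \<notin> W"
  proof
    assume "z \<in> W"
    then obtain y where y: "y \<in> Y" "z - y \<in> H" using memW by blast
    hence "z - (z - y) \<notin> Y" using H(2) by blast
    thus False using y(1) by simp
  qed
  have YW: "Y \<subseteq> W"
  proof
    fix y assume "y \<in> Y"
    thus "y \<in> W" using subgrpD(1)[OF sH] unfolding memW by (intro bexI[of _ y]) simp_all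
  qed
  have sW: "subgrp W" unfolding subgrp_def
  proof (intro conjI ballI)
    show "0 \<in> W" using YW subgrpD(1)[OF sY] by blast
    fix a b assume "a \<in> W" "b \<in> W"
    then obtain y y' where y: "y \<in> Y" "a - y \<in> H" "y' \<in> Y" "b - y' \<in> H" by (auto simp: memW)
    have "(a - b) - (y - y') = (a - y) - (b - y')" by (simp add: algebra_simps)
    hence "(a - b) - (y - y') \<in> H" using subgrpD(2)[OF sH y(2,4)] by (simp only:)
    thus "a - b \<in> W" using subgrpD(2)[OF sY y(1,3)] memW by blast
  qed
  have oW: "open W" unfolding W_def using H(1) open_coset by (auto simp: opsub_def)
  have W: "opsub W" using sW oW by (simp add: opsub_def)
  have inv1: "\<alpha> n w \<in> W \<longleftrightarrow> w \<in> W" for w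
  proof -
    have "\<alpha> n w - w \<in> W" using YW by (auto simp: Y_def)
    thus ?thesis using subgrpD(4)[OF sW, of "\<alpha> n w - w" w] subgrpD(2)[OF sW, of "\<alpha> n w" "\<alpha> n w - w"] by auto
  qed
  have inv: "\<alpha> (int k *s n) w \<in> W \<longleftrightarrow> w \<in> W" for k w
  proof (induction k arbitrary: w)
    case (Suc k) thus ?case unfolding act_multiple_Suc using inv1 by simp
  qed simp
  obtain \<mu> :: "'a measure" where \<mu>: "haar_measure \<mu>" using haar_measure_exists[OF comp zd] by blast
  interpret P: prob_space \<mu> using \<mu> by (simp add: haar_measure_def)
  have sets: "sets \<mu> = sets borel" and trans: "\<And>A x. A \<in> sets borel \<Longrightarrow> measure \<mu> ((\<lambda>y. x + y) ` A) = measure \<mu> A"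
    using \<mu> by (auto simp: haar_measure_def)
  have sp: "space \<mu> = UNIV" using sets_eq_imp_space_eq[OF sets] by simp
  have bW: "W \<in> sets borel" using oW by simp
  define p where "p = measure \<mu> W"
  have lim: "((\<lambda>m. measure \<mu> (W \<inter> \<alpha> m -` W)) \<longlongrightarrow> p * p) cofinite"
    using mix \<mu> bW unfolding mixing_action_def p_def by blast
  \<comment> \<open>Distinct multiples of n leave every finite set, so the limit may be tested along
    them.\<close>
  have "inj (\<lambda>k::nat. int k *s n)"
  proof (rule injI)
    fix a b :: nat assume eq: "int a *s n = int b *s n"
    obtain i where i: "n $ i \<noteq> 0" using n by (metis vec_eq_iff zero_index)
    have "(int a *s n) $ i = (int b *s n) $ i" using eq by simp
    thus "a = b" using i by simp
  qed
  hence "filterlim (\<lambda>k::nat. int k *s n) cofinite cofinite"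
    unfolding filterlim_iff eventually_cofinite
    by (auto dest: finite_vimageI simp: vimage_def)
  from filterlim_compose[OF lim this]
  have "((\<lambda>k::nat. measure \<mu> (W \<inter> \<alpha> (int k *s n) -` W)) \<longlongrightarrow> p * p) cofinite" .
  moreover have "W \<inter> \<alpha> (int k *s n) -` W = W" for k using inv by auto
  ultimately have "((\<lambda>k::nat. p) \<longlongrightarrow> p * p) cofinite" by (simp add: p_def)
  hence pp: "p = p * p" by (simp add: tendsto_const_iff cofinite_eq_sequentially)
  have coset_img: "coset W x = (\<lambda>y. x + y) ` W" for x
    by (auto simp: coset_def image_iff) (metis add_diff_cancel_left' diff_add_cancel add.commute)
  have "p \<noteq> 0"
  proof
    assume p0: "p = 0"
    obtain S where S: "finite S" "UNIV \<subseteq> (\<Union>x\<in>S. coset W x)"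
    proof -
      have "UNIV \<subseteq> (\<Union>x. coset W x)" using subgrpD(1)[OF sW] by (auto simp: coset_def)
      thus ?thesis using that compactE_image[OF comp, of UNIV "coset W"] open_coset[OF oW] by auto
    qed
    have "measure \<mu> (\<Union>x\<in>S. coset W x) \<le> (\<Sum>x\<in>S. measure \<mu> (coset W x))"
      using open_coset[OF oW] sets by (intro P.finite_measure_subadditive_finite S) auto
    also have "\<dots> = 0" unfolding coset_img trans[OF bW] using p0 by (simp add: p_def)
    also have "(\<Union>x\<in>S. coset W x) = space \<mu>" using S(2) sp by auto
    finally show False using P.prob_space by simp
  qed
  hence p1: "p = 1" using pp by simp
  have "W \<inter> coset W z = {}"
  proof -
    have False if "w \<in> W" "w - z \<in> W" for w
      using subgrpD(2)[OF sW that] zW by simp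
    thus ?thesis by (auto simp: coset_def)
  qed
  hence "measure \<mu> (W \<union> coset W z) = measure \<mu> W + measure \<mu> (coset W z)"
    using open_coset[OF oW] oW sets by (intro P.finite_measure_Union) auto
  also have "\<dots> = 2" unfolding coset_img trans[OF bW] using p1 by (simp add: p_def)
  finally show False using P.prob_le_1[of "W \<union> coset W z"] by simp
qed

end

section \<open>Characters\<close>

definition nsum :: "'a::ab_group_add \<Rightarrow> nat \<Rightarrow> 'a" where
  "nsum y i = ((+) y ^^ i) 0"

lemma nsum_0 [simp]: "nsum y 0 = 0"
  and nsum_Suc: "nsum y (Suc i) = y + nsum y i"
  by (simp_all add: nsum_def)

lemma nsum_add: "nsum y (i + j) = nsum y i + nsum y j"
  by (induction i) (simp_all add: nsum_Suc add.assoc)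

lemma nsum_mult: "nsum y (i * j) = nsum (nsum y i) j"
  by (induction j) (simp_all add: nsum_Suc nsum_add)

lemma nsum_in: "subgrp H \<Longrightarrow> y \<in> H \<Longrightarrow> nsum y i \<in> H"
  by (induction i) (auto simp: nsum_Suc subgrpD)

lemma nsum_hom:
  fixes f :: "'a::ab_group_add \<Rightarrow> 'a"
  assumes "\<And>x y. f (x + y) = f x + f y" shows "f (nsum y i) = nsum (f y) i"
  using additive_map_0[of f] assms by (induction i) (simp_all add: nsum_Suc)

lemma nsum_diff: "i \<le> j \<Longrightarrow> nsum y (j - i) = nsum y j - nsum y i"
  using nsum_add[of y "j - i" i] by (simp add: algebra_simps)

lemma ex_nsum_in:
  assumes H: "subgrp H" and fin: "finite (range (coset H))"
  obtains n where "n > 0" "nsum y n \<in> H"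
proof -
  have "\<not> inj (\<lambda>i::nat. coset H (nsum y i))"
    using fin by (meson finite_imageD infinite_UNIV_nat finite_subset image_subsetI rangeI)
  then obtain i j where "coset H (nsum y i) = coset H (nsum y j)" "i \<noteq> j" by (auto simp: inj_def)
  then obtain i j where ij: "coset H (nsum y i) = coset H (nsum y j)" "i < j" by (metis nat_neq_iff)
  hence "nsum y (j - i) \<in> H" using coset_eq_iff[OF H] nsum_diff[of i j y] by (metis less_imp_le)
  thus ?thesis using that[of "j - i"] ij(2) by simp
qed

section \<open>Extending characters from subgroups\<close>

definition partial_char :: "'a::ab_group_add set \<Rightarrow> ('a \<Rightarrow> complex) \<Rightarrow> bool" where
  "partial_char K c \<longleftrightarrow> subgrp K \<and> (\<forall>a\<in>K. norm (c a) = 1) \<and> (\<forall>a\<in>K. \<forall>b\<in>K. c (a + b) = c a * c b)"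

lemma partial_char_nsum:
  assumes "partial_char K c" "y \<in> K" shows "c (nsum y i) = c y ^ i"
proof (induction i)
  case 0
  have K: "subgrp K" and c: "norm (c 0) = 1" "c (0 + 0) = c 0 * c 0"
    using assms(1) subgrpD(1)[of K] by (auto simp: partial_char_def)
  have "c 0 \<noteq> 0" using c(1) by auto
  thus ?case using c(2) by simp
next
  case (Suc i)
  have "subgrp K" using assms(1) by (simp add: partial_char_def)
  hence "nsum y i \<in> K" using assms(2) by (rule nsum_in)
  thus ?case using assms Suc by (simp add: nsum_Suc partial_char_def)
qed

text \<open>With n the order of y modulo \<open>K\<close>, the only constraint on the value \<omega>
  at y is that its n-th power be the value of c at n y.\<close>

lemma partial_char_extend:
  assumes pc: "partial_char K c" and n: "n > 0" "nsum y n \<in> K"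
    and minimal: "\<And>i. 0 < i \<Longrightarrow> i < n \<Longrightarrow> nsum y i \<notin> K" and \<omega>: "\<omega> ^ n = c (nsum y n)"
  obtains K' c' where "partial_char K' c'" "K \<subseteq> K'" "y \<in> K'" "\<And>a. a \<in> K \<Longrightarrow> c' a = c a" "c' y = \<omega>"
proof -
  have K: "subgrp K" using pc by (simp add: partial_char_def)
  have nc: "norm (c a) = 1" if "a \<in> K" for a using pc that by (simp add: partial_char_def)
  have cm: "c (a + b) = c a * c b" if "a \<in> K" "b \<in> K" for a b using pc that by (simp add: partial_char_def)
  have "norm \<omega> ^ n = 1" using \<omega> nc[OF n(2)] by (simp flip: norm_power)
  hence n\<omega>: "norm \<omega> = 1" using n(1) power_eq_imp_eq_base[of "norm \<omega>" n 1] by simp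
  have c_nsum: "c (nsum y i) = \<omega> ^ i" if i: "nsum y i \<in> K" for i
  proof -
    have "nsum y (n * (i div n)) \<in> K" unfolding nsum_mult by (rule nsum_in[OF K n(2)])
    hence "nsum y i - nsum y (n * (i div n)) \<in> K" using i subgrpD(2)[OF K] by blast
    hence "nsum y (i mod n) \<in> K" using nsum_diff[of "n * (i div n)" i y]
      by (simp add: minus_mult_div_eq_mod)
    hence "i mod n = 0" using minimal[of "i mod n"] n(1) by (metis mod_less_divisor not_gr_zero)
    then obtain q where q: "i = n * q" by auto
    show ?thesis unfolding q nsum_mult partial_char_nsum[OF pc n(2)] \<omega>[symmetric] by (simp add: power_mult)
  qed
  define K' where "K' = {k + nsum y i | k i. k \<in> K}"
  \<comment> \<open>A choice among all representations k + i y; \<open>wd\<close> shows that they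
    give the same value.\<close>
  define c' where "c' = (\<lambda>z. SOME w. \<exists>k i. k \<in> K \<and> z = k + nsum y i \<and> w = c k * \<omega> ^ i)"
  have wd: "c k * \<omega> ^ i = c k' * \<omega> ^ j"
    if "k \<in> K" "k' \<in> K" "k + nsum y i = k' + nsum y j" "i \<le> j" for k k' i j
  proof -
    have "nsum y (j - i) = k - k'" using that(3) by (simp add: nsum_diff[OF that(4)] algebra_simps)
    hence e: "nsum y (j - i) \<in> K" "k = k' + nsum y (j - i)" using that subgrpD(2)[OF K] by auto
    have "c k = c k' * \<omega> ^ (j - i)" using cm[OF that(2) e(1)] c_nsum[OF e(1)] e(2) by simp
    thus ?thesis using that(4) by (simp flip: power_add)
  qed
  have c': "c' (k + nsum y i) = c k * \<omega> ^ i" if "k \<in> K" for k i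
  proof -
    let ?P = "\<lambda>w. \<exists>k' j. k' \<in> K \<and> k + nsum y i = k' + nsum y j \<and> w = c k' * \<omega> ^ j"
    have "?P (c' (k + nsum y i))" unfolding c'_def by (rule someI[of ?P "c k * \<omega> ^ i"]) (use that in blast)
    then obtain k' j where k': "k' \<in> K" "k + nsum y i = k' + nsum y j" "c' (k + nsum y i) = c k' * \<omega> ^ j" by blast
    show ?thesis
    proof (cases "i \<le> j")
      case True thus ?thesis using wd[OF that k'(1,2)] k'(3) by simp
    next
      case False thus ?thesis using wd[OF k'(1) that k'(2)[symmetric]] k'(3) by simp
    qed
  qed
  have in_K': "k + nsum y i \<in> K'" if "k \<in> K" for k i using that by (auto simp: K'_def)
  have add: "(k + nsum y i) + (k' + nsum y j) = (k + k') + nsum y (i + j)" for k k' i j by (simp add: nsum_add algebra_simps)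
  have sK': "subgrp K'" unfolding subgrp_def
  proof (intro conjI ballI)
    show "0 \<in> K'" using in_K'[OF subgrpD(1)[OF K], of 0] by simp
    fix a b assume "a \<in> K'" "b \<in> K'"
    then obtain k i k' j where a: "a = k + nsum y i" "b = k' + nsum y j" "k \<in> K" "k' \<in> K" by (auto simp: K'_def)
    \<comment> \<open>\<open>nsum\<close> has natural multiples only, so - j y is written as (n j -
      j) y - n j y, with n j y in \<open>K\<close>.\<close>
    have nK: "nsum y (n * j) \<in> K" unfolding nsum_mult by (rule nsum_in[OF K n(2)])
    have "j \<le> n * j" using n(1) by simp
    hence "nsum y (i + (n * j - j)) = nsum y i + (nsum y (n * j) - nsum y j)"
      by (simp only: nsum_add nsum_diff)
    hence "a - b = (k - k' - nsum y (n * j)) + nsum y (i + (n * j - j))"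
      by (simp only: a) (simp add: algebra_simps)
    thus "a - b \<in> K'" using in_K'[of "k - k' - nsum y (n * j)"] a nK subgrpD(2)[OF K] by metis
  qed
  show ?thesis
  proof (rule that[of K' c'])
    show "partial_char K' c'" unfolding partial_char_def
    proof (intro conjI ballI sK')
      fix a assume "a \<in> K'"
      then obtain k i where a: "a = k + nsum y i" "k \<in> K" by (auto simp: K'_def)
      show "norm (c' a) = 1" unfolding a(1) c'[OF a(2)] using nc[OF a(2)] n\<omega> by (simp add: norm_mult norm_power)
      fix b assume "b \<in> K'"
      then obtain k' j where b: "b = k' + nsum y j" "k' \<in> K" by (auto simp: K'_def)
      have "c' (a + b) = c (k + k') * \<omega> ^ (i + j)"
        unfolding a(1) b(1) add by (rule c') (rule subgrpD(4)[OF K a(2) b(2)])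
      thus "c' (a + b) = c' a * c' b" unfolding a(1) b(1) c'[OF a(2)] c'[OF b(2)] cm[OF a(2) b(2)]
        by (simp add: power_add)
    qed
    show "K \<subseteq> K'" using in_K'[of _ 0] by auto
    show "y \<in> K'" using in_K'[OF subgrpD(1)[OF K], of 1] by (simp add: nsum_Suc)
    show "c' a = c a" if "a \<in> K" for a using c'[OF that, of 0] by simp
    have "c 0 = 1" using c_nsum[of 0] subgrpD(1)[OF K] by simp
    thus "c' y = \<omega>" using c'[OF subgrpD(1)[OF K], of 1] by (simp add: nsum_Suc)
  qed
qed

lemma ex_minimal_nsum:
  assumes "subgrp H" "finite (range (coset H))"
  obtains n where "n > 0" "nsum y n \<in> H" "\<And>i. 0 < i \<Longrightarrow> i < n \<Longrightarrow> nsum y i \<notin> H"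
proof -
  let ?P = "\<lambda>n. n > 0 \<and> nsum y n \<in> H"
  have "\<exists>n. ?P n" using ex_nsum_in[OF assms] by metis
  hence "?P (LEAST n. ?P n)" by (rule LeastI_ex)
  moreover have "\<not> ?P i" if "i < (LEAST n. ?P n)" for i using that by (rule not_less_Least)
  ultimately show ?thesis using that by blast
qed

text \<open>A root of unity other than 1 is prescribed at x, then the domain is enlarged. Finiteness
  of the index replaces Zorn's lemma: among the suitable domains, one of least index is the whole
  group.\<close>

lemma ex_char_nontrivial:
  fixes H :: "'a::ab_group_add set"
  assumes H: "subgrp H" and fin: "finite (range (coset H))" and x: "x \<notin> H"
  obtains c where "partial_char UNIV c" "\<And>h. h \<in> H \<Longrightarrow> c h = 1" "c x \<noteq> 1"
proof -
  define P where "P = (\<lambda>K c. partial_char K c \<and> H \<subseteq> K \<and> x \<in> K \<and> (\<forall>h\<in>H. c h = 1) \<and> c x \<noteq> (1::complex))"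
  have finK: "finite (range (coset K))" if "subgrp K" "H \<subseteq> K" for K
  proof -
    have "coset K a = coset K b" if "coset H a = coset H b" for a b
      using that \<open>H \<subseteq> K\<close> coset_eq_iff[OF H] coset_eq_iff[OF \<open>subgrp K\<close>] by blast
    from card_image_le_card_image(1)[OF fin this] show ?thesis .
  qed
  have "\<exists>K c. P K c"
  proof -
    obtain n where n: "n > 0" "nsum x n \<in> H" "\<And>i. 0 < i \<Longrightarrow> i < n \<Longrightarrow> nsum x i \<notin> H"
      using ex_minimal_nsum[OF H fin] by metis
    have "n \<noteq> 1" using n(2) x by (auto simp: nsum_Suc)
    hence n2: "n \<ge> 2" using n(1) by simp
    define \<omega> where "\<omega> = cis (2 * pi / real n)"
    have "\<omega> ^ n = cis (real n * (2 * pi / real n))" unfolding \<omega>_def by (rule Complex.DeMoivre)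
    also have "real n * (2 * pi / real n) = 2 * pi" using n(1) by simp
    finally have "\<omega> ^ n = 1" by simp
    moreover have "\<omega> \<noteq> 1"
    proof
      assume "\<omega> = 1"
      hence "cos (2 * pi / real n) = 1" unfolding \<omega>_def by (simp add: complex_eq_iff)
      moreover have "0 < 2 * pi / real n" "2 * pi / real n \<le> pi" using n2 by (auto simp: field_simps)
      ultimately show False using cos_monotone_0_pi[of 0 "2 * pi / real n"] by simp
    qed
    moreover have "partial_char H (\<lambda>_. 1)" using H by (simp add: partial_char_def)
    ultimately obtain K c where "partial_char K c" "H \<subseteq> K" "x \<in> K" "\<And>a. a \<in> H \<Longrightarrow> c a = 1" "c x = \<omega>"
      using partial_char_extend[of H "\<lambda>_. 1" n x \<omega>] n by metis
    thus ?thesis using \<open>\<omega> \<noteq> 1\<close> unfolding P_def by blast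
  qed
  hence "\<exists>r K c. P K c \<and> idx UNIV K = r" by blast
  define r where "r = (LEAST r. \<exists>K c. P K c \<and> idx UNIV K = r)"
  have "\<exists>K c. P K c \<and> idx UNIV K = r" unfolding r_def
    using \<open>\<exists>r K c. P K c \<and> idx UNIV K = r\<close> by (rule LeastI_ex)
  then obtain K c where Kc: "P K c" "idx UNIV K = r" by blast
  have K: "subgrp K" "H \<subseteq> K" "partial_char K c" using Kc(1) by (auto simp: P_def partial_char_def)
  have "K = UNIV"
  proof (rule ccontr)
    assume "K \<noteq> UNIV"
    then obtain y where y: "y \<notin> K" by blast
    obtain n where n: "n > 0" "nsum y n \<in> K" "\<And>i. 0 < i \<Longrightarrow> i < n \<Longrightarrow> nsum y i \<notin> K"
      using ex_minimal_nsum[OF K(1) finK[OF K(1,2)]] by metis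
    have "norm (c (nsum y n)) = 1" using K(3) n(2) by (simp add: partial_char_def)
    \<comment> \<open>The value at n y lies on the unit circle and has an n-th root there, obtained
      by dividing the argument.\<close>
    then obtain t where t: "c (nsum y n) = cis t" by (metis cis_Arg complex_norm_eq_1_exp_eq norm_eq_zero rcis_cmod_Arg rcis_def mult_1 of_real_1)
    have "cis (t / real n) ^ n = cis (real n * (t / real n))" by (rule Complex.DeMoivre)
    also have "\<dots> = c (nsum y n)" using n(1) by (simp add: t)
    finally have "cis (t / real n) ^ n = c (nsum y n)" .
    then obtain K' c' where K': "partial_char K' c'" "K \<subseteq> K'" "y \<in> K'" "\<And>a. a \<in> K \<Longrightarrow> c' a = c a"
      using partial_char_extend[OF K(3) n(1,2)] n(3) by metis
    have sK': "subgrp K'" using K'(1) by (simp add: partial_char_def)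
    have "P K' c'" using Kc(1) K' unfolding P_def by auto
    hence "r \<le> idx UNIV K'" unfolding r_def by (intro Least_le) blast
    moreover have "idx UNIV K = idx UNIV K' * idx K' K"
      by (intro idx_tower_saturated sK' K K') auto
    moreover have "idx K' K \<ge> 2"
    proof -
      have "card {0, y} \<le> idx K' K"
      proof (rule card_le_idx)
        show "finite (coset K ` K')" using finK[OF K(1,2)] by (rule rev_finite_subset) auto
        show "{0, y} \<subseteq> K'" using K'(3) subgrpD(1)[OF sK'] by simp
        show "u = v" if "u \<in> {0, y}" "v \<in> {0, y}" "u - v \<in> K" for u v
          using that y subgrpD(3)[OF K(1), of "- y"] by auto
      qed (rule K)
      moreover have "y \<noteq> 0" using y subgrpD(1)[OF K(1)] by auto
      ultimately show ?thesis by simp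
    qed
    moreover have "idx UNIV K' > 0"
      using finK[OF sK'] K(2) K'(2) by (auto simp: idx_def card_gt_0_iff)
    ultimately have "2 * idx UNIV K' \<le> idx UNIV K'" using Kc(2) by (metis mult.commute mult_le_mono2 order_trans le_refl)
    thus False using \<open>idx UNIV K' > 0\<close> by simp
  qed
  thus ?thesis using that Kc(1) unfolding P_def by blast
qed

text \<open>The circle has no small subgroups: squaring multiplies 1 - Re w by 2 (1 + Re w), so this
  number at least doubles as long as Re w > 0, which cannot go on below 1.\<close>

lemma powers_in_half_plane:
  fixes w :: complex
  assumes "norm w = 1" "\<And>k. Re (w ^ k) > 0" shows "w = 1"
proof -
  define a where "a = (\<lambda>k. Re (w ^ (2 ^ k)))"
  have n1: "norm (w ^ k) = 1" for k using assms(1) by (simp add: norm_power)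
  have rec: "a (Suc k) = 2 * (a k)\<^sup>2 - 1" for k
  proof -
    let ?v = "w ^ (2 ^ k)"
    have "w ^ (2 ^ Suc k) = ?v * ?v" by (simp add: mult_2 power_add)
    hence "a (Suc k) = (Re ?v)\<^sup>2 - (Im ?v)\<^sup>2" by (simp add: a_def power2_eq_square)
    moreover have "(Re ?v)\<^sup>2 + (Im ?v)\<^sup>2 = 1" using n1[of "2 ^ k"] cmod_power2[of ?v] by simp
    ultimately show ?thesis by (simp add: a_def)
  qed
  have a0: "a k > 0" for k unfolding a_def by (rule assms(2))
  have a1: "a k \<le> 1" for k using n1[of "2 ^ k"] complex_Re_le_cmod[of "w ^ (2 ^ k)"] by (simp add: a_def)
  have le: "2 ^ k * (1 - a 0) \<le> 1 - a k" for k
  proof (induction k)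
    case (Suc k)
    have "1 - a (Suc k) = 2 * ((1 - a k) * (1 + a k))" by (simp add: rec power2_eq_square algebra_simps)
    also have "\<dots> \<ge> 2 * ((1 - a k) * 1)" using a0[of k] a1[of k] by (intro mult_left_mono) auto
    finally show ?case using Suc by simp
  qed simp
  have "a 0 = 1"
  proof (rule ccontr)
    assume "a 0 \<noteq> 1"
    hence pos: "1 - a 0 > 0" using a1[of 0] by simp
    obtain k where "1 / (1 - a 0) < 2 ^ k" using real_arch_pow[of 2 "1 / (1 - a 0)"] by auto
    hence "1 < 2 ^ k * (1 - a 0)" using pos by (simp add: divide_less_eq)
    thus False using le[of k] a0[of k] by linarith
  qed
  hence "Re w = 1" by (simp add: a_def)
  moreover have "(Re w)\<^sup>2 + (Im w)\<^sup>2 = 1" using assms(1) cmod_power2[of w] by simp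
  ultimately show ?thesis by (simp add: complex_eq_iff)
qed

section \<open>Continuous characters and expansiveness\<close>

lemma character_simps:
  assumes "c \<in> characters"
  shows "continuous_on UNIV c" "norm (c x) = 1" "c (x + y) = c x * c y" "c 0 = 1" "c x \<noteq> 0"
proof -
  show 1: "continuous_on UNIV c" "norm (c x) = 1" "c (x + y) = c x * c y" for x y
    using assms by (auto simp: characters_def)
  show nz: "c x \<noteq> 0" for x using 1(2)[of x] by auto
  show "c 0 = 1" using 1(3)[of 0 0] nz[of 0] by simp
qed

context zd_action
begin

text \<open>A character that is trivial on an open subgroup \<open>H\<close> avoiding x is constant
  on the cosets of \<open>H\<close>, hence continuous.\<close>

lemma characters_separate:
  assumes "(x::'a) \<noteq> 0" obtains c where "c \<in> characters" "c x \<noteq> 1"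
proof -
  obtain H where H: "opsub H" "H \<subseteq> - {x}"
    using opsub_basis[OF comp zd, of "- {x}"] assms by auto
  have sH: "subgrp H" "open H" using H by (auto simp: opsub_def)
  obtain c where c: "partial_char UNIV c" "\<And>h. h \<in> H \<Longrightarrow> c h = 1" "c x \<noteq> 1"
    using ex_char_nontrivial[OF sH(1) finite_cosets[OF H(1)], of x] H(2) by blast
  have hom: "c (a + b) = c a * c b" for a b using c(1) by (simp add: partial_char_def)
  have "open (c -` B)" for B
  proof (subst open_subopen, intro ballI)
    fix y assume y: "y \<in> c -` B"
    have "coset H y \<subseteq> c -` B"
    proof
      fix u assume "u \<in> coset H y"
      hence "c (u - y) = 1" using c(2) by (simp add: coset_def)
      hence "c u = c y" using hom[of "u - y" y] by simp
      thus "u \<in> c -` B" using y by simp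
    qed
    moreover have "y \<in> coset H y" using subgrpD(1)[OF sH(1)] by (simp add: coset_def)
    ultimately show "\<exists>T. open T \<and> y \<in> T \<and> T \<subseteq> c -` B" using open_coset[OF sH(2)] by blast
  qed
  hence "continuous_on UNIV c" by (simp add: continuous_on_open_vimage)
  hence "c \<in> characters" using c(1) by (simp add: characters_def partial_char_def)
  thus ?thesis using that c(3) by blast
qed

text \<open>An open subgroup on which the real part of c is positive is mapped to a subgroup of the
  circle inside a half plane.\<close>

lemma character_trivial_on_opsub:
  fixes c :: "'a \<Rightarrow> complex"
  assumes "c \<in> characters" obtains H where "opsub H" "\<And>h. h \<in> H \<Longrightarrow> c h = 1"
proof -
  note c = character_simps[OF assms]
  have "open ((\<lambda>x. Re (c x)) -` {0<..})" by (intro open_vimage continuous_intros c)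
  then obtain H where H: "opsub H" "H \<subseteq> (\<lambda>x. Re (c x)) -` {0<..}"
    using opsub_basis[OF comp zd, of "(\<lambda>x. Re (c x)) -` {0<..}"] c(4) by auto
  have sH: "subgrp H" using H by (simp add: opsub_def)
  have "c h = 1" if "h \<in> H" for h
  proof (rule powers_in_half_plane[OF c(2)])
    fix k
    have "partial_char UNIV c" using c by (simp add: partial_char_def subgrp_def)
    hence "c (nsum h k) = c h ^ k" by (rule partial_char_nsum) simp
    moreover have "nsum h k \<in> H" by (rule nsum_in[OF sH that])
    ultimately show "Re (c h ^ k) > 0" using H(2) by (metis greaterThan_iff subsetD vimageD)
  qed
  thus ?thesis using that H(1) by blast
qed

text \<open>\<open>U\<close> is an open subgroup on which finitely many generators of the dual
  module are trivial. The characters that are trivial along the orbit of x form a submodule; if the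
  orbit stays in \<open>U\<close>, it contains the generators, hence everything, and characters
  separate points.\<close>

lemma noetherian_imp_expansive:
  assumes "noetherian_action \<alpha>"
  obtains U where "opsub U" "\<And>x. (\<And>v. \<alpha> v x \<in> U) \<Longrightarrow> x = 0"
proof -
  have sub: "dual_submodule \<alpha> characters"
    unfolding dual_submodule_def
  proof (intro conjI ballI allI)
    fix c d :: "'a \<Rightarrow> complex" and n :: "int^'d" assume c: "c \<in> characters" and d: "d \<in> characters"
    show "(\<lambda>x. c x * d x) \<in> characters"
      using character_simps[OF c] character_simps[OF d]
      by (auto simp: characters_def norm_mult intro!: continuous_intros)
    show "(\<lambda>x. inverse (c x)) \<in> characters"
      using character_simps[OF c] by (auto simp: characters_def norm_inverse intro!: continuous_intros)
    have "continuous_on UNIV (c \<circ> \<alpha> n)"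
      using character_simps(1)[OF c] act_cont by (metis continuous_on_compose continuous_on_subset subset_UNIV)
    thus "c \<circ> \<alpha> n \<in> characters" using character_simps[OF c] by (simp add: characters_def act_plus)
  qed (auto simp: characters_def)
  then obtain S where S: "finite S" "S \<subseteq> characters" "dual_span \<alpha> S = characters"
    using assms unfolding noetherian_action_def by metis
  have "\<exists>H. opsub H \<and> (\<forall>h\<in>H. c h = 1)" if "c \<in> S" for c
    using character_trivial_on_opsub S(2) that by (metis subsetD)
  then obtain H where H: "\<And>c. c \<in> S \<Longrightarrow> opsub (H c)" "\<And>c h. c \<in> S \<Longrightarrow> h \<in> H c \<Longrightarrow> c h = 1" by metis
  define U where "U = (\<Inter>c\<in>S. H c)"
  have "opsub U" unfolding opsub_def
  proof
    show "open U" unfolding U_def using S(1) H(1) by (auto simp: opsub_def)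
    show "subgrp U" unfolding U_def using H(1) by (auto simp: opsub_def subgrp_def)
  qed
  moreover have "x = 0" if x: "\<And>v. \<alpha> v x \<in> U" for x
  proof (rule ccontr)
    assume "x \<noteq> 0"
    define N where "N = {c \<in> characters. \<forall>v. c (\<alpha> v x) = (1::complex)}"
    have "dual_submodule \<alpha> N"
      using sub unfolding dual_submodule_def N_def by (auto simp flip: act_add)
    moreover have "S \<subseteq> N" using S(2) H(2) x unfolding N_def U_def by blast
    ultimately have "characters \<subseteq> N" using S(3) unfolding dual_span_def by blast
    moreover obtain c where "c \<in> characters" "c x \<noteq> 1" using characters_separate[OF \<open>x \<noteq> 0\<close>] by blast
    moreover have "c (\<alpha> 0 x) = c x" by simp
    ultimately show False unfolding N_def by (metis (mono_tags, lifting) mem_Collect_eq subsetD)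
  qed
  ultimately show ?thesis using that by blast
qed

end

section \<open>Fixed points of subgroups of prime index\<close>

lemma funpow_period_mod:
  assumes "(f ^^ q) x = x" shows "(f ^^ (i + q * j)) x = (f ^^ i) x"
proof -
  have "(f ^^ (q * j)) x = x" by (induction j) (simp_all add: funpow_add assms)
  thus ?thesis by (simp add: funpow_add)
qed

text \<open>Every orbit has exactly q elements, because a shorter period would be prime to q and
  produce a fixed point. As the q-th iterate is the identity on \<open>S\<close>, iteration can be
  undone, so orbits are equal or disjoint.\<close>

lemma prime_period_dvd_card:
  fixes f :: "'b \<Rightarrow> 'b" and q :: nat
  assumes q: "prime q" and S: "finite S" and inv: "\<And>x. x \<in> S \<Longrightarrow> f x \<in> S"
    and per: "\<And>x. x \<in> S \<Longrightarrow> (f ^^ q) x = x" and nofix: "\<And>x. x \<in> S \<Longrightarrow> f x \<noteq> x"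
  shows "q dvd card S"
proof -
  define orb where "orb = (\<lambda>x. range (\<lambda>i. (f ^^ i) x))"
  have q0: "q > 0" using q by (rule prime_gt_0_nat)
  have inS: "(f ^^ i) x \<in> S" if "x \<in> S" for i x using that by (induction i) (auto intro: inv)
  have pm: "(f ^^ (i + q * j)) x = (f ^^ i) x" if "x \<in> S" for i j x
    by (rule funpow_period_mod[OF per[OF that]])
  have return: "(f ^^ (q * i - i)) ((f ^^ i) x) = x" if "x \<in> S" for i x
  proof -
    have "(f ^^ (q * i - i)) ((f ^^ i) x) = (f ^^ (q * i - i + i)) x" by (simp only: funpow_add comp_apply)
    also have "q * i - i + i = 0 + q * i" using q0 by simp
    also have "(f ^^ (0 + q * i)) x = x" by (subst pm[OF that]) simp
    finally show ?thesis .
  qed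
  have sub: "orb ((f ^^ i) x) \<subseteq> orb x" for i x
    unfolding orb_def by (auto simp flip: funpow_add[unfolded comp_def, THEN fun_cong])
  have orb_eq: "orb ((f ^^ i) x) = orb x" if "x \<in> S" for i x
    using sub[of i x] sub[of "q * i - i" "(f ^^ i) x"] unfolding return[OF that] by blast
  have card_orb: "card (orb x) = q" if x: "x \<in> S" for x
  proof -
    have "orb x = (\<lambda>i. (f ^^ i) x) ` {..<q}" unfolding orb_def
    proof (intro equalityI subsetI)
      fix y assume "y \<in> range (\<lambda>i. (f ^^ i) x)"
      then obtain i where "y = (f ^^ i) x" by blast
      also have "i = i mod q + q * (i div q)" by simp
      also have "(f ^^ (i mod q + q * (i div q))) x = (f ^^ (i mod q)) x" by (rule pm[OF x])
      finally show "y \<in> (\<lambda>i. (f ^^ i) x) ` {..<q}" using q0 by auto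
    qed auto
    moreover have "inj_on (\<lambda>i. (f ^^ i) x) {..<q}"
    proof -
      have False if ij: "i < j" "j < q" "(f ^^ i) x = (f ^^ j) x" for i j
      proof -
        have "(f ^^ (j - i)) ((f ^^ i) x) = (f ^^ (j - i + i)) x" by (simp only: funpow_add comp_apply)
        also have "j - i + i = j" using ij by simp
        finally have "(f ^^ (j - i)) ((f ^^ i) x) = (f ^^ i) x" using ij by simp
        moreover define y where "y = (f ^^ i) x"
        ultimately have y: "(f ^^ (j - i)) y = y" "y \<in> S" using inS[OF x] by simp_all
        have "coprime (j - i) q" using ij q by (meson coprime_commute diff_less_mono2 dvd_imp_le less_imp_diff_less not_less prime_imp_coprime zero_less_diff)
        \<comment> \<open>Both j - i and q are periods of y, hence so is 1.\<close>
        then obtain u v where uv: "(j - i) * u = q * v + 1"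
          using coprime_bezout_strong[of "j - i" q] q prime_gt_1_nat[OF q] by (metis nat_neq_iff)
        have "(f ^^ ((j - i) * u)) y = y" using funpow_period_mod[OF y(1), of 0 u] by simp
        moreover have "(f ^^ (1 + q * v)) y = f y" using pm[OF y(2), of 1 v] by simp
        ultimately show False using uv nofix[OF y(2)] by (simp add: add.commute)
      qed
      thus ?thesis by (intro inj_onI) (metis lessThan_iff nat_neq_iff)
    qed
    ultimately show ?thesis by (simp add: card_image)
  qed
  have U: "\<Union>(orb ` S) = S"
  proof
    show "\<Union>(orb ` S) \<subseteq> S" using inS by (auto simp: orb_def)
    show "S \<subseteq> \<Union>(orb ` S)" unfolding orb_def by (auto intro!: bexI range_eqI[of _ _ 0])
  qed
  have "q dvd card (\<Union>(orb ` S))"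
  proof (rule dvd_partition)
    show "finite (\<Union>(orb ` S))" using U S by simp
    show "\<forall>c\<in>orb ` S. q dvd card c" using card_orb by auto
    show "\<forall>c1\<in>orb ` S. \<forall>c2\<in>orb ` S. c1 \<noteq> c2 \<longrightarrow> c1 \<inter> c2 = {}"
    proof (intro ballI impI)
      fix c1 c2 assume c: "c1 \<in> orb ` S" "c2 \<in> orb ` S" "c1 \<noteq> c2"
      then obtain x y where xy: "x \<in> S" "y \<in> S" "c1 = orb x" "c2 = orb y" by blast
      have "orb x = orb y" if "(f ^^ i) x = (f ^^ j) y" for i j
        using orb_eq[OF xy(1), of i] orb_eq[OF xy(2), of j] that by simp
      thus "c1 \<inter> c2 = {}" using c(3) xy unfolding orb_def by fastforce
    qed
  qed
  thus ?thesis using U by simp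
qed

lemma nsum_zero [simp]: "nsum 0 i = 0"
  by (induction i) (simp_all add: nsum_Suc)

lemma nsum_coprime_in:
  assumes H: "subgrp H" and "nsum y a \<in> H" "nsum y b \<in> H" "coprime a b" "b \<noteq> 1"
  shows "y \<in> H"
proof -
  obtain u v where uv: "a * u = b * v + 1"
    using coprime_bezout_strong[of a b] assms(4,5) by (metis nat_neq_iff)
  have "nsum y (a * u) \<in> H" "nsum y (b * v) \<in> H" unfolding nsum_mult using nsum_in[OF H] assms(2,3) by blast+
  moreover have "nsum y (a * u) = nsum y (b * v) + y" unfolding uv nsum_add by (simp add: nsum_Suc)
  ultimately show ?thesis using subgrpD(2)[OF H, of "nsum y (a * u)" "nsum y (b * v)"] by simp
qed

text \<open>Among the subgroups of p-power order a maximal one is everything: a further element w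
  has order p modulo it, and adjoining w multiplies the order by p.\<close>

lemma card_elementary_abelian:
  fixes S :: "'a::ab_group_add set"
  assumes p: "prime p" and S: "subgrp S" "finite S" and tor: "\<And>w. w \<in> S \<Longrightarrow> nsum w p = 0"
  shows "\<exists>k. card S = p ^ k"
proof -
  define \<F> where "\<F> = {K. subgrp K \<and> K \<subseteq> S \<and> (\<exists>k. card K = p ^ k)}"
  have "{0} \<in> \<F>" using subgrpD(1)[OF S(1)] by (auto simp: \<F>_def subgrp_def intro: exI[of _ 0])
  moreover have "finite \<F>" by (rule finite_subset[of _ "Pow S"]) (use S in \<open>auto simp: \<F>_def\<close>)
  ultimately obtain K where K: "K \<in> \<F>" "\<And>K'. K' \<in> \<F> \<Longrightarrow> K \<subseteq> K' \<Longrightarrow> K' = K"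
    using finite_has_maximal[of \<F>] by (metis empty_iff)
  have sK: "subgrp K" "K \<subseteq> S" "finite K" using K(1) S(2) by (auto simp: \<F>_def intro: finite_subset)
  have "K = S"
  proof (rule ccontr)
    assume "K \<noteq> S"
    then obtain w where w: "w \<in> S" "w \<notin> K" using sK(2) by blast
    define K' where "K' = (\<lambda>(s, i). s + nsum w i) ` (K \<times> {..<p})"
    have K'_iff: "x \<in> K' \<longleftrightarrow> (\<exists>s\<in>K. \<exists>i. x = s + nsum w i)" for x
    proof
      assume "\<exists>s\<in>K. \<exists>i. x = s + nsum w i"
      then obtain s i where s: "s \<in> K" "x = s + nsum w i" by blast
      have "nsum w i = nsum w (p * (i div p) + i mod p)" by simp
      also have "\<dots> = nsum w (i mod p)" by (simp only: nsum_add nsum_mult tor[OF w(1)] nsum_zero add_0)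
      finally show "x \<in> K'" using s prime_gt_0_nat[OF p] by (auto simp: K'_def)
    qed (auto simp: K'_def)
    have inj: "inj_on (\<lambda>(s, i). s + nsum w i) (K \<times> {..<p})"
    proof -
      have less: False if "s \<in> K" "s' \<in> K" "i < j" "j < p" "s + nsum w i = s' + nsum w j" for s s' i j
      proof -
        have "nsum w (j - i) = s - s'" using that by (simp add: nsum_diff algebra_simps)
        hence "nsum w (j - i) \<in> K" using that subgrpD(2)[OF sK(1)] by simp
        moreover have "nsum w p \<in> K" using tor[OF w(1)] subgrpD(1)[OF sK(1)] by simp
        moreover have "\<not> p dvd j - i" using that by (auto dest: dvd_imp_le)
        hence "coprime (j - i) p" using p by (metis coprime_commute prime_imp_coprime)
        ultimately have "w \<in> K" using nsum_coprime_in[OF sK(1)] prime_gt_1_nat[OF p] by (metis nat_neq_iff)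
        thus False using w by blast
      qed
      show ?thesis
      proof (rule inj_onI)
        fix a b assume ab: "a \<in> K \<times> {..<p}" "b \<in> K \<times> {..<p}"
          "(case a of (s, i) \<Rightarrow> s + nsum w i) = (case b of (s, i) \<Rightarrow> s + nsum w i)"
        obtain s i s' j where "a = (s, i)" "b = (s', j)" by fastforce
        note a = this ab
        have "i = j" using less[of s s' i j] less[of s' s j i] a by (metis lessThan_iff mem_Sigma_iff nat_neq_iff old.prod.case)
        thus "a = b" using a by simp
      qed
    qed
    have "subgrp K'" unfolding subgrp_def
    proof (intro conjI ballI)
      show "0 \<in> K'" unfolding K'_iff using subgrpD(1)[OF sK(1)] by (intro bexI[of _ 0] exI[of _ 0]) auto
      fix a b assume "a \<in> K'" "b \<in> K'"
      then obtain s i s' j where ab: "s \<in> K" "s' \<in> K" "a = s + nsum w i" "b = s' + nsum w j" unfolding K'_iff by blast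
      have "j \<le> p * j" using prime_gt_0_nat[OF p] by simp
      hence "nsum w (p * j - j) = - nsum w j"
        by (simp only: nsum_diff nsum_mult tor[OF w(1)] nsum_zero diff_0)
      hence "a - b = (s - s') + nsum w (i + (p * j - j))" unfolding nsum_add ab by simp
      thus "a - b \<in> K'" unfolding K'_iff using ab subgrpD(2)[OF sK(1)] by blast
    qed
    moreover have "K' \<subseteq> S" using w(1) sK(2) S(1) nsum_in[OF S(1) w(1)] subgrpD(4)[OF S(1)] by (auto simp: K'_def)
    moreover obtain k where "card K = p ^ k" using K(1) by (auto simp: \<F>_def)
    hence "card K' = p ^ Suc k" unfolding K'_def using card_image[OF inj] by (simp add: card_cartesian_product mult.commute)
    ultimately have "K' \<in> \<F>" unfolding \<F>_def by blast
    moreover have "K \<subseteq> K'" unfolding K'_iff subset_iff by (metis add.right_neutral nsum_0)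
    moreover have "w \<in> K'" unfolding K'_iff using subgrpD(1)[OF sK(1)]
      by (intro bexI[of _ 0] exI[of _ 1]) (auto simp: nsum_Suc)
    ultimately show False using K(2) w(2) by blast
  qed
  thus ?thesis using K(1) by (auto simp: \<F>_def)
qed

lemma ex_prime_order_multiple:
  assumes z: "z \<noteq> 0" and N: "N > 0" "nsum z N = 0"
  obtains p j where "prime p" "p \<le> N" "nsum z j \<noteq> 0" "nsum (nsum z j) p = 0"
proof -
  let ?P = "\<lambda>n. n > 0 \<and> nsum z n = 0"
  define n where "n = (LEAST n. ?P n)"
  have n: "?P n" "n \<le> N" unfolding n_def using N by (auto intro: LeastI2 Least_le)
  have least: "\<not> ?P i" if "i < n" for i using that unfolding n_def by (rule not_less_Least)
  have "n \<noteq> 1" using n(1) z by (auto simp: nsum_Suc)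
  then obtain p where p: "prime p" "p dvd n" using prime_factor_nat by blast
  then obtain j where j: "n = p * j" by blast
  have "j < n" "j > 0" using j n(1) prime_gt_1_nat[OF p(1)] by auto
  hence "nsum z j \<noteq> 0" using least by blast
  moreover have "nsum (nsum z j) p = 0" using n(1) j by (simp add: mult.commute flip: nsum_mult)
  moreover have "p \<le> N" using p(2) n dvd_imp_le[of p n] by simp
  ultimately show ?thesis using that p(1) by blast
qed

context zd_action
begin

text \<open>By pigeonhole modulo \<open>U\<close>, every point has a multiple in \<open>U\<close>
  with a positive factor at most \<open>idx UNIV U\<close>. The factorial serves all points of the
  orbit of x at once, so expansiveness applies.\<close>

lemma expansive_torsion:
  assumes U: "opsub U" and expansive: "\<And>x. (\<And>v. \<alpha> v x \<in> U) \<Longrightarrow> x = 0"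
  shows "nsum (x :: 'a) (fact (idx UNIV U)) = 0"
proof (rule expansive)
  fix v
  have sU: "subgrp U" using U by (simp add: opsub_def)
  define y where "y = \<alpha> v x"
  let ?D = "idx UNIV U"
  have "\<not> inj_on (\<lambda>i. coset U (nsum y i)) {..?D}"
  proof
    assume inj: "inj_on (\<lambda>i. coset U (nsum y i)) {..?D}"
    have "card ((\<lambda>i. coset U (nsum y i)) ` {..?D}) \<le> ?D" unfolding idx_def
      by (rule card_mono[OF finite_cosets[OF U]]) auto
    thus False using card_image[OF inj] by simp
  qed
  then obtain i j where ij: "i < j" "j \<le> ?D" "coset U (nsum y i) = coset U (nsum y j)"
    unfolding inj_on_def by (metis atMost_iff nat_neq_iff)
  hence "nsum y (j - i) \<in> U" using coset_eq_iff[OF sU] nsum_diff[of i j y] by (metis less_imp_le)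
  moreover have "(j - i) dvd fact ?D" using ij by (intro dvd_fact) auto
  then obtain k :: nat where "fact ?D = (j - i) * k" by blast
  ultimately have "nsum y (fact ?D) \<in> U" using nsum_in[OF sU] by (simp add: nsum_mult)
  thus "\<alpha> v (nsum x (fact ?D)) \<in> U" by (simp add: y_def nsum_hom[of "\<alpha> v", OF act_plus])
qed

end

section \<open>Subgroups of prime index in Z^d\<close>

lemma cosets_Zd_eq: "cosets_Zd L = range (coset L)"
  unfolding cosets_Zd_def coset_def
  by (intro arg_cong[where f=range] ext) (force simp: image_iff algebra_simps)

lemma subgroup_Zd_eq: "subgroup_Zd L \<longleftrightarrow> subgrp L"
proof
  assume "subgroup_Zd L"
  thus "subgrp L" unfolding subgroup_Zd_def subgrp_def by (metis add_uminus_conv_diff)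
next
  assume L: "subgrp L"
  show "subgroup_Zd L" unfolding subgroup_Zd_def using subgrpD(1,3,4)[OF L] by blast
qed

text \<open>The subgroup \<open>K\<close> generated by \<open>L\<close> and t is strictly larger
  than \<open>L\<close>, so by primality of the index it is everything, and t has order q modulo
  \<open>L\<close>.\<close>

lemma prime_index_generated:
  fixes L :: "(int^'d) set"
  assumes L: "subgrp L" and q: "prime q" "idx UNIV L = q" and t: "t \<notin> L"
  shows "int q *s t \<in> L" "\<exists>i. n - int i *s t \<in> L"
proof -
  have mult: "nsum t i = int i *s t" for i
    by (induction i) (simp_all add: nsum_Suc vector_sadd_rdistrib vec_eq_iff algebra_simps)
  have fin: "finite (range (coset L))" using q prime_gt_0_nat[OF q(1)] by (metis card.infinite idx_def less_irrefl)
  obtain j where j: "j > 0" "nsum t j \<in> L" "\<And>i. 0 < i \<Longrightarrow> i < j \<Longrightarrow> nsum t i \<notin> L"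
    using ex_minimal_nsum[OF L fin] by metis
  define K where "K = {x. \<exists>i. x - nsum t i \<in> L}"
  have red: "\<exists>i<j. x - nsum t i \<in> L" if "x \<in> K" for x
  proof -
    obtain i where i: "x - nsum t i \<in> L" using \<open>x \<in> K\<close> by (auto simp: K_def)
    have "nsum t i = nsum t (j * (i div j)) + nsum t (i mod j)" by (simp flip: nsum_add)
    moreover have "nsum t (j * (i div j)) \<in> L" unfolding nsum_mult by (rule nsum_in[OF L j(2)])
    ultimately have "x - nsum t (i mod j) \<in> L"
      using subgrpD(4)[OF L i, of "nsum t (j * (i div j))"] by (simp add: algebra_simps)
    thus ?thesis using j(1) by (intro exI[of _ "i mod j"]) simp
  qed
  have sK: "subgrp K" unfolding subgrp_def
  proof (intro conjI ballI)
    show "0 \<in> K" unfolding K_def using subgrpD(1)[OF L] by (auto intro: exI[of _ 0])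
    fix a b assume "a \<in> K" "b \<in> K"
    then obtain i i' where ii: "a - nsum t i \<in> L" "b - nsum t i' \<in> L" by (auto simp: K_def)
    have jL: "nsum t (j * i') \<in> L" unfolding nsum_mult by (rule nsum_in[OF L j(2)])
    have "i' \<le> j * i'" using j(1) by simp
    hence "nsum t (i + (j * i' - i')) = nsum t i + (nsum t (j * i') - nsum t i')"
      by (simp only: nsum_add nsum_diff)
    hence e: "(a - b) - nsum t (i + (j * i' - i')) = (a - nsum t i) - (b - nsum t i') - nsum t (j * i')"
      by (simp only:) (simp add: algebra_simps)
    have "(a - b) - nsum t (i + (j * i' - i')) \<in> L"
      unfolding e by (intro subgrpD(2)[OF L] ii jL)
    thus "a - b \<in> K" by (auto simp: K_def)
  qed
  have LK: "L \<subseteq> K" by (auto simp: K_def intro: exI[of _ 0])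
  have tK: "t \<in> K" using subgrpD(1)[OF L] by (auto simp: K_def nsum_Suc intro!: exI[of _ 1])
  have tower: "q = idx UNIV K * idx K L" unfolding q(2)[symmetric]
    by (rule idx_tower) (use L sK LK in \<open>auto simp: subgrp_def[of UNIV]\<close>)
  have finK: "finite (coset L ` K)" using fin by (rule rev_finite_subset) auto
  have "card {0, t} \<le> idx K L"
  proof (rule card_le_idx(2)[OF L finK])
    show "{0, t} \<subseteq> K" using tK subgrpD(1)[OF sK] by simp
    show "x = y" if "x \<in> {0, t}" "y \<in> {0, t}" "x - y \<in> L" for x y
      using that t subgrpD(3)[OF L, of "- t"] by auto
  qed
  moreover have "t \<noteq> 0" using t subgrpD(1)[OF L] by auto
  ultimately have "idx K L \<noteq> 1" by simp
  moreover have "idx K L dvd q" using tower by simp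
  ultimately have KL: "idx K L = q" using q(1) by (metis prime_nat_iff)
  hence "idx UNIV K = 1" using tower prime_gt_0_nat[OF q(1)] by simp
  then obtain c where "range (coset K) = {c}" unfolding idx_def by (auto simp: card_1_singleton_iff)
  hence "coset K x = coset K 0" for x by (metis rangeI singletonD)
  hence UK: "x \<in> K" for x using coset_eq_iff[OF sK, of x 0] by simp
  have inj: "inj_on (\<lambda>i. coset L (nsum t i)) {..<j}"
  proof -
    have "nsum t i - nsum t i' \<notin> L" if "i' < i" "i < j" for i i'
      using j(3)[of "i - i'"] that nsum_diff[of i' i t] by simp
    thus ?thesis unfolding inj_on_def coset_eq_iff[OF L] by (metis lessThan_iff nat_neq_iff subgrpD(5)[OF L])
  qed
  have "coset L ` K = (\<lambda>i. coset L (nsum t i)) ` {..<j}"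
  proof (intro equalityI subsetI)
    fix c assume "c \<in> coset L ` K"
    then obtain x where x: "x \<in> K" "c = coset L x" by blast
    then obtain i where "i < j" "x - nsum t i \<in> L" using red by blast
    thus "c \<in> (\<lambda>i. coset L (nsum t i)) ` {..<j}" using x coset_eq_iff[OF L] by blast
  qed (use UK in auto)
  hence "q = j" unfolding KL[symmetric] idx_def using card_image[OF inj] by simp
  thus "int q *s t \<in> L" using j(2) by (simp add: mult)
  show "\<exists>i. n - int i *s t \<in> L" using UK[of n] by (auto simp: K_def mult)
qed

text \<open>Pigeonhole in the plane of two coordinates a, b: with s the integer part of sqrt q, the
  (s + 1)^2 > q vectors with entries from 0 to s cannot all be distinct modulo
  \<open>L\<close>.\<close>

lemma ex_short_vector:
  fixes L :: "(int^'d) set"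
  assumes d: "CARD('d) \<ge> 2" and L: "subgrp L" and q: "idx UNIV L = q" "q > 0"
  obtains n s where "n \<in> L" "n \<noteq> 0" "n \<in> cube s" "real s \<le> sqrt (real q)"
proof -
  have "\<exists>a b :: 'd. a \<noteq> b"
  proof (rule ccontr)
    assume "\<not> (\<exists>a b :: 'd. a \<noteq> b)"
    hence "(UNIV :: 'd set) = {undefined}" by auto
    hence "CARD('d) = 1" by (metis card_1_singleton_iff One_nat_def)
    thus False using d by simp
  qed
  then obtain a b :: 'd where ab: "a \<noteq> b" by blast
  define s where "s = nat \<lfloor>sqrt (real q)\<rfloor>"
  define v :: "nat \<times> nat \<Rightarrow> int^'d" where "v = (\<lambda>(i, j). \<chi> k. if k = a then int i else if k = b then int j else 0)"
  have fin: "finite (range (coset L))" using q by (metis card.infinite idx_def less_irrefl)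
  have s: "real s \<le> sqrt (real q)" "sqrt (real q) < real s + 1" unfolding s_def by (simp, linarith)
  have "real q = sqrt (real q) * sqrt (real q)" by simp
  also have "\<dots> < (real s + 1) * (real s + 1)" using s(2) by (intro mult_strict_mono) auto
  finally have "real q < real ((s + 1) * (s + 1))" by (simp add: algebra_simps)
  hence qs: "q < (s + 1) * (s + 1)" by (simp only: of_nat_less_iff)
  have "\<not> inj_on (\<lambda>x. coset L (v x)) ({..s} \<times> {..s})"
  proof
    assume inj: "inj_on (\<lambda>x. coset L (v x)) ({..s} \<times> {..s})"
    have "card ((\<lambda>x. coset L (v x)) ` ({..s} \<times> {..s})) \<le> q" unfolding q(1)[symmetric] idx_def
      by (rule card_mono[OF fin]) auto
    thus False using card_image[OF inj] qs by (simp add: card_cartesian_product)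
  qed
  then obtain x y where xy: "x \<in> {..s} \<times> {..s}" "y \<in> {..s} \<times> {..s}" "x \<noteq> y" "coset L (v x) = coset L (v y)"
    unfolding inj_on_def by blast
  obtain i j i' j' where ij: "x = (i, j)" "y = (i', j')" by fastforce
  have "v x - v y \<in> L" using xy(4) coset_eq_iff[OF L] by blast
  moreover have "v x - v y \<noteq> 0"
  proof
    assume "v x - v y = 0"
    hence "(v x - v y) $ a = 0" "(v x - v y) $ b = 0" by simp_all
    thus False using xy(3) ab by (auto simp: v_def ij)
  qed
  moreover have "v x - v y \<in> cube s" using xy(1,2) unfolding cube_def v_def ij by auto
  ultimately show ?thesis using that s(1) by blast
qed

context zd_action
begin

definition fixed_by :: "(int^'d) set \<Rightarrow> 'a set" where
  "fixed_by L = {x. \<forall>n\<in>L. \<alpha> n x = x}"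

lemma fixed_by_subgrp: "subgrp (fixed_by L)"
  by (simp add: subgrp_def fixed_by_def act_diff)

lemma fixed_by_act: "x \<in> fixed_by L \<Longrightarrow> \<alpha> n x \<in> fixed_by L"
  by (simp add: fixed_by_def act_commute[of _ n])

text \<open>If \<open>fixed_by L\<close> is larger than the set of globally fixed points, then \<open>\<alpha> t\<close> with \<open>t \<notin> L\<close> permutes
  a nontrivial finite elementary abelian \<open>p\<close>-group in orbits of length \<open>q\<close>, apart from \<open>0\<close>.\<close>
lemma prime_index_extra_fixed_points:
  assumes L: "subgrp L" and q: "prime q" "idx UNIV L = q" and fin: "finite (fixed_by L)"
    and E: "E > 0" "\<And>x :: 'a. nsum x E = 0" and qE: "coprime q E"
    and ne: "fixed_by L \<noteq> fixed_by UNIV"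
  obtains p k where "prime p" "p \<le> E" "k > 0" "q dvd p ^ k - 1" "p ^ k \<le> card (fixed_by L)"
proof -
  define G where "G = fixed_by L"
  have sG: "subgrp G" unfolding G_def by (rule fixed_by_subgrp)
  have "fixed_by UNIV \<subseteq> G" by (auto simp: fixed_by_def G_def)
  then obtain x where x: "x \<in> G" "x \<notin> fixed_by UNIV" using ne by (auto simp: G_def)
  then obtain t where t: "\<alpha> t x \<noteq> x" by (auto simp: fixed_by_def)
  hence tL: "t \<notin> L" using x(1) by (auto simp: G_def fixed_by_def)
  define f where "f = \<alpha> t"
  have f_add: "f (a + b) = f a + f b" for a b by (simp add: f_def act_plus)
  have f_diff: "f (a - b) = f a - f b" for a b by (simp add: f_def act_diff)
  have f0 [simp]: "f 0 = 0" by (simp add: f_def)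
  have fG: "f y \<in> G" if "y \<in> G" for y using that unfolding f_def G_def by (rule fixed_by_act)
  have f_pow: "(f ^^ i) y = \<alpha> (int i *s t) y" for i y unfolding f_def by (rule act_funpow)
  have per: "(f ^^ q) y = y" if "y \<in> G" for y
    unfolding f_pow using that prime_index_generated(1)[OF L q tL] by (auto simp: G_def fixed_by_def)
  define d where "d = (\<lambda>y. f y - y)"
  have d_diff: "d (a - b) = d a - d b" for a b by (simp add: d_def f_diff)
  have d_add: "d (a + b) = d a + d b" for a b by (simp add: d_def f_add)
  have dG: "d y \<in> G" if "y \<in> G" for y unfolding d_def using fG[OF that] that subgrpD(2)[OF sG] by blast
  \<comment> \<open>The image of d = f - 1 contains no nonzero fixed point: if z = d w is fixed, the
    i-th iterate of f sends w to w + i z, so q z = 0, while E z = 0 with \<open>E\<close> prime to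
    q.\<close>
  have d_inj: "z = 0" if z: "z \<in> d ` G" "f z = z" for z
  proof -
    obtain w where w: "w \<in> G" "z = d w" using z(1) by blast
    have "(f ^^ i) w = w + nsum z i" for i
    proof (induction i)
      case (Suc i)
      have "f (nsum z i) = nsum z i" using nsum_hom[of f z i] f_add z(2) by simp
      moreover have "f w = w + z" using w(2) by (simp add: d_def)
      ultimately show ?case using Suc by (simp add: f_add nsum_Suc add.assoc)
    qed simp
    hence "nsum z q = 0" using per[OF w(1)] by (metis add_cancel_right_right)
    moreover have "nsum z E = 0" by (rule E(2))
    moreover have "coprime E q" using qE by (simp add: coprime_commute)
    moreover have "q \<noteq> 1" using q(1) by auto
    moreover have "subgrp ({0} :: 'a set)" by (simp add: subgrp_def)
    ultimately show ?thesis using nsum_coprime_in[of "{0}" z E q] by simp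
  qed
  have dx: "d x \<noteq> 0" using t by (simp add: d_def f_def)
  obtain p j where p: "prime p" "p \<le> E" "nsum (d x) j \<noteq> 0" "nsum (nsum (d x) j) p = 0"
    using ex_prime_order_multiple[OF dx E] by blast
  \<comment> \<open>The p-torsion of the image of d is elementary abelian and invariant under f, and
    it is nonzero since p was obtained from the order of d x.\<close>
  define S where "S = {w \<in> d ` G. nsum w p = 0}"
  have nsum_diff_arg: "nsum (a - b) i = nsum a i - nsum b i" for a b :: 'a and i
    by (induction i) (simp_all add: nsum_Suc algebra_simps)
  have sdG: "subgrp (d ` G)" unfolding subgrp_def
  proof (intro conjI ballI)
    show "0 \<in> d ` G" using subgrpD(1)[OF sG] by (intro image_eqI[of _ _ 0]) (simp_all add: d_def)
    fix a b assume "a \<in> d ` G" "b \<in> d ` G"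
    then obtain u v where uv: "a = d u" "b = d v" "u \<in> G" "v \<in> G" by blast
    have "a - b = d (u - v)" by (simp add: uv d_diff)
    thus "a - b \<in> d ` G" using subgrpD(2)[OF sG uv(3,4)] by blast
  qed
  have sS: "subgrp S" using subgrpD(1,2)[OF sdG] unfolding subgrp_def S_def by (simp add: nsum_diff_arg)
  have SG: "S \<subseteq> G" using dG by (auto simp: S_def)
  have finS: "finite S" using finite_subset[OF SG] fin by (simp add: G_def)
  obtain k where k: "card S = p ^ k" using card_elementary_abelian[OF p(1) sS finS] by (auto simp: S_def)
  have fS: "f y \<in> S" if y: "y \<in> S" for y
  proof -
    obtain w where w: "w \<in> G" "y = d w" "nsum y p = 0" using y by (auto simp: S_def)
    have "f y = d (f w)" by (simp add: w(2) d_def f_diff)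
    moreover have "nsum (f y) p = f (nsum y p)" using nsum_hom[of f y p] f_add by simp
    ultimately show ?thesis using fG[OF w(1)] w(3) by (simp add: S_def)
  qed
  have f_inj0: "y = 0" if "y \<in> G" "f y = 0" for y
  proof -
    have "(f ^^ (q - 1)) (f y) = (f ^^ Suc (q - 1)) y" by (simp only: funpow_Suc_right comp_apply)
    also have "Suc (q - 1) = q" using prime_gt_0_nat[OF q(1)] by simp
    finally have "y = (f ^^ (q - 1)) 0" using per[OF that(1)] that(2) by simp
    moreover have "(f ^^ i) 0 = 0" for i by (induction i) simp_all
    ultimately show ?thesis by simp
  qed
  have "q dvd card (S - {0})"
  proof (rule prime_period_dvd_card[OF q(1), of _ f])
    show "finite (S - {0})" using finS by simp
    show "f y \<in> S - {0}" if "y \<in> S - {0}" for y using fS f_inj0 that SG by blast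
    show "(f ^^ q) y = y" if "y \<in> S - {0}" for y using per that SG by blast
    show "f y \<noteq> y" if "y \<in> S - {0}" for y using d_inj[of y] that by (auto simp: S_def)
  qed
  moreover have "card (S - {0}) = p ^ k - 1" using k finS subgrpD(1)[OF sS] by (simp add: card_Diff_singleton)
  ultimately have "q dvd p ^ k - 1" by simp
  moreover have "k > 0"
  proof (rule gr0I)
    assume "k = 0"
    hence "card S = 1" using k by simp
    moreover have "nsum (d x) j \<in> S" unfolding S_def using nsum_in[OF sdG] x(1) p(4) by blast
    ultimately show False using subgrpD(1)[OF sS] p(3) by (metis card_1_singletonE singletonD)
  qed
  moreover have "p ^ k \<le> card (fixed_by L)" using card_mono[OF _ SG] fin k by (simp add: G_def)
  ultimately show ?thesis using that p(1,2) by blast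
qed

text \<open>\<open>E\<close> and \<open>C\<close> depend on the action and not on \<open>L\<close>,
  so the exceptional primes of all \<open>L\<close> lie in one sparse set.\<close>

lemma fixed_points_exceptional_primes:
  assumes d: "CARD('d) \<ge> 2" and mix: "mixing_action \<alpha>" and noe: "noetherian_action \<alpha>" and ent: "entropy_rank_one \<alpha>"
  obtains E :: nat and C :: real where "E > 0" "C > 0"
    "\<And>L q. subgrp L \<Longrightarrow> prime q \<Longrightarrow> idx UNIV L = q \<Longrightarrow> q > E \<Longrightarrow> fixed_by L \<noteq> fixed_by UNIV \<Longrightarrow>
      \<exists>p k. prime p \<and> p \<le> E \<and> k > 0 \<and> real k \<le> C * sqrt (real q) \<and> q dvd p ^ k - 1"
proof -
  obtain U0 where U0: "opsub U0" "\<And>x. (\<And>v. \<alpha> v x \<in> U0) \<Longrightarrow> x = 0" using noetherian_imp_expansive[OF noe] by blast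
  have surj: "\<And>n. n \<noteq> 0 \<Longrightarrow> surj (\<lambda>x. \<alpha> n x - x)" by (rule mixing_imp_surj[OF mix])
  define e :: "int^'d" where "e = (\<chi> k. 1)"
  have e: "e \<noteq> 0" by (simp add: e_def vec_eq_iff)
  have "top_entropy (\<alpha> e) < \<infinity>" using ent by (simp add: entropy_rank_one_def)
  from idx_cube_le[OF surj e this U0(1)] obtain U M where U: "opsub U" "U \<subseteq> U0"
    and growth: "\<And>R. idx UNIV (window U (cube R)) \<le> idx UNIV U ^ (2 * M * R + 1)" by blast
  have expansive: "\<And>x. (\<And>v. \<alpha> v x \<in> U) \<Longrightarrow> x = 0" using U0(2) U(2) by blast
  define D where "D = idx UNIV U"
  \<comment> \<open>The factorial annihilates the group by \<open>expansive_torsion\<close>; it also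
    bounds the primes p, and q > \<open>E\<close> makes q prime to it.\<close>
  define E where "E = (fact D :: nat)"
  define K where "K = real (D ^ (2 * M))"
  have D1: "D \<ge> 1" unfolding D_def using idx_pos[OF U(1), of 0 UNIV] by simp
  have K1: "K \<ge> 1" using D1 by (simp add: K_def)
  \<comment> \<open>From 2^k \<le> p^k \<le> K^s and s \<le> sqrt q; the summand 1 keeps
    \<open>C\<close> positive when \<open>K\<close> is 1.\<close>
  define C where "C = ln K / ln 2 + 1"
  have C: "C > 0" using K1 by (simp add: C_def add_nonneg_pos)
  have tor: "nsum x E = 0" for x :: 'a unfolding E_def D_def by (rule expansive_torsion[OF U(1) expansive])
  have E0: "E > 0" by (simp add: E_def)
  have main: "\<exists>p k. prime p \<and> p \<le> E \<and> k > 0 \<and> real k \<le> C * sqrt (real q) \<and> q dvd p ^ k - 1"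
    if L: "subgrp L" and q: "prime q" "idx UNIV L = q" "q > E" and ne: "fixed_by L \<noteq> fixed_by UNIV" for L q
  proof -
    obtain n s where n: "n \<in> L" "n \<noteq> 0" "n \<in> cube s" "real s \<le> sqrt (real q)"
      using ex_short_vector[OF d L q(2) prime_gt_0_nat[OF q(1)]] by blast
    note fp = fixed_points_bound[OF surj U(1) expansive growth n(2,3)]
    have sub: "fixed_by L \<subseteq> {x. \<alpha> n x = x}" using n(1) by (auto simp: fixed_by_def)
    have fin: "finite (fixed_by L)" by (rule finite_subset[OF sub fp(1)])
    have "card (fixed_by L) \<le> card {x. \<alpha> n x = x}" by (rule card_mono[OF fp(1) sub])
    hence "card (fixed_by L) \<le> D ^ (2 * M * s)" using fp(2) by (simp add: D_def)
    hence "real (card (fixed_by L)) \<le> real (D ^ (2 * M * s))" by (rule of_nat_mono)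
    also have "\<dots> = K ^ s" by (simp add: K_def power_mult)
    finally have card: "real (card (fixed_by L)) \<le> K ^ s" .
    have "\<not> q dvd E" using q(3) E0 by (auto dest: dvd_imp_le)
    hence "coprime q E" using q(1) by (rule prime_imp_coprime[rotated])
    from prime_index_extra_fixed_points[OF L q(1,2) fin E0 tor this ne]
    obtain p k where p: "prime p" "p \<le> E" "k > 0" "q dvd p ^ k - 1" "p ^ k \<le> card (fixed_by L)" by blast
    have "2 ^ k \<le> p ^ k" by (rule power_mono[OF prime_ge_2_nat[OF p(1)]]) simp
    hence "2 ^ k \<le> card (fixed_by L)" using p(5) by (rule order_trans)
    have "(2::real) ^ k = real (2 ^ k)" by simp
    also have "\<dots> \<le> real (card (fixed_by L))" using \<open>2 ^ k \<le> card (fixed_by L)\<close> by (rule of_nat_mono)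
    also note card
    finally have "(2::real) ^ k \<le> K ^ s" .
    hence "ln ((2::real) ^ k) \<le> ln (K ^ s)" by (intro ln_mono) auto
    hence "real k * ln 2 \<le> real s * ln K" using K1 by (simp add: ln_realpow)
    hence "real k \<le> (ln K / ln 2) * real s" by (simp add: pos_le_divide_eq mult.commute)
    also have "\<dots> \<le> C * sqrt (real q)" unfolding C_def using n(4) K1 by (intro mult_mono) auto
    finally show ?thesis using p by blast
  qed
  show ?thesis by (rule that[OF E0 C main])
qed

end

theorem theorem1p3:
  fixes \<alpha> :: "int^'d \<Rightarrow> 'a::{metric_space, topological_ab_group_add} \<Rightarrow> 'a"
  assumes "CARD('d) \<ge> 2"
    and "compact (UNIV :: 'a set)"
    and "zero_dim_space (UNIV :: 'a set)"
    and "cont_aut_action \<alpha>"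
    and "mixing_action \<alpha>"
    and "noetherian_action \<alpha>"
    and "entropy_rank_one \<alpha>"
  shows "(\<exists>Q \<delta>. Q \<subseteq> {p. prime p} \<and> prime_density Q \<delta> \<and> \<delta> > 0 \<and>
            finite {fix_count \<alpha> L | L. L \<in> finite_index_subgroups \<and> index_Zd L \<in> Q})
       \<and> (CARD('d) \<ge> 3 \<longrightarrow>
          (\<exists>Q. Q \<subseteq> {p. prime p} \<and> prime_density Q 1 \<and>
            finite {fix_count \<alpha> L | L. L \<in> finite_index_subgroups \<and> index_Zd L \<in> Q}))"
proof -
  interpret zd_action \<alpha> using assms(2,3,4) by unfold_locales
  obtain E C where E: "E > 0" and C: "C > 0" and main:
    "\<And>L q. subgrp L \<Longrightarrow> prime q \<Longrightarrow> idx UNIV L = q \<Longrightarrow> q > E \<Longrightarrow> fixed_by L \<noteq> fixed_by UNIV \<Longrightarrow>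
      \<exists>p k. prime p \<and> p \<le> E \<and> k > 0 \<and> real k \<le> C * sqrt (real q) \<and> q dvd p ^ k - 1"
    using fixed_points_exceptional_primes[OF assms(1,5,6,7)] by blast
  \<comment> \<open>One sequence for all primes p \<le> \<open>E\<close> at once: p^k - 1 divides
    \<open>W k\<close>. The product starts at 2 because a = 1 would make it vanish.\<close>
  define W where "W = (\<lambda>k. \<Prod>a=2..E. a ^ k - 1 :: nat)"
  \<comment> \<open>The summand 1 ensures \<open>A\<close> > 1 also when \<open>E\<close> is
    1.\<close>
  define A where "A = real (fact E) + 1"
  define B where "B = {q. q \<le> E \<or> (\<exists>k>0. real k \<le> C * sqrt (real q) \<and> k dvd q - 1 \<and> q dvd W k)}"
  define Q where "Q = {q. prime q \<and> q \<notin> B}"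
  have W: "W k > 0 \<and> real (W k) \<le> A ^ k" if k: "k > 0" for k
  proof
    have "a ^ k - 1 > 0" if "a \<in> {2..E}" for a using that k one_less_power[of a k] by simp
    thus "W k > 0" unfolding W_def by (intro prod_pos) auto
    have "W k \<le> (\<Prod>a=2..E. a ^ k)" unfolding W_def by (intro prod_mono) auto
    also have "\<dots> = (\<Prod>a=2..E. a) ^ k" by (rule prod_power_distrib[symmetric])
    also have "\<dots> \<le> fact E ^ k"
    proof (rule power_mono)
      show "\<Prod>{2..E} \<le> fact E" unfolding fact_prod of_nat_id
        by (rule dvd_imp_le[OF prod_dvd_prod_subset]) (auto intro: prod_pos)
    qed simp
    finally have "real (W k) \<le> real (fact E ^ k)" by (rule of_nat_mono)
    also have "\<dots> \<le> A ^ k" unfolding A_def of_nat_power by (rule power_mono) auto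
    finally show "real (W k) \<le> A ^ k" .
  qed
  have sparse: "\<forall>\<^sub>F N in sequentially. real (card {q\<in>B. prime q \<and> q \<le> N}) \<le> \<epsilon> * (real N / ln (real N))"
    if \<epsilon>: "\<epsilon> > 0" for \<epsilon>
  proof -
    have 1: "\<forall>\<^sub>F N in sequentially. real E + 1 \<le> \<epsilon> / 2 * (real N / ln (real N))" using \<epsilon> by real_asymp
    have "\<forall>\<^sub>F N in sequentially. real (card {q. prime q \<and> q \<le> N \<and>
      (\<exists>k>0. real k \<le> C * sqrt (real q) \<and> k dvd q - 1 \<and> q dvd W k)}) \<le> 8 * (\<epsilon> / 16) * (real N / ln (real N))"
      using C \<epsilon> by (intro card_sqrt_divisor_primes[of W A] W) (auto simp: A_def)
    thus ?thesis using 1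
    proof eventually_elim
      case (elim N)
      let ?S = "{q. prime q \<and> q \<le> N \<and> (\<exists>k>0. real k \<le> C * sqrt (real q) \<and> k dvd q - 1 \<and> q dvd W k)}"
      have "{q\<in>B. prime q \<and> q \<le> N} \<subseteq> {..E} \<union> ?S" by (auto simp: B_def)
      hence "card {q\<in>B. prime q \<and> q \<le> N} \<le> card ({..E} \<union> ?S)" by (intro card_mono) auto
      also have "\<dots> \<le> card {..E} + card ?S" by (rule card_Un_le)
      finally have "real (card {q\<in>B. prime q \<and> q \<le> N}) \<le> real E + 1 + real (card ?S)" by simp
      thus ?case using elim by simp
    qed
  qed
  have density: "prime_density Q 1" unfolding Q_def by (rule prime_density_one[OF sparse])
  have const: "fix_count \<alpha> L = fix_count \<alpha> UNIV" if L: "L \<in> finite_index_subgroups" "index_Zd L \<in> Q" for L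
  proof -
    define q where "q = index_Zd L"
    have sL: "subgrp L" using L(1) by (simp add: finite_index_subgroups_def subgroup_Zd_eq)
    have q: "prime q" "q \<notin> B" "idx UNIV L = q"
      using L(2) by (simp_all add: Q_def q_def index_Zd_def cosets_Zd_eq idx_def)
    have qE: "q > E" using q(2) by (simp add: B_def)
    have "fixed_by L = fixed_by UNIV"
    proof (rule ccontr)
      assume "fixed_by L \<noteq> fixed_by UNIV"
      from main[OF sL q(1,3) qE this] obtain p k where p: "prime p" "p \<le> E" "k > 0" "real k \<le> C * sqrt (real q)" "q dvd p ^ k - 1"
        by blast
      \<comment> \<open>The exponent k need not divide q - 1, but the order of p modulo q does, and
        it is at most k.\<close>
      define r where "r = ord q p"
      have p2: "p \<ge> 2" using p(1) by (rule prime_ge_2_nat)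
      have "\<not> q dvd p" using p(2) p2 qE by (auto dest: dvd_imp_le)
      hence cop: "coprime q p" using q(1) by (rule prime_imp_coprime[rotated])
      have "[p ^ k = 1] (mod q)" using p(5) p2 by (subst cong_altdef_nat) (auto intro: one_le_power)
      hence "r dvd k" unfolding r_def by (simp only: ord_divides)
      hence rk: "r \<le> k" using p(3) by (rule dvd_imp_le)
      have r0: "r > 0" unfolding r_def using cop by (simp add: ord_eq_0)
      have "r dvd totient q" unfolding r_def using cop by (rule order_divides_totient)
      hence r1: "r dvd q - 1" using q(1) by (simp add: totient_prime)
      have "[p ^ r = 1] (mod q)" unfolding r_def by (rule ord)
      hence "q dvd p ^ r - 1" by (rule cong_to_1_nat)
      also have "p ^ r - 1 dvd W r" unfolding W_def using p2 p(2)
        by (intro dvd_prodI[of "{2..E}" p "\<lambda>a. a ^ r - 1"]) auto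
      finally have "q dvd W r" .
      moreover have "real r \<le> C * sqrt (real q)" using rk p(4) by simp
      ultimately have "q \<in> B" using r0 r1 by (auto simp: B_def)
      thus False using q(2) by blast
    qed
    thus ?thesis by (simp add: fix_count_def fixed_by_def Let_def)
  qed
  have "{fix_count \<alpha> L | L. L \<in> finite_index_subgroups \<and> index_Zd L \<in> Q} \<subseteq> {fix_count \<alpha> UNIV}"
    using const by blast
  hence fin: "finite {fix_count \<alpha> L | L. L \<in> finite_index_subgroups \<and> index_Zd L \<in> Q}"
    by (rule finite_subset) simp
  have sub: "Q \<subseteq> {p. prime p}" by (auto simp: Q_def)
  \<comment> \<open>The same \<open>Q\<close>, of density 1, answers both claims.\<close>
  show ?thesis
    using density fin sub zero_less_one by blast
qed

end
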